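(* Let $S=\mathbb{C}[x_0,\dots,x_n]$ and let ${\bf f}=(f_0,\dots,f_n)$ be a collection of $n+1$ homogeneous polynomials, all in $S_e$ for some degree $e>0$. Assume that the ideal $J_{\bf f}=(f_0,\dots,f_n)$ in $S$ is a 1-dimensional complete intersection, i.e. $\dim S/J_{\bf f}=1$ and $(f_1,\dots,f_n)$ is a regular sequence in $S$. Then $$ER({\bf f})_m=0 \quad\text{for any } m \leq n(e-1)-\sum_{p\in |Y({\bf f})|} o(m_p).$$
   Context: $S$ carries the standard grading $S=\oplus_k S_k$. $AR({\bf f})$ is the graded $S$-module of syzygies: $AR({\bf f})_m$ is the space of $(a_0,\dots,a_n)\in S_m^{n+1}$ with $a_0f_0+\dots+a_nf_n=0$. $KR({\bf f})\subset AR({\bf f})$ is the graded submodule generated by the Koszul relations (the tuples with $f_j$ in position $i$, $-f_i$ in position $j$, and $0$ elsewhere, $i<j$), and $ER({\bf f})=AR({\bf f})/KR({\bf f})$. $Y({\bf f})$ is the 0-dimensional subscheme of $\mathbb{P}^n$ defined by the ideal $J_{\bf f}$, and $|Y({\bf f})|$ is its support. For $p\in|Y({\bf f})|$, $m_p$ is the maximal ideal of the Artinian local ring $\mathcal{O}_{Y({\bf f}),p}$, and its order $o(m_p)$ is the smallest integer $k>0$ such that $m_p^k=0$ in $\mathcal{O}_{Y({\bf f}),p}$. *)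

theory Defs
  imports
    "HOL-Algebra.QuotRing"
    "HOL-Algebra.Ideal_Product"
    "HOL-Algebra.Module"
    "HOL-Library.Poly_Mapping"
    "HOL-Library.Extended_Nat"
    "HOL-Computational_Algebra.Fraction_Field"
    Complex_Main
begin

section \<open>The graded polynomial ring\<close>

text \<open>Exponent vectors are finitely supported functions on the variable indices; the
  variables \<open>x\<^sub>i\<close> are indexed by all natural numbers, and \<open>poly_S n\<close> is the subring of
  polynomials in \<open>x\<^sub>0, \<dots>, x\<^sub>n\<close>.\<close>

type_synonym mpoly = "(nat \<Rightarrow>\<^sub>0 nat) \<Rightarrow>\<^sub>0 complex"

definition poly_S :: "nat \<Rightarrow> mpoly ring" where
  "poly_S n = \<lparr>carrier = {p. \<forall>t\<in>Poly_Mapping.keys p. Poly_Mapping.keys t \<subseteq> {..n}},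
     monoid.mult = (*), monoid.one = 1, ring.zero = 0, ring.add = (+)\<rparr>"

definition mon_deg :: "(nat \<Rightarrow>\<^sub>0 nat) \<Rightarrow> nat" where
  "mon_deg t = (\<Sum>i\<in>Poly_Mapping.keys t. Poly_Mapping.lookup t i)"

text \<open>The grading is indexed by the integers, with \<open>S\<^sub>d = 0\<close> for \<open>d < 0\<close>. The zero polynomial
  lies in every \<open>S\<^sub>d\<close>.\<close>

definition S_part :: "nat \<Rightarrow> int \<Rightarrow> mpoly set" where
  "S_part n d = {p \<in> carrier (poly_S n). \<forall>t\<in>Poly_Mapping.keys p. int (mon_deg t) = d}"

definition homogeneous_ideal :: "nat \<Rightarrow> mpoly set \<Rightarrow> bool" where
  "homogeneous_ideal n I \<longleftrightarrow>
     ideal I (poly_S n) \<and> I = genideal (poly_S n) (I \<inter> (\<Union>d. S_part n d))"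

definition irrelevant_ideal :: "nat \<Rightarrow> mpoly set" where
  "irrelevant_ideal n = genideal (poly_S n) (\<Union>d\<in>{0<..}. S_part n d)"

definition J_ideal :: "nat \<Rightarrow> (nat \<Rightarrow> mpoly) \<Rightarrow> mpoly set" where
  "J_ideal n f = genideal (poly_S n) (f ` {..n})"


section \<open>Commutative algebra\<close>

text \<open>The supremum of the lengths of strict chains of prime ideals; it is \<open>0\<close> for the zero ring.\<close>

definition krull_dim :: "('a, 'b) ring_scheme \<Rightarrow> enat" where
  "krull_dim R = Sup {enat k | k. \<exists>P :: nat \<Rightarrow> 'a set.
     (\<forall>i\<le>k. primeideal (P i) R) \<and> (\<forall>i<k. P i \<subset> P (Suc i))}"

text \<open>Each entry is a non-zero-divisor modulo the preceding ones, and all of them together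
  generate a proper ideal.\<close>

definition regular_sequence :: "('a, 'b) ring_scheme \<Rightarrow> 'a list \<Rightarrow> bool" where
  "regular_sequence R fs \<longleftrightarrow> set fs \<subseteq> carrier R \<and>
     (\<forall>i<length fs. \<forall>g\<in>carrier R.
        fs ! i \<otimes>\<^bsub>R\<^esub> g \<in> genideal R (set (take i fs)) \<longrightarrow> g \<in> genideal R (set (take i fs))) \<and>
     genideal R (set fs) \<noteq> carrier R"

primrec ideal_power :: "('a, 'b) ring_scheme \<Rightarrow> 'a set \<Rightarrow> nat \<Rightarrow> 'a set" where
  "ideal_power R I 0 = carrier R"
| "ideal_power R I (Suc k) = ideal_prod R I (ideal_power R I k)"

definition ideal_order :: "('a, 'b) ring_scheme \<Rightarrow> 'a set \<Rightarrow> nat" where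
  "ideal_order R I = (LEAST k. 0 < k \<and> ideal_power R I k = {\<zero>\<^bsub>R\<^esub>})"

text \<open>Only meaningful for local rings.\<close>

definition the_maximal_ideal :: "('a, 'b) ring_scheme \<Rightarrow> 'a set" where
  "the_maximal_ideal R = (THE M. maximalideal M R)"


section \<open>The subscheme of projective space defined by the ideal\<close>

text \<open>Points of projective space are the homogeneous primes not containing the irrelevant
  ideal. The support of \<open>Y(f)\<close> consists of those containing \<open>J\<^sub>f\<close>; when \<open>Y(f)\<close> has dimension 0,
  all of them are closed points.\<close>

definition Proj_points :: "nat \<Rightarrow> mpoly set set" where
  "Proj_points n = {P. primeideal P (poly_S n) \<and> homogeneous_ideal n P \<and>
     \<not> irrelevant_ideal n \<subseteq> P}"

definition Y_support :: "nat \<Rightarrow> (nat \<Rightarrow> mpoly) \<Rightarrow> mpoly set set" where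
  "Y_support n f = {P \<in> Proj_points n. J_ideal n f \<subseteq> P}"

text \<open>The stalk at \<open>P\<close> of the sheaf associated with a homogeneous ideal \<open>I\<close>, i.e. the degree 0
  part of the localization of \<open>I\<close> at the homogeneous elements outside \<open>P\<close>, realized inside the
  field of fractions of the polynomial ring. For \<open>I = S\<close> this is the local ring of projective
  space at \<open>P\<close>.\<close>

definition hom_localization :: "nat \<Rightarrow> mpoly set \<Rightarrow> mpoly set \<Rightarrow> mpoly fract set" where
  "hom_localization n P I =
     {Fract a s | a s d. a \<in> I \<inter> S_part n d \<and> s \<in> S_part n d \<and> s \<notin> P}"

definition local_ring_Proj :: "nat \<Rightarrow> mpoly set \<Rightarrow> mpoly fract ring" where
  "local_ring_Proj n P = \<lparr>carrier = hom_localization n P (carrier (poly_S n)),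
     monoid.mult = (*), monoid.one = 1, ring.zero = 0, ring.add = (+)\<rparr>"

definition local_ring_Y ::
    "nat \<Rightarrow> (nat \<Rightarrow> mpoly) \<Rightarrow> mpoly set \<Rightarrow> mpoly fract set ring" where
  "local_ring_Y n f P = local_ring_Proj n P Quot hom_localization n P (J_ideal n f)"

definition point_order :: "nat \<Rightarrow> (nat \<Rightarrow> mpoly) \<Rightarrow> mpoly set \<Rightarrow> nat" where
  "point_order n f P =
     ideal_order (local_ring_Y n f P) (the_maximal_ideal (local_ring_Y n f P))"


section \<open>Syzygies\<close>

text \<open>The free module \<open>S\<^sup>n\<^sup>+\<^sup>1\<close>; tuples \<open>(a\<^sub>0, \<dots>, a\<^sub>n)\<close> are functions vanishing beyond \<open>n\<close>. The
  \<open>mult\<close> and \<open>one\<close> fields of the module record play no role.\<close>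

definition free_S :: "nat \<Rightarrow> (mpoly, nat \<Rightarrow> mpoly) module" where
  "free_S n = \<lparr>carrier = {a. (\<forall>i\<le>n. a i \<in> carrier (poly_S n)) \<and> (\<forall>i>n. a i = 0)},
     monoid.mult = (\<lambda>a b i. a i * b i), monoid.one = (\<lambda>i. if i \<le> n then 1 else 0),
     ring.zero = (\<lambda>i. 0), ring.add = (\<lambda>a b i. a i + b i), smult = (\<lambda>r a i. r * a i)\<rparr>"

definition AR :: "nat \<Rightarrow> (nat \<Rightarrow> mpoly) \<Rightarrow> (mpoly, nat \<Rightarrow> mpoly) module" where
  "AR n f = (free_S n)\<lparr>carrier := {a \<in> carrier (free_S n). (\<Sum>i\<le>n. a i * f i) = 0}\<rparr>"

definition AR_part :: "nat \<Rightarrow> (nat \<Rightarrow> mpoly) \<Rightarrow> int \<Rightarrow> (nat \<Rightarrow> mpoly) set" where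
  "AR_part n f m = {a \<in> carrier (AR n f). \<forall>i\<le>n. a i \<in> S_part n m}"

definition koszul :: "(nat \<Rightarrow> mpoly) \<Rightarrow> nat \<Rightarrow> nat \<Rightarrow> nat \<Rightarrow> mpoly" where
  "koszul f i j = (\<lambda>k. if k = i then f j else if k = j then - f i else 0)"

definition KR :: "nat \<Rightarrow> (nat \<Rightarrow> mpoly) \<Rightarrow> (nat \<Rightarrow> mpoly) set" where
  "KR n f = \<Inter>{N. submodule N (poly_S n) (AR n f) \<and> {koszul f i j | i j. i < j \<and> j \<le> n} \<subseteq> N}"

text \<open>The quotient group; it is written multiplicatively, so its zero element \<open>KR n f\<close> is
  denoted \<open>\<one>\<close>.\<close>

definition ER :: "nat \<Rightarrow> (nat \<Rightarrow> mpoly) \<Rightarrow> (nat \<Rightarrow> mpoly) set monoid" where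
  "ER n f = AR n f A_Mod KR n f"

text \<open>The degree \<open>m\<close> part of the quotient: the image of the degree \<open>m\<close> part of \<open>AR(f)\<close>.\<close>

definition ER_part :: "nat \<Rightarrow> (nat \<Rightarrow> mpoly) \<Rightarrow> int \<Rightarrow> (nat \<Rightarrow> mpoly) set set" where
  "ER_part n f m = (\<lambda>a. KR n f +>\<^bsub>AR n f\<^esub> a) ` AR_part n f m"

end

theory Submission
  imports Defs
    "HOL-Computational_Algebra.Fundamental_Theorem_Algebra"
    "HOL-Analysis.Continuum_Not_Denumerable"
begin

text \<open>Let \<open>I = (f\<^sub>1, \<dots>, f\<^sub>n)\<close> and \<open>\<sigma> = n (e - 1)\<close>. A syzygy is determined modulo the Koszul
  relations by its first entry \<open>a\<close> modulo \<open>I\<close>, and \<open>a J \<subseteq> I\<close>; so it has to be shown that \<open>a \<in> I\<close>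
  when the degree of \<open>a\<close> is at most \<open>\<sigma> - N\<close>, where \<open>N\<close> is the sum of the orders of the points.

  Exchanging the \<open>f\<^sub>i\<close> for variables, one at a time, shows that \<open>S/I\<close> has no socle, so that a
  generic linear form \<open>l\<close> is a nonzerodivisor on it, and that \<open>S/(I, l)\<close> has finite length with
  its socle concentrated in degree \<open>\<sigma>\<close>. At a point, every variable is a multiple of \<open>l\<close> modulo
  linear forms vanishing there. Hence a monomial of degree \<open>N\<close> is congruent modulo \<open>l\<close> to a
  product \<open>h\<close> of linear forms that contains, for each point, as many factors vanishing there as
  its order. As \<open>h\<close> lies in \<open>J\<close> locally at each point, some power of \<open>l\<close> carries \<open>a h\<close> into \<open>I\<close>,
  and thus \<open>a h \<in> I\<close>. Therefore \<open>a\<close> is killed by \<open>S\<^sub>N\<close> modulo \<open>(I, l)\<close>; were it nonzero there, a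
  multiple of it in degree less than \<open>\<sigma>\<close> would lie in the socle. So \<open>a \<in> (I, l)\<close>, and dividing
  by \<open>l\<close> one concludes by induction on the degree.\<close>

section \<open>Homogeneous polynomials\<close>

text \<open>The value \<sigma> comes from comparing (f_1, ..., f_n, l) with (x_0, ..., x_n):
  exchanging regular sequences shifts the socle by the difference of the sums of degrees, and the
  quotient by all variables has its socle in degree 0, so \<sigma> = (n e + 1) - (n + 1). The
  inclusion a J \<subseteq> I is the syzygy itself, because a f_0 = -(a_1 f_1 + ... + a_n f_n). It
  links algebra to geometry: (I : a h) contains J, so a relevant prime over it is a point of Y;
  there h lies in J up to a factor t outside the prime, and t a h \<in> I puts t into the prime
  after all. The order of a point is the number of linear forms through it whose product is sure to
  vanish in the local ring, whence the sum N. Dividing by l preserves the setting: a = k + r l with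
  k \<in> I gives r J \<subseteq> I again. The obstacle is to obtain l and the socle degree without
  unmixedness or prime avoidance; both come from dimension counts in single graded pieces, which is
  why ideals are handled degree by degree.\<close>

definition var :: "nat \<Rightarrow> mpoly" where
  "var i = Poly_Mapping.single (Poly_Mapping.single i 1) 1"

definition const :: "complex \<Rightarrow> mpoly" where
  "const c = Poly_Mapping.single 0 c"

lemma const_0 [simp]: "const 0 = 0"
  and const_1 [simp]: "const 1 = 1"
  and const_add: "const (a + b) = const a + const b"
  and const_diff: "const (a - b) = const a - const b"
  and const_uminus: "const (- a) = - const a"
  and const_mult: "const (a * b) = const a * const b"
  by (simp_all add: const_def single_add single_diff single_uminus mult_single)

lemma lookup_const_mult [simp]:
  "Poly_Mapping.lookup (const c * p) t = c * Poly_Mapping.lookup p t"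
proof -
  have "const c * p = Poly_Mapping.map ((*) c) p"
    by (simp add: mult_map_scale_conv_mult const_def)
  then show ?thesis by (simp add: Poly_Mapping.map.rep_eq when_def)
qed

lemma const_inverse_mult: "c \<noteq> 0 \<Longrightarrow> const (inverse c) * (const c * p) = p"
  by (simp add: mult.assoc[symmetric] const_mult[symmetric])

lemma mpoly_expand: "p = (\<Sum>t\<in>Poly_Mapping.keys p. Poly_Mapping.single t (Poly_Mapping.lookup p t))"
proof (rule poly_mapping_eqI)
  fix t
  show "Poly_Mapping.lookup p t =
    Poly_Mapping.lookup (\<Sum>t\<in>Poly_Mapping.keys p. Poly_Mapping.single t (Poly_Mapping.lookup p t)) t"
    by (auto simp: lookup_sum lookup_single when_def in_keys_iff sum.delta)
qed

lemma single_eq_const_mult: "Poly_Mapping.single t c = const c * Poly_Mapping.single t 1"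
  by (simp add: const_def mult_single)

lemma carrier_poly_S_iff:
  "p \<in> carrier (poly_S n) \<longleftrightarrow> (\<forall>t\<in>Poly_Mapping.keys p. Poly_Mapping.keys t \<subseteq> {..n})"
  by (simp add: poly_S_def)

lemma keys_add_nat: "Poly_Mapping.keys (s + t :: nat \<Rightarrow>\<^sub>0 nat) = Poly_Mapping.keys s \<union> Poly_Mapping.keys t"
  by (auto simp: in_keys_iff lookup_add)

lemma keys_mpoly_uminus: "Poly_Mapping.keys (- p :: mpoly) = Poly_Mapping.keys p"
  by (auto simp: in_keys_iff)

lemma mon_deg_superset:
  assumes "finite A" "Poly_Mapping.keys t \<subseteq> A"
  shows "mon_deg t = (\<Sum>i\<in>A. Poly_Mapping.lookup t i)"
  unfolding mon_deg_def by (rule sum.mono_neutral_left) (use assms in \<open>auto simp: in_keys_iff\<close>)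

lemma mon_deg_add: "mon_deg (s + t) = mon_deg s + mon_deg t"
proof -
  let ?A = "Poly_Mapping.keys s \<union> Poly_Mapping.keys t"
  have "mon_deg (s + t) = (\<Sum>i\<in>?A. Poly_Mapping.lookup s i + Poly_Mapping.lookup t i)"
    by (subst mon_deg_superset[of ?A]) (auto simp: keys_add_nat lookup_add)
  also have "\<dots> = mon_deg s + mon_deg t"
    by (simp add: sum.distrib mon_deg_superset[of ?A])
  finally show ?thesis .
qed

lemma mon_deg_0 [simp]: "mon_deg 0 = 0"
  by (simp add: mon_deg_def)

lemma mon_deg_eq_0_iff: "mon_deg t = 0 \<longleftrightarrow> t = 0"
  by (auto simp: mon_deg_def in_keys_iff intro!: poly_mapping_eqI)

lemma mon_deg_single [simp]: "mon_deg (Poly_Mapping.single i k) = k"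
  by (simp add: mon_deg_def)

lemma poly_S_simps [simp]:
  "monoid.mult (poly_S n) = (*)" "monoid.one (poly_S n) = 1"
  "ring.zero (poly_S n) = 0" "ring.add (poly_S n) = (+)"
  by (simp_all add: poly_S_def)

lemma poly_S_closed:
  shows poly_S_zero: "0 \<in> carrier (poly_S n)"
    and poly_S_one: "1 \<in> carrier (poly_S n)"
    and poly_S_add: "p \<in> carrier (poly_S n) \<Longrightarrow> q \<in> carrier (poly_S n) \<Longrightarrow> p + q \<in> carrier (poly_S n)"
    and poly_S_uminus: "p \<in> carrier (poly_S n) \<Longrightarrow> - p \<in> carrier (poly_S n)"
    and poly_S_mult: "p \<in> carrier (poly_S n) \<Longrightarrow> q \<in> carrier (poly_S n) \<Longrightarrow> p * q \<in> carrier (poly_S n)"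
proof -
  show "0 \<in> carrier (poly_S n)" "1 \<in> carrier (poly_S n)" by (auto simp: carrier_poly_S_iff)
  assume p: "p \<in> carrier (poly_S n)"
  then show "- p \<in> carrier (poly_S n)" by (auto simp: carrier_poly_S_iff keys_mpoly_uminus)
  assume q: "q \<in> carrier (poly_S n)"
  show "p + q \<in> carrier (poly_S n)"
    using p q keys_add[of p q] unfolding carrier_poly_S_iff by blast
  show "p * q \<in> carrier (poly_S n)"
    unfolding carrier_poly_S_iff
  proof
    fix t assume "t \<in> Poly_Mapping.keys (p * q)"
    then obtain a b where "t = a + b" "a \<in> Poly_Mapping.keys p" "b \<in> Poly_Mapping.keys q"
      using keys_mult[of p q] by blast
    then show "Poly_Mapping.keys t \<subseteq> {..n}"
      using p q by (auto simp: carrier_poly_S_iff keys_add_nat)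
  qed
qed

lemma poly_S_diff: "p \<in> carrier (poly_S n) \<Longrightarrow> q \<in> carrier (poly_S n) \<Longrightarrow> p - q \<in> carrier (poly_S n)"
  using poly_S_add[of p n "- q"] poly_S_uminus[of q n] by simp

lemma poly_S_sum: "(\<And>a. a \<in> A \<Longrightarrow> g a \<in> carrier (poly_S n)) \<Longrightarrow> sum g A \<in> carrier (poly_S n)"
  by (induction A rule: infinite_finite_induct) (auto intro: poly_S_closed)

lemma cring_poly_S: "cring (poly_S n)"
proof (rule cringI)
  show "abelian_group (poly_S n)"
    by (rule abelian_groupI)
      (auto intro: poly_S_closed simp: add.assoc add.commute
        intro!: bexI[of _ "- x" for x, OF _ poly_S_uminus])
  show "comm_monoid (poly_S n)"
    by (rule comm_monoidI) (auto intro: poly_S_closed simp: mult.assoc mult.commute)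
qed (auto simp: algebra_simps)

lemma ring_poly_S: "ring (poly_S n)"
  using cring_poly_S by (simp add: cring_def)

lemma S_part_iff:
  "p \<in> S_part n d \<longleftrightarrow>
    (\<forall>t\<in>Poly_Mapping.keys p. Poly_Mapping.keys t \<subseteq> {..n} \<and> int (mon_deg t) = d)"
  by (auto simp: S_part_def carrier_poly_S_iff)

lemma S_part_carrier: "p \<in> S_part n d \<Longrightarrow> p \<in> carrier (poly_S n)"
  by (simp add: S_part_def)

lemma S_part_0 [simp]: "0 \<in> S_part n d"
  by (simp add: S_part_iff)

lemma S_part_add: "p \<in> S_part n d \<Longrightarrow> q \<in> S_part n d \<Longrightarrow> p + q \<in> S_part n d"
  using keys_add[of p q] unfolding S_part_iff by blast

lemma S_part_uminus: "p \<in> S_part n d \<Longrightarrow> - p \<in> S_part n d"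
  by (auto simp: S_part_iff keys_mpoly_uminus)

lemma S_part_diff: "p \<in> S_part n d \<Longrightarrow> q \<in> S_part n d \<Longrightarrow> p - q \<in> S_part n d"
  using S_part_add[of p n d "- q"] S_part_uminus[of q n d] by simp

lemma S_part_sum: "(\<And>a. a \<in> A \<Longrightarrow> g a \<in> S_part n d) \<Longrightarrow> sum g A \<in> S_part n d"
  by (induction A rule: infinite_finite_induct) (auto intro: S_part_add)

lemma S_part_mult:
  assumes "p \<in> S_part n d" "q \<in> S_part n e"
  shows "p * q \<in> S_part n (d + e)"
  unfolding S_part_iff
proof
  fix t assume "t \<in> Poly_Mapping.keys (p * q)"
  then obtain a b where "t = a + b" "a \<in> Poly_Mapping.keys p" "b \<in> Poly_Mapping.keys q"
    using keys_mult[of p q] by blast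
  then show "Poly_Mapping.keys t \<subseteq> {..n} \<and> int (mon_deg t) = d + e"
    using assms by (auto simp: S_part_iff keys_add_nat mon_deg_add)
qed

lemma S_part_mult': "p \<in> S_part n d \<Longrightarrow> q \<in> S_part n e \<Longrightarrow> k = d + e \<Longrightarrow> p * q \<in> S_part n k"
  using S_part_mult by blast

lemma const_S_part [simp]: "const c \<in> S_part n 0"
  by (simp add: S_part_iff const_def)

lemma one_S_part [simp]: "1 \<in> S_part n 0"
  using const_S_part[of 1 n] by simp

lemma S_part_const_mult: "p \<in> S_part n d \<Longrightarrow> const c * p \<in> S_part n d"
  using S_part_mult[OF const_S_part] by force

lemma var_S_part: "i \<le> n \<Longrightarrow> var i \<in> S_part n 1"
  by (simp add: S_part_iff var_def)

lemma S_part_power: "p \<in> S_part n d \<Longrightarrow> p ^ k \<in> S_part n (int k * d)"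
  by (induction k) (auto intro: S_part_mult' simp: algebra_simps)

lemma S_part_power1: "p \<in> S_part n 1 \<Longrightarrow> p ^ k \<in> S_part n (int k)"
  using S_part_power[of p n 1 k] by simp

lemma S_part_prod:
  "(\<And>a. a \<in> A \<Longrightarrow> g a \<in> S_part n 1) \<Longrightarrow> prod g A \<in> S_part n (int (card A))"
  by (induction A rule: infinite_finite_induct) (auto intro: S_part_mult')

lemma S_part_neg: "p \<in> S_part n d \<Longrightarrow> d < 0 \<Longrightarrow> p = 0"
  by (metis S_part_iff keys_eq_empty equals0I of_nat_0_le_iff not_less)

lemma S_part_distinct_degrees: "p \<in> S_part n d \<Longrightarrow> p \<in> S_part n e \<Longrightarrow> d \<noteq> e \<Longrightarrow> p = 0"
  by (metis S_part_iff keys_eq_empty equals0I)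

text \<open>The factors are indexed by an arbitrary finite set of the right size, since later every
  factor of a monomial is assigned to a pair of a point and a number below its order.\<close>

lemma monomial_eq_prod_var:
  assumes "finite A" "Poly_Mapping.keys t \<subseteq> {..n}" "mon_deg t = card A"
  shows "\<exists>v. (\<forall>a\<in>A. v a \<le> n) \<and> Poly_Mapping.single t 1 = (\<Prod>a\<in>A. var (v a))"
  using assms
proof (induction A arbitrary: t rule: finite_induct)
  case empty
  then have "t = 0" by (simp add: mon_deg_eq_0_iff)
  then show ?case by simp
next
  case (insert b A)
  then have "t \<noteq> 0" by (auto simp flip: mon_deg_eq_0_iff)
  then obtain i where i: "i \<in> Poly_Mapping.keys t"
    by (metis poly_mapping_eqI lookup_zero in_keys_iff)
  define s where "s = t - Poly_Mapping.single i 1"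
  have t: "t = Poly_Mapping.single i 1 + s"
    unfolding s_def by (rule poly_mapping_eqI)
      (use i in \<open>auto simp: lookup_add lookup_minus lookup_single when_def in_keys_iff\<close>)
  have "Poly_Mapping.keys s \<subseteq> {..n}" "mon_deg s = card A" "i \<le> n"
    using insert.prems insert.hyps i unfolding t by (auto simp: keys_add_nat mon_deg_add)
  then obtain v where v: "\<forall>a\<in>A. v a \<le> n" "Poly_Mapping.single s 1 = (\<Prod>a\<in>A. var (v a))"
    using insert.IH by blast
  have "Poly_Mapping.single t 1 = var i * Poly_Mapping.single s 1"
    unfolding var_def t by (simp add: mult_single)
  also have "\<dots> = (\<Prod>a\<in>insert b A. var ((v(b := i)) a))"
    unfolding v(2) using insert.hyps by (auto intro!: prod.cong)
  finally show ?case using v(1) \<open>i \<le> n\<close> by (intro exI[of _ "v(b := i)"]) auto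
qed

lemma S_part_induct [consumes 1, case_names monomial zero add smult]:
  assumes "p \<in> S_part n d"
    and "\<And>t. Poly_Mapping.keys t \<subseteq> {..n} \<Longrightarrow> int (mon_deg t) = d \<Longrightarrow> P (Poly_Mapping.single t 1)"
    and "P 0" "\<And>p q. P p \<Longrightarrow> P q \<Longrightarrow> P (p + q)" "\<And>c p. P p \<Longrightarrow> P (const c * p)"
  shows "P p"
proof -
  have sum: "P (sum g A)" if "\<And>a. a \<in> A \<Longrightarrow> P (g a)" for g and A :: "(nat \<Rightarrow>\<^sub>0 nat) set"
    using that by (induction A rule: infinite_finite_induct) (auto intro: assms)
  have "P (\<Sum>t\<in>Poly_Mapping.keys p. Poly_Mapping.single t (Poly_Mapping.lookup p t))"
    using assms(1) by (intro sum, subst single_eq_const_mult) (auto simp: S_part_iff intro: assms)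
  then show ?thesis using mpoly_expand[of p] by simp
qed

section \<open>Finite dimension of the graded pieces and linear dependence\<close>

lemma finite_monomials: "finite {t. Poly_Mapping.keys t \<subseteq> {..n} \<and> mon_deg t = d}"
proof -
  have "{t. Poly_Mapping.keys t \<subseteq> {..n} \<and> mon_deg t = d} \<subseteq>
      (\<lambda>v. \<Sum>a<d. Poly_Mapping.single (v a) 1) ` ({..<d} \<rightarrow>\<^sub>E {..n})"
  proof
    fix t assume "t \<in> {t. Poly_Mapping.keys t \<subseteq> {..n} \<and> mon_deg t = d}"
    then obtain v where v: "\<forall>a\<in>{..<d}. v a \<le> n" "Poly_Mapping.single t (1::complex) = (\<Prod>a<d. var (v a))"
      using monomial_eq_prod_var[of "{..<d}" t n] by auto
    have "(\<Prod>a\<in>A. var (v a)) = Poly_Mapping.single (\<Sum>a\<in>A. Poly_Mapping.single (v a) 1) 1"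
      if "finite A" for A using that by induction (auto simp: var_def mult_single)
    with v have "Poly_Mapping.single t (1::complex) =
        Poly_Mapping.single (\<Sum>a<d. Poly_Mapping.single (v a) 1) 1" by simp
    then have "t = (\<Sum>a<d. Poly_Mapping.single (v a) 1)"
      by (metis keys_single the_elem_eq zero_neq_one)
    then have "t = (\<Sum>a<d. Poly_Mapping.single (restrict v {..<d} a) 1)" by simp
    with v show "t \<in> (\<lambda>v. \<Sum>a<d. Poly_Mapping.single (v a) 1) ` ({..<d} \<rightarrow>\<^sub>E {..n})"
      by (intro image_eqI[of _ _ "restrict v {..<d}"]) auto
  qed
  then show ?thesis by (rule finite_subset) (auto intro: finite_PiE)
qed

text \<open>Gaussian elimination, by induction on the equations. These will be indexed by monomials
  or by pairs of a monomial and an exponent, the unknowns by numbers, points or parameters.\<close>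

lemma underdetermined_system:
  fixes w :: "'t \<Rightarrow> 'x \<Rightarrow> complex"
  assumes "finite X" "finite T" "card X < card T"
  shows "\<exists>c. (\<exists>t\<in>T. c t \<noteq> 0) \<and> (\<forall>x\<in>X. (\<Sum>t\<in>T. c t * w t x) = 0)"
  using assms
proof (induction X arbitrary: T w rule: finite_induct)
  case empty
  then have "T \<noteq> {}" by auto
  then show ?case by (auto intro!: exI[of _ "\<lambda>_. 1"])
next
  case (insert x X)
  show ?case
  proof (cases "\<forall>t\<in>T. w t x = 0")
    case True
    then show ?thesis using insert.IH[of T w] insert.prems insert.hyps by auto
  next
    case False
    then obtain s where s: "s \<in> T" "w s x \<noteq> 0" by blast
    let ?T = "T - {s}"
    have "card X < card ?T" using insert.prems insert.hyps s by simp
    then obtain c where c: "\<exists>t\<in>?T. c t \<noteq> 0"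
      "\<And>y. y \<in> X \<Longrightarrow> (\<Sum>t\<in>?T. c t * (w t y - w t x / w s x * w s y)) = 0"
      using insert.IH[of ?T "\<lambda>t y. w t y - w t x / w s x * w s y"] insert.prems by auto
    \<comment> \<open>The pivot coefficient makes each combination with \<open>c'\<close> equal to
      the combination of the reduced vectors with \<open>c\<close>; the reduced vectors vanish at
      \<open>x\<close>.\<close>
    define c' where "c' = c(s := - (\<Sum>t\<in>?T. c t * (w t x / w s x)))"
    have split: "(\<Sum>t\<in>T. c' t * w t y) =
        (\<Sum>t\<in>?T. c t * (w t y - w t x / w s x * w s y))" for y
    proof -
      have "(\<Sum>t\<in>T. c' t * w t y) = c' s * w s y + (\<Sum>t\<in>?T. c' t * w t y)"
        using s insert.prems by (simp add: sum.remove)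
      also have "(\<Sum>t\<in>?T. c' t * w t y) = (\<Sum>t\<in>?T. c t * w t y)"
        by (intro sum.cong) (auto simp: c'_def)
      finally show ?thesis
        by (simp add: c'_def sum_distrib_right sum_subtractf right_diff_distrib mult.assoc)
    qed
    have "(\<Sum>t\<in>T. c' t * w t y) = 0" if "y \<in> insert x X" for y
    proof (cases "y = x")
      case True
      then show ?thesis unfolding split using s by (auto intro!: sum.neutral)
    next
      case False
      then show ?thesis using that c(2) unfolding split by auto
    qed
    moreover have "\<exists>t\<in>T. c' t \<noteq> 0" using c(1) by (auto simp: c'_def)
    ultimately show ?thesis by blast
  qed
qed

definition monomials :: "nat \<Rightarrow> int \<Rightarrow> (nat \<Rightarrow>\<^sub>0 nat) set" where
  "monomials n d = {t. Poly_Mapping.keys t \<subseteq> {..n} \<and> int (mon_deg t) = d}"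

lemma finite_monomials_int: "finite (monomials n d)"
proof -
  have "monomials n d \<subseteq> {t. Poly_Mapping.keys t \<subseteq> {..n} \<and> mon_deg t = nat d}"
    by (auto simp: monomials_def)
  then show ?thesis by (rule finite_subset) (rule finite_monomials)
qed

lemma S_part_eq_0I:
  assumes "p \<in> S_part n d" "\<And>t. t \<in> monomials n d \<Longrightarrow> Poly_Mapping.lookup p t = 0"
  shows "p = 0"
proof (rule poly_mapping_eqI)
  fix t
  have "t \<in> monomials n d" if "Poly_Mapping.lookup p t \<noteq> 0"
    using assms(1) that unfolding S_part_iff monomials_def by (simp add: in_keys_iff)
  then show "Poly_Mapping.lookup p t = Poly_Mapping.lookup 0 t"
    using assms(2)[of t] by (cases "Poly_Mapping.lookup p t = 0") simp_all
qed

lemma S_part_dependent: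
  assumes "finite T" "card (monomials n d) < card T" "\<And>t. t \<in> T \<Longrightarrow> v t \<in> S_part n d"
  shows "\<exists>c. (\<exists>t\<in>T. c t \<noteq> 0) \<and> (\<Sum>t\<in>T. const (c t) * v t) = 0"
proof -
  obtain c where c: "\<exists>t\<in>T. c t \<noteq> 0"
    "\<forall>x\<in>monomials n d. (\<Sum>t\<in>T. c t * Poly_Mapping.lookup (v t) x) = 0"
    using underdetermined_system[OF finite_monomials_int assms(1,2), of "\<lambda>t. Poly_Mapping.lookup (v t)"]
    by (elim exE conjE)
  have "(\<Sum>t\<in>T. const (c t) * v t) = 0"
  proof (rule S_part_eq_0I)
    show "(\<Sum>t\<in>T. const (c t) * v t) \<in> S_part n d"
      by (intro S_part_sum S_part_const_mult assms)
  qed (simp add: lookup_sum c(2))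
  then show ?thesis using c(1) by blast
qed

section \<open>Graded ideals\<close>

text \<open>A homogeneous ideal is represented by the family of its graded pieces.\<close>

definition gideal :: "nat \<Rightarrow> (int \<Rightarrow> mpoly set) \<Rightarrow> bool" where
  "gideal n K \<longleftrightarrow> (\<forall>d. K d \<subseteq> S_part n d \<and> 0 \<in> K d) \<and>
     (\<forall>d. \<forall>p\<in>K d. \<forall>q\<in>K d. p + q \<in> K d) \<and>
     (\<forall>d e. \<forall>r\<in>S_part n e. \<forall>p\<in>K d. r * p \<in> K (e + d))"

text \<open>The ideal (K, g) with \<open>g\<close> in degree \<open>\<delta>\<close>. The degree is
  passed explicitly, here and in \<open>nzd\<close>, because it cannot be read off from the zero
  polynomial.\<close>

definition adj :: "nat \<Rightarrow> (int \<Rightarrow> mpoly set) \<Rightarrow> mpoly \<Rightarrow> int \<Rightarrow> int \<Rightarrow> mpoly set" where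
  "adj n K g \<delta> d = {k + r * g | k r. k \<in> K d \<and> r \<in> S_part n (d - \<delta>)}"

definition nzd :: "nat \<Rightarrow> (int \<Rightarrow> mpoly set) \<Rightarrow> mpoly \<Rightarrow> int \<Rightarrow> bool" where
  "nzd n K g \<delta> \<longleftrightarrow> (\<forall>d. \<forall>u\<in>S_part n d. u * g \<in> K (d + \<delta>) \<longrightarrow> u \<in> K d)"

text \<open>Absence of a socle in all degrees is the form in which positive depth of S/K is
  used.\<close>

definition has_socle :: "nat \<Rightarrow> (int \<Rightarrow> mpoly set) \<Rightarrow> int \<Rightarrow> bool" where
  "has_socle n K d \<longleftrightarrow> (\<exists>u\<in>S_part n d. u \<notin> K d \<and> (\<forall>i\<le>n. var i * u \<in> K (d + 1)))"

definition finite_colength :: "nat \<Rightarrow> (int \<Rightarrow> mpoly set) \<Rightarrow> bool" where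
  "finite_colength n K \<longleftrightarrow> (\<exists>M. \<forall>d\<ge>M. S_part n d \<subseteq> K d)"

lemma gidealI:
  assumes "\<And>d. K d \<subseteq> S_part n d" "\<And>d. 0 \<in> K d"
    "\<And>d p q. p \<in> K d \<Longrightarrow> q \<in> K d \<Longrightarrow> p + q \<in> K d"
    "\<And>d e r p. r \<in> S_part n e \<Longrightarrow> p \<in> K d \<Longrightarrow> r * p \<in> K (e + d)"
  shows "gideal n K"
  using assms unfolding gideal_def by blast

lemma gideal_S_part: "gideal n K \<Longrightarrow> p \<in> K d \<Longrightarrow> p \<in> S_part n d"
  and gideal_0: "gideal n K \<Longrightarrow> 0 \<in> K d"
  and gideal_add: "gideal n K \<Longrightarrow> p \<in> K d \<Longrightarrow> q \<in> K d \<Longrightarrow> p + q \<in> K d"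
  and gideal_mult: "gideal n K \<Longrightarrow> r \<in> S_part n e \<Longrightarrow> p \<in> K d \<Longrightarrow> r * p \<in> K (e + d)"
  by (auto simp: gideal_def)

lemma gideal_mult': "gideal n K \<Longrightarrow> r \<in> S_part n e \<Longrightarrow> p \<in> K d \<Longrightarrow> k = e + d \<Longrightarrow> r * p \<in> K k"
  using gideal_mult by blast

lemma gideal_mult_right: "gideal n K \<Longrightarrow> r \<in> S_part n e \<Longrightarrow> p \<in> K d \<Longrightarrow> k = d + e \<Longrightarrow> p * r \<in> K k"
  using gideal_mult'[of n K r e p d k] by (simp add: mult.commute add.commute)

lemma gideal_const_mult: "gideal n K \<Longrightarrow> p \<in> K d \<Longrightarrow> const c * p \<in> K d"
  by (rule gideal_mult') auto

lemma gideal_uminus: "gideal n K \<Longrightarrow> p \<in> K d \<Longrightarrow> - p \<in> K d"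
  using gideal_const_mult[of n K p d "-1"] by (simp add: const_uminus)

lemma gideal_diff: "gideal n K \<Longrightarrow> p \<in> K d \<Longrightarrow> q \<in> K d \<Longrightarrow> p - q \<in> K d"
  using gideal_add[of n K p d "- q"] gideal_uminus[of n K q d] by simp

lemma gideal_sum: "gideal n K \<Longrightarrow> (\<And>a. a \<in> A \<Longrightarrow> g a \<in> K d) \<Longrightarrow> sum g A \<in> K d"
  by (induction A rule: infinite_finite_induct) (auto intro: gideal_add gideal_0)

lemma gideal_add_cancel: "gideal n K \<Longrightarrow> p \<in> K d \<Longrightarrow> p + q \<in> K d \<longleftrightarrow> q \<in> K d"
  using gideal_diff[of n K "p + q" d p] gideal_add[of n K p d q] by auto

lemma gideal_zero: "gideal n (\<lambda>_. {0})"
  by (rule gidealI) auto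

lemma adjE:
  assumes "p \<in> adj n K g \<delta> d"
  obtains k r where "p = k + r * g" "k \<in> K d" "r \<in> S_part n (d - \<delta>)"
  using assms(1) that unfolding adj_def by (elim CollectE exE conjE)

lemma adjI: "k \<in> K d \<Longrightarrow> r \<in> S_part n (d - \<delta>) \<Longrightarrow> k + r * g \<in> adj n K g \<delta> d"
  unfolding adj_def by blast

lemma gideal_adj:
  assumes K: "gideal n K" and g: "g \<in> S_part n \<delta>"
  shows "gideal n (adj n K g \<delta>)"
proof (rule gidealI)
  show "adj n K g \<delta> d \<subseteq> S_part n d" for d
    using gideal_S_part[OF K] by (auto simp: adj_def intro!: S_part_add S_part_mult'[OF _ g])
  show "0 \<in> adj n K g \<delta> d" for d
    unfolding adj_def using gideal_0[OF K] by (force intro: exI[of _ 0])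
  show "p + q \<in> adj n K g \<delta> d" if pq: "p \<in> adj n K g \<delta> d" "q \<in> adj n K g \<delta> d" for d p q
  proof -
    obtain k r where "p = k + r * g" "k \<in> K d" "r \<in> S_part n (d - \<delta>)"
      using pq(1) by (rule adjE)
    moreover obtain k' r' where "q = k' + r' * g" "k' \<in> K d" "r' \<in> S_part n (d - \<delta>)"
      using pq(2) by (rule adjE)
    ultimately have "p + q = (k + k') + (r + r') * g" "k + k' \<in> K d" "r + r' \<in> S_part n (d - \<delta>)"
      using K by (auto simp: algebra_simps intro: gideal_add S_part_add)
    then show ?thesis unfolding adj_def by blast
  qed
  show "s * p \<in> adj n K g \<delta> (e + d)" if sp: "s \<in> S_part n e" "p \<in> adj n K g \<delta> d" for d e s p
  proof -
    obtain k r where "p = k + r * g" "k \<in> K d" "r \<in> S_part n (d - \<delta>)"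
      using sp(2) by (rule adjE)
    then have "s * p = s * k + (s * r) * g" by (simp add: distrib_left mult.assoc)
    moreover have "s * k \<in> K (e + d)" by (rule gideal_mult[OF K sp(1)]) fact
    moreover have "s * r \<in> S_part n (e + d - \<delta>)" by (rule S_part_mult'[OF sp(1)]) (fact, simp)
    ultimately show ?thesis unfolding adj_def by blast
  qed
qed

lemma adj_base: "k \<in> K d \<Longrightarrow> k \<in> adj n K g \<delta> d"
  using adjI[of k K d 0] by simp

lemma adj_mult: "gideal n K \<Longrightarrow> r \<in> S_part n (d - \<delta>) \<Longrightarrow> r * g \<in> adj n K g \<delta> d"
  using adjI[of 0 K d r] by (simp add: gideal_0)

lemma nzdD: "nzd n K g \<delta> \<Longrightarrow> u \<in> S_part n d \<Longrightarrow> u * g \<in> K k \<Longrightarrow> k = d + \<delta> \<Longrightarrow> u \<in> K d"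
  by (auto simp: nzd_def)

lemma nzdI: "(\<And>d u. u \<in> S_part n d \<Longrightarrow> u * g \<in> K (d + \<delta>) \<Longrightarrow> u \<in> K d) \<Longrightarrow> nzd n K g \<delta>"
  by (auto simp: nzd_def)

section \<open>Nonzerodivisors, socles and their exchange\<close>

lemma nzd_power:
  assumes K: "gideal n K" and z: "z \<in> S_part n \<delta>" "nzd n K z \<delta>"
    and u: "u \<in> S_part n d" "u * z ^ k \<in> K (d + int k * \<delta>)"
  shows "u \<in> K d"
  using u
proof (induction k)
  case (Suc k)
  have "u * z ^ k \<in> S_part n (d + int k * \<delta>)"
    by (intro S_part_mult S_part_power Suc z)
  moreover have "(u * z ^ k) * z \<in> K (d + int (Suc k) * \<delta>)"
    using Suc.prems(2) by (simp add: algebra_simps)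
  ultimately have "u * z ^ k \<in> K (d + int k * \<delta>)"
    by (rule nzdD[OF z(2)]) (simp add: algebra_simps)
  then show ?case using Suc by blast
qed auto

text \<open>Every monomial of positive degree has a variable as a factor, which already carries
  \<open>u\<close> into \<open>K\<close>; the rest is linearity.\<close>

lemma gideal_positive_degree_mult:
  assumes K: "gideal n K" and u: "\<And>i. i \<le> n \<Longrightarrow> var i * u \<in> K (d + 1)"
    and y: "y \<in> S_part n \<beta>" "\<beta> > 0"
  shows "y * u \<in> K (\<beta> + d)"
  using y(1)
proof (induction rule: S_part_induct)
  case (monomial t)
  define m where "m = nat (\<beta> - 1)"
  have m: "\<beta> = int (Suc m)" using y(2) by (simp add: m_def)
  obtain v where v: "\<forall>a\<in>{..<Suc m}. v a \<le> n"
    "Poly_Mapping.single t 1 = (\<Prod>a<Suc m. var (v a))"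
    using monomial_eq_prod_var[of "{..<Suc m}" t n] monomial m by auto
  have "(\<Prod>a<m. var (v a)) * (var (v m) * u) \<in> K (\<beta> + d)"
  proof (rule gideal_mult'[OF K])
    show "(\<Prod>a<m. var (v a)) \<in> S_part n (int m)"
      using S_part_prod[of "{..<m}" "\<lambda>a. var (v a)" n] v(1) by (simp add: var_S_part)
    show "var (v m) * u \<in> K (d + 1)" using u v by simp
  qed (use m in simp)
  then show ?case by (simp add: v(2) mult.assoc)
qed (auto simp: distrib_right mult.assoc gideal_0[OF K] intro: gideal_add[OF K] gideal_const_mult[OF K])

text \<open>Homogeneous regular sequences may be permuted. If u z \<in> K, then u = k + r f, and
  cancelling f gives r z \<in> K with r of smaller degree; this descent replaces Nakayama's lemma.
  For the second claim, u f = k + v z puts v into (K, f), after which f can be cancelled.\<close>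

lemma nzd_swap:
  assumes K: "gideal n K" and f: "f \<in> S_part n \<delta>" "\<delta> > 0" "nzd n K f \<delta>"
    and z: "z \<in> S_part n \<epsilon>" "nzd n (adj n K f \<delta>) z \<epsilon>"
  shows "nzd n K z \<epsilon>" "nzd n (adj n K z \<epsilon>) f \<delta>"
proof -
  have *: "u \<in> S_part n d \<Longrightarrow> u * z \<in> K (d + \<epsilon>) \<Longrightarrow> nat d < m \<Longrightarrow> u \<in> K d" for m u d
  proof (induction m arbitrary: u d)
    case (Suc m)
    have "u \<in> adj n K f \<delta> d"
      by (rule nzdD[OF z(2) Suc.prems(1), of "d + \<epsilon>"]) (auto intro: adj_base Suc.prems)
    then obtain k r where kr: "u = k + r * f" "k \<in> K d" "r \<in> S_part n (d - \<delta>)"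
      by (rule adjE)
    show ?case
    proof (cases "d < \<delta>")
      case True
      then have "r = 0" using S_part_neg[OF kr(3)] by simp
      then show ?thesis using kr by simp
    next
      case False
      have "k * z \<in> K (d + \<epsilon>)" by (rule gideal_mult_right[OF K z(1) kr(2)]) simp
      then have "(r * z) * f \<in> K (d + \<epsilon>)"
        using gideal_diff[OF K Suc.prems(2)] unfolding kr(1) by (fastforce simp: algebra_simps)
      then have "r * z \<in> K (d - \<delta> + \<epsilon>)"
        by (intro nzdD[OF f(3), of _ "d - \<delta> + \<epsilon>" "d + \<epsilon>"] S_part_mult kr z) auto
      then have "r \<in> K (d - \<delta>)" using Suc.IH[OF kr(3)] Suc.prems(3) f(2) False by auto
      then show ?thesis unfolding kr(1)
        by (intro gideal_add[OF K] kr gideal_mult_right[OF K f(1)]) auto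
    qed
  qed simp
  show z': "nzd n K z \<epsilon>"
    by (rule nzdI) (use * in blast)
  show "nzd n (adj n K z \<epsilon>) f \<delta>"
  proof (rule nzdI)
    fix d u assume u: "u \<in> S_part n d" "u * f \<in> adj n K z \<epsilon> (d + \<delta>)"
    then obtain k v where kv: "u * f = k + v * z" "k \<in> K (d + \<delta>)" "v \<in> S_part n (d + \<delta> - \<epsilon>)"
      by (auto elim: adjE)
    have "v * z = - k + u * f" using kv(1) by (simp add: algebra_simps)
    also have "\<dots> \<in> adj n K f \<delta> (d + \<delta>)"
      using u(1) kv(2) K by (intro adjI gideal_uminus) auto
    finally have "v \<in> adj n K f \<delta> (d + \<delta> - \<epsilon>)"
      by (rule nzdD[OF z(2) kv(3)]) simp
    then obtain k' w where w: "v = k' + w * f" "k' \<in> K (d + \<delta> - \<epsilon>)" "w \<in> S_part n (d + \<delta> - \<epsilon> - \<delta>)"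
      by (rule adjE)
    have w': "w \<in> S_part n (d - \<epsilon>)" using w(3) by (simp add: algebra_simps)
    have "(u - w * z) * f = k + k' * z" using kv(1) w(1) by (simp add: algebra_simps)
    also have "\<dots> \<in> K (d + \<delta>)"
      by (intro gideal_add[OF K] kv gideal_mult_right[OF K z(1) w(2)]) simp
    finally have "u - w * z \<in> K d"
      by (intro nzdD[OF f(3), of _ d "d + \<delta>"] S_part_diff u(1) S_part_mult'[OF w' z(1)]) auto
    then have "(u - w * z) + w * z \<in> adj n K z \<epsilon> d" using w' by (intro adjI)
    then show "u \<in> adj n K z \<epsilon> d" by simp
  qed
qed

lemma adj_commute: "adj n (adj n K f \<delta>) z \<epsilon> = adj n (adj n K z \<epsilon>) f \<delta>"
proof -
  have "adj n (adj n K f \<delta>) z \<epsilon> d \<subseteq> adj n (adj n K z \<epsilon>) f \<delta> d" for K f \<delta> z \<epsilon> d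
  proof
    fix p assume "p \<in> adj n (adj n K f \<delta>) z \<epsilon> d"
    then obtain k r s where "p = (k + r * f) + s * z" "k \<in> K d" "r \<in> S_part n (d - \<delta>)"
      "s \<in> S_part n (d - \<epsilon>)" by (auto elim!: adjE)
    then have "p = (k + s * z) + r * f" "k + s * z \<in> adj n K z \<epsilon> d" "r \<in> S_part n (d - \<delta>)"
      by (auto simp: algebra_simps intro!: adjI)
    then show "p \<in> adj n (adj n K z \<epsilon>) f \<delta> d" using adjI by blast
  qed
  then show ?thesis by (intro ext equalityI)
qed

text \<open>Kaplansky's exchange: a socle element \<open>u\<close> modulo \<open>(K, x)\<close> yields a socle element \<open>v\<close>
  modulo \<open>(K, y)\<close> through \<open>u y \<equiv> v x\<close> modulo \<open>K\<close>.\<close>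

lemma has_socle_exchange:
  assumes K: "gideal n K" and x: "x \<in> S_part n \<alpha>" "nzd n K x \<alpha>"
    and y: "y \<in> S_part n \<beta>" "\<beta> > 0" "nzd n K y \<beta>"
    and soc: "has_socle n (adj n K x \<alpha>) d"
  shows "has_socle n (adj n K y \<beta>) (d + \<beta> - \<alpha>)"
proof -
  obtain u where u: "u \<in> S_part n d" "u \<notin> adj n K x \<alpha> d"
    "\<And>i. i \<le> n \<Longrightarrow> var i * u \<in> adj n K x \<alpha> (d + 1)"
    using soc unfolding has_socle_def by blast
  have "y * u \<in> adj n K x \<alpha> (\<beta> + d)"
    by (rule gideal_positive_degree_mult[OF gideal_adj[OF K x(1)] u(3) y(1,2)])
  then obtain k v where v: "y * u = k + v * x" "k \<in> K (\<beta> + d)" "v \<in> S_part n (\<beta> + d - \<alpha>)"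
    by (rule adjE)
  have v': "v \<in> S_part n (d + \<beta> - \<alpha>)" using v(3) by (simp add: add.commute)
  moreover have "v \<notin> adj n K y \<beta> (d + \<beta> - \<alpha>)"
  proof
    assume "v \<in> adj n K y \<beta> (d + \<beta> - \<alpha>)"
    then obtain k' r where r: "v = k' + r * y" "k' \<in> K (d + \<beta> - \<alpha>)" "r \<in> S_part n (d + \<beta> - \<alpha> - \<beta>)"
      by (rule adjE)
    have r': "r \<in> S_part n (d - \<alpha>)" using r(3) by (simp add: algebra_simps)
    have "(u - r * x) * y = k + k' * x" using v(1) r(1) by (simp add: algebra_simps)
    also have "\<dots> \<in> K (d + \<beta>)"
      using v(2) by (intro gideal_add[OF K] gideal_mult_right[OF K x(1) r(2)]) (auto simp: add.commute)
    finally have "u - r * x \<in> K d"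
      by (intro nzdD[OF y(3), of _ d "d + \<beta>"] S_part_diff u(1) S_part_mult'[OF r' x(1)]) auto
    then have "(u - r * x) + r * x \<in> adj n K x \<alpha> d" using r' by (intro adjI)
    then show False using u(2) by simp
  qed
  moreover have "var i * v \<in> adj n K y \<beta> (d + \<beta> - \<alpha> + 1)" if i: "i \<le> n" for i
  proof -
    obtain k' r where r: "var i * u = k' + r * x" "k' \<in> K (d + 1)" "r \<in> S_part n (d + 1 - \<alpha>)"
      using u(3)[OF i] by (rule adjE)
    \<comment> \<open>Two expressions for x_i y u are compared; cancelling x then gives x_i v - r y
      \<in> K.\<close>
    have "(var i * v - r * y) * x = k' * y - var i * k"
    proof -
      have "var i * (y * u) = var i * (k + v * x)" using v(1) by simp
      moreover have "var i * (y * u) = y * (k' + r * x)" using r(1) by (simp only: mult.left_commute)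
      ultimately show ?thesis by (simp add: algebra_simps)
    qed
    also have "\<dots> \<in> K (d + \<beta> + 1)"
      by (intro gideal_diff[OF K] gideal_mult_right[OF K y(1) r(2)]
          gideal_mult'[OF K var_S_part[OF i] v(2)]) auto
    finally have "var i * v - r * y \<in> K (d + \<beta> - \<alpha> + 1)"
      by (intro nzdD[OF x(2), of _ "d + \<beta> - \<alpha> + 1" "d + \<beta> + 1"] S_part_diff
          S_part_mult'[OF var_S_part[OF i] v'] S_part_mult'[OF r(3) y(1)]) auto
    then have "(var i * v - r * y) + r * y \<in> adj n K y \<beta> (d + \<beta> - \<alpha> + 1)"
      using r(3) by (intro adjI) (simp_all add: algebra_simps)
    then show ?thesis by simp
  qed
  ultimately show ?thesis unfolding has_socle_def by blast
qed

text \<open>Linear independence in the degree \<open>d\<close> part of S/K, stated for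
  representatives so that no quotient space has to be formed.\<close>

definition indep_mod :: "(int \<Rightarrow> mpoly set) \<Rightarrow> int \<Rightarrow> nat \<Rightarrow> (nat \<Rightarrow> mpoly) \<Rightarrow> bool" where
  "indep_mod K d D v \<longleftrightarrow>
    (\<forall>c. (\<Sum>a<D. const (c a) * v a) \<in> K d \<longrightarrow> (\<forall>a<D. c a = 0))"

text \<open>\<open>D\<close> is the dimension of the degree \<open>d\<close> part of S/K; it exists
  because the number of monomials bounds the size of independent families.\<close>

lemma indep_mod_max:
  assumes K: "gideal n K"
  obtains D v where "\<And>a. v a \<in> S_part n d" "indep_mod K d D v"
    "\<And>w. (\<And>a. w a \<in> S_part n d) \<Longrightarrow> \<not> indep_mod K d (Suc D) w"
proof -
  let ?P = "\<lambda>D. \<exists>v. (\<forall>a. v a \<in> S_part n d) \<and> indep_mod K d D v"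
  have bound: "D \<le> card (monomials n d)" if "?P D" for D
  proof (rule ccontr)
    assume D: "\<not> D \<le> card (monomials n d)"
    obtain v where v: "\<forall>a. v a \<in> S_part n d" "indep_mod K d D v" using \<open>?P D\<close> by blast
    then obtain c where "\<exists>a<D. c a \<noteq> 0" "(\<Sum>a<D. const (c a) * v a) = 0"
      using S_part_dependent[of "{..<D}" n d v] D by auto
    then show False using v(2) gideal_0[OF K, of d] unfolding indep_mod_def by metis
  qed
  have P0: "?P 0" by (intro exI[of _ "\<lambda>_. 0"]) (auto simp: indep_mod_def)
  obtain D where "?P D" "\<forall>D'. ?P D' \<longrightarrow> D' \<le> D"
    using ex_has_greatest_nat[of ?P 0 id "Suc (card (monomials n d))"] P0 bound
    by (auto simp: less_Suc_eq_le)
  moreover from this have "\<not> ?P (Suc D)" by (metis Suc_n_not_le_n)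
  ultimately show ?thesis using that by blast
qed

text \<open>Above \<open>M\<close>, multiplication by \<open>y\<close> is onto modulo
  \<open>K\<close>. This can be iterated since \<beta> \<ge> 0 keeps all degrees above
  \<open>M\<close>.\<close>

lemma S_part_eq_power_mod:
  assumes K: "gideal n K" and y: "y \<in> S_part n \<beta>" "\<beta> \<ge> 0"
    and M: "\<And>d. d > M \<Longrightarrow> S_part n d \<subseteq> adj n K y \<beta> d" and d: "d > M"
    and p: "p \<in> S_part n (d + int m * \<beta>)"
  shows "\<exists>s\<in>S_part n d. p - s * y ^ m \<in> K (d + int m * \<beta>)"
  using p
proof (induction m arbitrary: p)
  case 0
  then show ?case by (auto intro!: bexI[of _ p] gideal_0[OF K])
next
  case (Suc m)
  have "d + int (Suc m) * \<beta> > M" using d y(2) by (smt (verit) mult_nonneg_nonneg of_nat_0_le_iff)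
  then have "p \<in> adj n K y \<beta> (d + int (Suc m) * \<beta>)" using M Suc.prems by blast
  then obtain k r where r: "p = k + r * y" "k \<in> K (d + int (Suc m) * \<beta>)"
    "r \<in> S_part n (d + int (Suc m) * \<beta> - \<beta>)"
    by (rule adjE)
  have "r \<in> S_part n (d + int m * \<beta>)" using r(3) by (simp add: algebra_simps)
  then obtain s where s: "s \<in> S_part n d" "r - s * y ^ m \<in> K (d + int m * \<beta>)" using Suc.IH by blast
  have "p - s * y ^ Suc m = k + (r - s * y ^ m) * y" using r(1) by (simp add: algebra_simps)
  also have "\<dots> \<in> K (d + int (Suc m) * \<beta>)"
    by (intro gideal_add[OF K] r gideal_mult_right[OF K y(1) s(2)]) (simp add: algebra_simps)
  finally show ?case using s(1) by blast
qed

text \<open>In large degrees, multiplication by a power of \<open>y\<close> is onto modulo \<open>K\<close> and multiplication by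
  a power of \<open>x\<close> is injective; comparing dimensions, the latter is onto as well.\<close>

lemma finite_colength_exchange:
  assumes K: "gideal n K" and x: "x \<in> S_part n \<alpha>" "\<alpha> > 0" "nzd n K x \<alpha>"
    and y: "y \<in> S_part n \<beta>" "\<beta> > 0" and fin: "finite_colength n (adj n K y \<beta>)"
  shows "finite_colength n (adj n K x \<alpha>)"
proof -
  obtain M where M: "\<And>d. d \<ge> M \<Longrightarrow> S_part n d \<subseteq> adj n K y \<beta> d"
    using fin unfolding finite_colength_def by blast
  have "p \<in> adj n K x \<alpha> d" if d: "d > M + \<alpha> * \<beta>" and p: "p \<in> S_part n d" for p d
  proof -
    \<comment> \<open>Both \<open>x ^ nat \<beta>\<close> and \<open>y ^ nat \<alpha>\<close> have
      degree \<alpha> \<beta>, so both multiplications lead from degree \<open>e\<close> to degree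
      \<open>d\<close>.\<close>
    define e where "e = d - \<alpha> * \<beta>"
    have e: "e > M" "d = e + int (nat \<alpha>) * \<beta>" "d = e + int (nat \<beta>) * \<alpha>"
      using d x(2) y(2) by (auto simp: e_def mult.commute)
    obtain D v where v: "\<And>a. v a \<in> S_part n e" "indep_mod K e D v"
      and max: "\<And>w. (\<And>a. w a \<in> S_part n e) \<Longrightarrow> \<not> indep_mod K e (Suc D) w"
      using indep_mod_max[OF K, of e] by metis
    have vx: "v a * x ^ nat \<beta> \<in> S_part n d" for a
      unfolding e(3) by (intro S_part_mult S_part_power v x)
    \<comment> \<open>The image of a basis under the power of x, and \<open>p\<close> as one element
      more. Modulo \<open>K\<close> these are multiples, by the power of y, of D + 1 elements of
      degree \<open>e\<close>, which must be dependent.\<close>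
    define w where "w a = (if a < D then v a * x ^ nat \<beta> else p)" for a
    have w: "w a \<in> S_part n d" for a using vx p by (simp add: w_def)
    have "\<forall>a. \<exists>s\<in>S_part n e. w a - s * y ^ nat \<alpha> \<in> K d"
    proof
      fix a
      have "w a \<in> S_part n (e + int (nat \<alpha>) * \<beta>)" using w e(2) by simp
      then show "\<exists>s\<in>S_part n e. w a - s * y ^ nat \<alpha> \<in> K d"
        unfolding e(2) using M y(2) by (intro S_part_eq_power_mod[OF K y(1) _ _ e(1)]) auto
    qed
    then obtain s where s: "\<And>a. s a \<in> S_part n e" "\<And>a. w a - s a * y ^ nat \<alpha> \<in> K d" by metis
    obtain c a where ca: "(\<Sum>a<Suc D. const (c a) * s a) \<in> K e" "a < Suc D" "c a \<noteq> 0"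
      using max[of s] s(1) unfolding indep_mod_def by auto
    have "(\<Sum>a<Suc D. const (c a) * s a) * y ^ nat \<alpha> \<in> K d"
      using S_part_power[OF y(1), of "nat \<alpha>"] by (rule gideal_mult_right[OF K _ ca(1)]) (use e in auto)
    moreover have "(\<Sum>a<Suc D. const (c a) * (w a - s a * y ^ nat \<alpha>)) \<in> K d"
      by (intro gideal_sum[OF K] gideal_const_mult[OF K] s)
    ultimately have "(\<Sum>a<Suc D. const (c a) * s a) * y ^ nat \<alpha> +
        (\<Sum>a<Suc D. const (c a) * (w a - s a * y ^ nat \<alpha>)) \<in> K d"
      by (rule gideal_add[OF K])
    also have "(\<Sum>a<Suc D. const (c a) * s a) * y ^ nat \<alpha> +
        (\<Sum>a<Suc D. const (c a) * (w a - s a * y ^ nat \<alpha>)) = (\<Sum>a<Suc D. const (c a) * w a)"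
      unfolding sum_distrib_right sum.distrib[symmetric] by (intro sum.cong) (auto simp: algebra_simps)
    also have "\<dots> = (\<Sum>a<D. const (c a) * v a) * x ^ nat \<beta> + const (c D) * p"
      by (simp add: w_def sum_distrib_right mult.assoc)
    finally have rel: "(\<Sum>a<D. const (c a) * v a) * x ^ nat \<beta> + const (c D) * p \<in> K d" .
    have vS: "(\<Sum>a<D. const (c a) * v a) \<in> S_part n e"
      by (intro S_part_sum S_part_const_mult v)
    \<comment> \<open>Otherwise injectivity of the power of x would give a relation among the basis
      elements \<open>v\<close>.\<close>
    have "c D \<noteq> 0"
    proof
      assume "c D = 0"
      then have "(\<Sum>a<D. const (c a) * v a) \<in> K e"
        using rel nzd_power[OF K x(1,3) vS, of "nat \<beta>"] e(3) by simp
      then show False using v(2) ca \<open>c D = 0\<close> unfolding indep_mod_def by (auto simp: less_Suc_eq)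
    qed
    define z where "z = const (- inverse (c D)) * ((\<Sum>a<D. const (c a) * v a) * x ^ (nat \<beta> - 1))"
    have "d - \<alpha> = e + int (nat \<beta> - 1) * \<alpha>" using e(3) y(2) by (simp add: algebra_simps of_nat_diff)
    then have zS: "z \<in> S_part n (d - \<alpha>)" unfolding z_def
      by (simp only:) (intro S_part_const_mult S_part_mult vS S_part_power x)
    have "x ^ nat \<beta> = x ^ (nat \<beta> - 1) * x" using y(2) by (simp add: power_eq_if mult.commute)
    then have "const (inverse (c D)) * ((\<Sum>a<D. const (c a) * v a) * x ^ nat \<beta> + const (c D) * p) + z * x = p"
      using \<open>c D \<noteq> 0\<close> by (simp add: z_def distrib_left const_inverse_mult const_uminus mult.assoc)
    moreover have "\<dots> \<in> adj n K x \<alpha> d"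
      by (subst calculation[symmetric], rule adjI) (auto intro: gideal_const_mult[OF K rel] zS)
    ultimately show ?thesis by simp
  qed
  then show ?thesis unfolding finite_colength_def
    by (intro exI[of _ "M + \<alpha> * \<beta> + 1"]) auto
qed

section \<open>Generic linear forms\<close>

text \<open>A family of linear forms that is polynomial in one parameter; the generic form is taken
  from it. With an indeterminate for \<open>t\<close> it becomes \<open>moment_poly\<close>, to
  which arguments about zero divisors in polynomial rings apply.\<close>

definition moment_form :: "nat \<Rightarrow> complex \<Rightarrow> mpoly" where
  "moment_form n t = (\<Sum>i\<le>n. const (t ^ i) * var i)"

definition moment_poly :: "nat \<Rightarrow> mpoly poly" where
  "moment_poly n = (\<Sum>i\<le>n. Polynomial.monom (var i) i)"

lemma coeff_moment_poly: "Polynomial.coeff (moment_poly n) i = (if i \<le> n then var i else 0)"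
  by (simp add: moment_poly_def coeff_sum)

lemma moment_form_S_part: "moment_form n t \<in> S_part n 1"
  unfolding moment_form_def by (intro S_part_sum S_part_const_mult var_S_part) simp

lemma const_power: "const (t ^ k) = const t ^ k"
  by (induction k) (auto simp: const_mult)

lemma poly_moment_poly: "poly (moment_poly n) (const t) = moment_form n t"
  by (simp add: moment_poly_def moment_form_def poly_sum poly_monom const_power mult.commute)

text \<open>McCoy's argument for zero divisors in \<open>(S/K)[T]\<close>: the sequence \<open>g\<close> lists the coefficients of
  a polynomial in \<open>T\<close> that is killed by the generic linear form \<open>\<Sum> x\<^sub>i T\<^sup>i\<close>.\<close>

lemma mccoy:
  assumes K: "gideal n K" and soc: "\<And>d. \<not> has_socle n K d"
    and g: "\<And>j. g j \<in> S_part n d" "\<And>j. j \<ge> m \<Longrightarrow> g j \<in> K d"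
    and rel: "\<And>k. (\<Sum>i\<le>min n k. var i * g (k - i)) \<in> K (d + 1)"
  shows "g j \<in> K d"
  using g rel
proof (induction m arbitrary: g d j)
  case (Suc m)
  \<comment> \<open>Modulo \<open>K\<close>, \<open>g m\<close> is the last coefficient that may be
    nonzero. In the relation of index i + m the terms with a < i involve coefficients beyond
    \<open>m\<close>, and those with a > i are covered by descending induction on i; so x_i kills
    \<open>g m\<close>. Hence x_i g is shorter, and the outer induction shows that x_i kills every
    coefficient.\<close>
  have "i \<le> n \<longrightarrow> (\<forall>j. var i * g j \<in> K (d + 1))" for i
  proof (induction "n - i" arbitrary: i rule: less_induct)
    case less
    show ?case
    proof (intro impI allI)
      fix j assume i: "i \<le> n"
      have above: "var a * g b \<in> K (d + 1)" if "i < a" "a \<le> n" for a b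
        using less[of a] that i by auto
      have "var i * g m \<in> K (d + 1)"
      proof -
        have "(\<Sum>a\<in>{..min n (i + m)} - {i}. var a * g (i + m - a)) \<in> K (d + 1)"
        proof (rule gideal_sum[OF K])
          fix a assume a: "a \<in> {..min n (i + m)} - {i}"
          show "var a * g (i + m - a) \<in> K (d + 1)"
          proof (cases "a < i")
            case True
            then have "g (i + m - a) \<in> K d" using Suc.prems(2) by simp
            then show ?thesis using a by (intro gideal_mult'[OF K var_S_part]) auto
          next
            case False
            then show ?thesis using above a by auto
          qed
        qed
        moreover have "(\<Sum>a\<le>min n (i + m). var a * g (i + m - a)) =
            (\<Sum>a\<in>{..min n (i + m)} - {i}. var a * g (i + m - a)) + var i * g m"
          using i by (subst sum.remove[of _ i]) auto
        ultimately show ?thesis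
          using Suc.prems(3)[of "i + m"] gideal_add_cancel[OF K] by simp
      qed
      moreover have "var i * g b \<in> K (d + 1)" if "b > m" for b
        using that Suc.prems(2)[of b] i by (intro gideal_mult'[OF K var_S_part]) auto
      ultimately have top: "var i * g b \<in> K (d + 1)" if "b \<ge> m" for b
        using that by (cases "b = m") auto
      have deg: "var i * g b \<in> S_part n (d + 1)" for b
        using i Suc.prems(1) by (intro S_part_mult'[OF var_S_part]) auto
      have "(\<Sum>a\<le>min n k. var a * (var i * g (k - a))) \<in> K (d + 1 + 1)" for k
      proof -
        have "var i * (\<Sum>a\<le>min n k. var a * g (k - a)) \<in> K (d + 1 + 1)"
          by (intro gideal_mult'[OF K var_S_part[OF i] Suc.prems(3)]) simp
        then show ?thesis by (simp add: sum_distrib_left mult.left_commute)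
      qed
      then show "var i * g j \<in> K (d + 1)"
        using Suc.IH[of "\<lambda>b. var i * g b" "d + 1" j] deg top by blast
    qed
  qed
  then have "\<forall>i\<le>n. var i * g j \<in> K (d + 1)" by blast
  then show ?case using soc[of d] Suc.prems(1) unfolding has_socle_def by blast
qed simp

lemma poly_const_gideal:
  assumes K: "gideal n K" and "\<And>i. Polynomial.coeff p i \<in> K d"
  shows "poly p (const t) \<in> K d"
  unfolding poly_altdef const_power[symmetric]
  by (intro gideal_sum[OF K]) (metis K gideal_const_mult assms(2) mult.commute)

text \<open>Write \<open>L(T) = \<Sum> x\<^sub>i T\<^sup>i\<close>. Infinitely many parameters \<open>t\<close> with \<open>u\<^sub>t L(t) \<in> K\<close> admit a
  linear relation with coefficients \<open>c\<^sub>t\<close> between the polynomials \<open>u\<^sub>t (L(T) - L(t)) / (T - t)\<close>,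
  which lie in a space of finite dimension. Then \<open>L(T)\<close> kills the polynomial
  \<open>\<Sum> c\<^sub>t u\<^sub>t \<Prod> (T - s)\<close>, the product ranging over the parameters \<open>s \<noteq> t\<close>, which is nonzero
  over \<open>S/K\<close>.\<close>

lemma finite_bad_moment_parameters:
  assumes K: "gideal n K" and soc: "\<And>d. \<not> has_socle n K d"
  shows "finite {t. \<exists>u\<in>S_part n d. u \<notin> K d \<and> u * moment_form n t \<in> K (d + 1)}" (is "finite ?B")
proof (rule ccontr)
  assume inf: "infinite ?B"
  let ?L = "moment_poly n"
  \<comment> \<open>\<open>X\<close> indexes the scalar coordinates of the polynomials
    \<open>w t\<close> below: an exponent up to \<open>n\<close> and a monomial of degree d + 1. One
    parameter more than that forces a relation.\<close>
  define X where "X = monomials n (d + 1) \<times> {..n}"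
  have finX: "finite X" by (simp add: X_def finite_monomials_int)
  obtain T where T: "finite T" "card T = Suc (card X)" "T \<subseteq> ?B"
    using infinite_arbitrarily_large[OF inf] by blast
  then have "\<forall>t\<in>T. \<exists>u. u \<in> S_part n d \<and> u \<notin> K d \<and> u * moment_form n t \<in> K (d + 1)" by blast
  then obtain u where u: "\<And>t. t \<in> T \<Longrightarrow> u t \<in> S_part n d" "\<And>t. t \<in> T \<Longrightarrow> u t \<notin> K d"
    "\<And>t. t \<in> T \<Longrightarrow> u t * moment_form n t \<in> K (d + 1)"
    by metis
  define q where "q t = synthetic_div ?L (const t)" for t
  have q: "?L = [:- const t, 1:] * q t + [:moment_form n t:]" for t
    using synthetic_div_correct'[of "const t" ?L] by (simp add: q_def poly_moment_poly add.commute)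
  have degL: "Polynomial.degree ?L \<le> n"
    by (rule degree_le) (simp add: coeff_moment_poly)
  have q_top: "Polynomial.coeff (q t) i = 0" if "i > n" for t i
    using degL that by (intro coeff_eq_0) (simp add: q_def degree_synthetic_div)
  have q_rec: "Polynomial.coeff (q t) i = const t * Polynomial.coeff (q t) (Suc i) + Polynomial.coeff ?L (Suc i)" for t i
  proof -
    have "Polynomial.coeff ?L (Suc i) = Polynomial.coeff ([:- const t, 1:] * q t + [:moment_form n t:]) (Suc i)"
      using q by simp
    then show ?thesis by simp
  qed
  have q_S: "Polynomial.coeff (q t) i \<in> S_part n 1" for t i
  proof (induction "Suc n - i" arbitrary: i)
    case 0
    then show ?case by (simp add: q_top)
  next
    case (Suc k)
    then have "Polynomial.coeff (q t) (Suc i) \<in> S_part n 1" by simp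
    then show ?case unfolding q_rec[of t i]
      by (intro S_part_add S_part_const_mult) (auto simp: coeff_moment_poly intro: var_S_part)
  qed
  define w where "w t = Polynomial.smult (u t) (q t)" for t
  have w_S: "Polynomial.coeff (w t) i \<in> S_part n (d + 1)" if "t \<in> T" for t i
    using u(1)[OF that] q_S by (auto simp: w_def intro: S_part_mult)
  have "card X < card T" using T by simp
  then obtain c where c: "\<exists>t\<in>T. c t \<noteq> 0"
    "\<forall>x\<in>X. (\<Sum>t\<in>T. c t * Poly_Mapping.lookup (Polynomial.coeff (w t) (snd x)) (fst x)) = 0"
    using underdetermined_system[OF finX T(1) \<open>card X < card T\<close>,
        of "\<lambda>t x. Poly_Mapping.lookup (Polynomial.coeff (w t) (snd x)) (fst x)"]
    by (elim exE conjE)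
  have "(\<Sum>t\<in>T. Polynomial.smult (const (c t)) (w t)) = 0"
  proof (rule poly_eqI)
    fix i
    show "Polynomial.coeff (\<Sum>t\<in>T. Polynomial.smult (const (c t)) (w t)) i = Polynomial.coeff 0 i"
    proof (cases "i \<le> n")
      case True
      have "Polynomial.coeff (\<Sum>t\<in>T. Polynomial.smult (const (c t)) (w t)) i = 0"
      proof (rule S_part_eq_0I)
        show "Polynomial.coeff (\<Sum>t\<in>T. Polynomial.smult (const (c t)) (w t)) i \<in> S_part n (d + 1)"
          by (auto simp: coeff_sum intro!: S_part_sum S_part_const_mult w_S)
        fix s assume "s \<in> monomials n (d + 1)"
        then have "(s, i) \<in> X" using True by (simp add: X_def)
        then show "Poly_Mapping.lookup (Polynomial.coeff (\<Sum>t\<in>T. Polynomial.smult (const (c t)) (w t)) i) s = 0"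
          using c(2) by (fastforce simp: coeff_sum lookup_sum)
      qed
      then show ?thesis by simp
    qed (simp add: coeff_sum w_def q_top)
  qed
  note dep = this
  define Q where "Q A = (\<Prod>j\<in>A. [:- const j, 1:])" for A :: "complex set"
  \<comment> \<open>Since these products have constant coefficients, multiplying by them respects
    the grading.\<close>
  have Q_const: "\<exists>z. Polynomial.coeff (Q A) i = const z" if "finite A" for A i
    using that
  proof (induction A arbitrary: i rule: finite_induct)
    case empty
    then show ?case by (auto simp: Q_def intro: exI[of _ 1] exI[of _ 0])
  next
    case (insert j A)
    have *: "Q (insert j A) = [:- const j, 1:] * Q A" using insert.hyps by (simp add: Q_def)
    obtain z where "Polynomial.coeff (Q A) i = const z" using insert.IH by blast
    moreover obtain z' where "i > 0 \<Longrightarrow> Polynomial.coeff (Q A) (i - 1) = const z'" using insert.IH by blast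
    ultimately have "Polynomial.coeff (Q (insert j A)) i = const (- j * z + (if i = 0 then 0 else z'))"
      unfolding * by (cases i) (auto simp: const_add const_diff const_mult const_uminus)
    then show ?case by blast
  qed
  define g where "g = (\<Sum>t\<in>T. Polynomial.smult (const (c t) * u t) (Q (T - {t})))"
  have gS: "Polynomial.coeff g i \<in> S_part n d" for i
    unfolding g_def coeff_sum
  proof (rule S_part_sum)
    fix t assume t: "t \<in> T"
    obtain z where "Polynomial.coeff (Q (T - {t})) i = const z"
      using Q_const[of "T - {t}" i] T(1) by auto
    then show "Polynomial.coeff (Polynomial.smult (const (c t) * u t) (Q (T - {t}))) i \<in> S_part n d"
      using u(1)[OF t] by (auto intro!: S_part_mult'[OF _ const_S_part] S_part_const_mult)
  qed
  have factor: "(r * q' + [:b:]) * Polynomial.smult a P = Polynomial.smult a (q' * (r * P)) +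
      Polynomial.smult a (Polynomial.smult b P)" for r q' P :: "mpoly poly" and a b
    by (simp only: mult_smult_right distrib_right smult_add_right) (simp add: mult.assoc mult.left_commute)
  \<comment> \<open>Substituting (T - t) \<open>q t\<close> + L(t) for L in the summand of t, with T
    the indeterminate, splits the product into the vanishing combination of the \<open>w t\<close>
    times a common factor, and multiples of the u_t L(t), which lie in \<open>K\<close>.\<close>
  have "?L * g = (\<Sum>t\<in>T. ?L * Polynomial.smult (const (c t) * u t) (Q (T - {t})))"
    by (simp add: g_def sum_distrib_left)
  also have "\<dots> = (\<Sum>t\<in>T. Polynomial.smult (const (c t)) (w t) * Q T +
      Polynomial.smult (const (c t) * (u t * moment_form n t)) (Q (T - {t})))"
  proof (rule sum.cong)
    fix t assume t: "t \<in> T"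
    have P: "Q T = [:- const t, 1:] * Q (T - {t})"
      unfolding Q_def using prod.remove[OF T(1) t] by blast
    have "?L * Polynomial.smult (const (c t) * u t) (Q (T - {t})) =
      ([:- const t, 1:] * q t + [:moment_form n t:]) * Polynomial.smult (const (c t) * u t) (Q (T - {t}))"
      using q[of t] by (rule arg_cong)
    also have "\<dots> = Polynomial.smult (const (c t) * u t) (q t * ([:- const t, 1:] * Q (T - {t}))) +
        Polynomial.smult (const (c t) * u t) (Polynomial.smult (moment_form n t) (Q (T - {t})))"
      by (rule factor)
    also have "\<dots> = Polynomial.smult (const (c t)) (w t) * Q T +
      Polynomial.smult (const (c t) * (u t * moment_form n t)) (Q (T - {t}))"
      unfolding P[symmetric] by (simp only: w_def mult_smult_left smult_smult mult.assoc)
    finally show "?L * Polynomial.smult (const (c t) * u t) (Q (T - {t})) = \<dots>" .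
  qed simp
  also have "\<dots> = (\<Sum>t\<in>T. Polynomial.smult (const (c t) * (u t * moment_form n t)) (Q (T - {t})))"
    by (simp only: sum.distrib sum_distrib_right[symmetric] dep) simp
  finally have Lg: "?L * g = \<dots>" .
  have "Polynomial.coeff (?L * g) i \<in> K (d + 1)" for i
    unfolding Lg coeff_sum
  proof (rule gideal_sum[OF K])
    fix t assume t: "t \<in> T"
    obtain z where "Polynomial.coeff (Q (T - {t})) i = const z"
      using Q_const[of "T - {t}" i] T(1) by auto
    then show "Polynomial.coeff (Polynomial.smult (const (c t) * (u t * moment_form n t)) (Q (T - {t}))) i \<in> K (d + 1)"
      using u(3)[OF t] by (auto intro!: gideal_mult_right[OF K const_S_part] gideal_const_mult[OF K])
  qed
  moreover have "Polynomial.coeff (?L * g) k = (\<Sum>i\<le>min n k. var i * Polynomial.coeff g (k - i))" for k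
    unfolding coeff_mult
    by (rule sum.mono_neutral_cong_right) (auto simp: coeff_moment_poly)
  ultimately have rel: "(\<Sum>i\<le>min n k. var i * Polynomial.coeff g (k - i)) \<in> K (d + 1)" for k
    by metis
  have "Polynomial.coeff g i \<in> K d" for i
    by (rule mccoy[OF K soc gS _ rel, of "Suc (Polynomial.degree g)"])
      (simp add: coeff_eq_0 gideal_0[OF K])
  then have eval: "poly g (const t) \<in> K d" for t by (rule poly_const_gideal[OF K])
  \<comment> \<open>Evaluation at such a parameter leaves only its own summand, a nonzero constant
    multiple of \<open>u t\<close>. As the coefficients of \<open>g\<close> lie in \<open>K\<close>,
    so would \<open>u t\<close>.\<close>
  obtain t where t: "t \<in> T" "c t \<noteq> 0" using c(1) by blast
  define z where "z = (\<Prod>j\<in>T - {t}. t - j)"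
  have "z \<noteq> 0" using T(1) by (auto simp: z_def)
  have const_prod: "const (\<Prod>j\<in>A. h j) = (\<Prod>j\<in>A. const (h j))" for A and h :: "complex \<Rightarrow> complex"
    by (induction A rule: infinite_finite_induct) (auto simp: const_mult)
  have "poly (Q (T - {s})) (const t) = (if s = t then const z else 0)" if "s \<in> T" for s
    using t(1) T(1) by (auto simp: Q_def z_def poly_prod const_prod const_diff intro!: bexI[of _ t])
  then have "poly g (const t) = (\<Sum>s\<in>T. if s = t then const (c t) * u t * const z else 0)"
    unfolding g_def poly_sum poly_smult by (intro sum.cong) auto
  also have "\<dots> = const (c t * z) * u t"
    using t(1) T(1) by (simp add: const_mult mult_ac)
  finally have "const (inverse (c t * z)) * (const (c t * z) * u t) \<in> K d"
    using eval[of t] gideal_const_mult[OF K] by metis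
  moreover have "c t * z \<noteq> 0" using t(2) \<open>z \<noteq> 0\<close> by simp
  ultimately show False using u(2)[OF t(1)] by (metis const_inverse_mult)
qed

text \<open>Each degree excludes finitely many parameters and the degrees are countable, whereas the
  complex numbers are not. Two ideals are treated at once because comparing two sequences takes one
  form that suits both.\<close>

lemma ex_common_nzd:
  assumes "gideal n K" "\<And>d. \<not> has_socle n K d" "gideal n K'" "\<And>d. \<not> has_socle n K' d"
  obtains z where "z \<in> S_part n 1" "nzd n K z 1" "nzd n K' z 1"
proof -
  define B where "B K d = {t. \<exists>u\<in>S_part n d. u \<notin> K d \<and> u * moment_form n t \<in> K (d + 1)}" for K d
  have "countable (\<Union>d. B K d \<union> B K' d)"
    using finite_bad_moment_parameters assms unfolding B_def
    by (intro countable_UN countable_Un) (auto intro!: countable_finite)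
  moreover have "uncountable (UNIV :: complex set)"
    using uncountable_UNIV_real countable_image[of UNIV Re] surjI[of Re complex_of_real] by auto
  ultimately obtain t where "t \<notin> (\<Union>d. B K d \<union> B K' d)" by (metis UNIV_I countable_subset subsetI)
  then show ?thesis using that[of "moment_form n t"] moment_form_S_part
    by (auto simp: nzd_def B_def)
qed

section \<open>Regular sequences of homogeneous polynomials\<close>

text \<open>Every form is listed with its degree. The head is absorbed into the base ideal, so
  inductions over the list must run over all \<open>K\<close>.\<close>

fun adjs :: "nat \<Rightarrow> (int \<Rightarrow> mpoly set) \<Rightarrow> (mpoly \<times> int) list \<Rightarrow> int \<Rightarrow> mpoly set" where
  "adjs n K [] = K"
| "adjs n K (g # gs) = adjs n (adj n K (fst g) (snd g)) gs"

fun hom_regular :: "nat \<Rightarrow> (int \<Rightarrow> mpoly set) \<Rightarrow> (mpoly \<times> int) list \<Rightarrow> bool" where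
  "hom_regular n K [] \<longleftrightarrow> True"
| "hom_regular n K (g # gs) \<longleftrightarrow> fst g \<in> S_part n (snd g) \<and> snd g > 0 \<and> nzd n K (fst g) (snd g) \<and>
     hom_regular n (adj n K (fst g) (snd g)) gs"

lemma adjs_append: "adjs n K (gs @ hs) = adjs n (adjs n K gs) hs"
  by (induction gs arbitrary: K) auto

lemma hom_regular_append:
  "hom_regular n K (gs @ hs) \<longleftrightarrow> hom_regular n K gs \<and> hom_regular n (adjs n K gs) hs"
  by (induction gs arbitrary: K) auto

lemma gideal_adjs:
  "gideal n K \<Longrightarrow> (\<And>g. g \<in> set gs \<Longrightarrow> fst g \<in> S_part n (snd g)) \<Longrightarrow> gideal n (adjs n K gs)"
  by (induction gs arbitrary: K) (auto intro: gideal_adj)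

lemma hom_regular_S_part: "hom_regular n K gs \<Longrightarrow> g \<in> set gs \<Longrightarrow> fst g \<in> S_part n (snd g)"
  by (induction gs arbitrary: K) auto

lemma gideal_adjs_regular: "gideal n K \<Longrightarrow> hom_regular n K gs \<Longrightarrow> gideal n (adjs n K gs)"
  by (rule gideal_adjs) (auto intro: hom_regular_S_part)

text \<open>The form \<open>z\<close> is carried past one member at a time by
  \<open>nzd_swap\<close>.\<close>

lemma hom_regular_move_front:
  assumes "gideal n K" "hom_regular n K gs" "z \<in> S_part n \<epsilon>" "nzd n (adjs n K gs) z \<epsilon>"
  shows "nzd n K z \<epsilon> \<and> hom_regular n (adj n K z \<epsilon>) gs \<and>
    adjs n (adj n K z \<epsilon>) gs = adj n (adjs n K gs) z \<epsilon>"
  using assms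
proof (induction gs arbitrary: K)
  case (Cons g gs)
  let ?K = "adj n K (fst g) (snd g)"
  have "gideal n ?K" using Cons.prems by (auto intro: gideal_adj)
  then have IH: "nzd n ?K z \<epsilon>" "hom_regular n (adj n ?K z \<epsilon>) gs"
    "adjs n (adj n ?K z \<epsilon>) gs = adj n (adjs n ?K gs) z \<epsilon>"
    using Cons.IH[of ?K] Cons.prems by auto
  then show ?case
    using nzd_swap[OF Cons.prems(1) _ _ _ Cons.prems(3) IH(1)] Cons.prems(2)
    by (simp add: adj_commute[of n K "fst g"])
qed simp

text \<open>A form of positive degree kills every socle element, which a nonzerodivisor cannot
  do.\<close>

lemma no_socle_if_nzd:
  assumes K: "gideal n K" and g: "g \<in> S_part n \<delta>" "\<delta> > 0" "nzd n K g \<delta>"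
  shows "\<not> has_socle n K d"
proof
  assume "has_socle n K d"
  then obtain u where u: "u \<in> S_part n d" "u \<notin> K d" "\<And>i. i \<le> n \<Longrightarrow> var i * u \<in> K (d + 1)"
    unfolding has_socle_def by blast
  have "g * u \<in> K (\<delta> + d)" by (rule gideal_positive_degree_mult[OF K u(3) g(1,2)])
  then have "u \<in> K d" by (intro nzdD[OF g(3) u(1), of "\<delta> + d"]) (auto simp: mult.commute)
  then show False using u(2) by blast
qed

text \<open>The last members of both sequences are replaced by a common nonzerodivisor, which is then
  moved to the front and divided out.\<close>

lemma regular_exchange:
  assumes "gideal n K" "hom_regular n K gs" "hom_regular n K ys" "length gs = length ys"
  shows "has_socle n (adjs n K gs) d \<Longrightarrow>
      has_socle n (adjs n K ys) (d + sum_list (map snd ys) - sum_list (map snd gs))"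
    and "finite_colength n (adjs n K ys) \<Longrightarrow> finite_colength n (adjs n K gs)"
proof -
  have "(has_socle n (adjs n K gs) d \<longrightarrow>
      has_socle n (adjs n K ys) (d + sum_list (map snd ys) - sum_list (map snd gs))) \<and>
    (finite_colength n (adjs n K ys) \<longrightarrow> finite_colength n (adjs n K gs))"
    using assms
  proof (induction "length gs" arbitrary: K gs ys d)
    case (Suc r)
    obtain gs' g \<gamma> where gs: "gs = gs' @ [(g, \<gamma>)]"
      using Suc.hyps(2) by (metis length_0_conv nat.distinct(1) prod.exhaust rev_exhaust)
    obtain ys' y \<eta> where ys: "ys = ys' @ [(y, \<eta>)]"
      using Suc.hyps(2) Suc.prems(4) by (metis length_0_conv nat.distinct(1) prod.exhaust rev_exhaust)
    let ?G = "adjs n K gs'" and ?Y = "adjs n K ys'"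
    have K: "gideal n K" by fact
    have G: "hom_regular n K gs'" "g \<in> S_part n \<gamma>" "\<gamma> > 0" "nzd n ?G g \<gamma>"
      and Y: "hom_regular n K ys'" "y \<in> S_part n \<eta>" "\<eta> > 0" "nzd n ?Y y \<eta>"
      using Suc.prems by (auto simp: gs ys hom_regular_append)
    have GK: "gideal n ?G" and YK: "gideal n ?Y" using gideal_adjs_regular K G(1) Y(1) by blast+
    obtain z where z: "z \<in> S_part n 1" "nzd n ?G z 1" "nzd n ?Y z 1"
      using ex_common_nzd[OF GK no_socle_if_nzd[OF GK G(2-4)] YK no_socle_if_nzd[OF YK Y(2-4)]] .
    let ?Z = "adj n K z 1"
    have moveG: "hom_regular n ?Z gs'" "adjs n ?Z gs' = adj n ?G z 1"
      using hom_regular_move_front[OF K G(1) z(1,2)] by auto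
    have moveY: "hom_regular n ?Z ys'" "adjs n ?Z ys' = adj n ?Y z 1"
      using hom_regular_move_front[OF K Y(1) z(1,3)] by auto
    have Z: "gideal n ?Z" by (rule gideal_adj[OF K z(1)])
    have len: "r = length gs'" "length gs' = length ys'" using Suc.hyps(2) Suc.prems(4) by (auto simp: gs ys)
    \<comment> \<open>The shortened sequences are compared over (K, z). Exchanging the last members
      adds 1 - \<gamma> and \<eta> - 1 to the shift of the socle degree, so the degree of z drops
      out.\<close>
    note IH = Suc.hyps(1)[OF len(1) Z moveG(1) moveY(1) len(2)]
    have eqs: "adjs n K gs = adj n ?G g \<gamma>" "adjs n K ys = adj n ?Y y \<eta>"
      by (simp_all add: gs ys adjs_append)
    show ?case
    proof (intro conjI impI)
      assume "has_socle n (adjs n K gs) d"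
      then have "has_socle n (adj n ?G z 1) (d + 1 - \<gamma>)"
        unfolding eqs by (intro has_socle_exchange[OF GK G(2,4) z(1) _ z(2)]) auto
      then have "has_socle n (adj n ?Y z 1) (d + 1 - \<gamma> + sum_list (map snd ys') - sum_list (map snd gs'))"
        using IH unfolding moveG(2) moveY(2) by blast
      then have "has_socle n (adj n ?Y y \<eta>)
          (d + 1 - \<gamma> + sum_list (map snd ys') - sum_list (map snd gs') + \<eta> - 1)"
        by (rule has_socle_exchange[OF YK z(1,3) Y(2-4)])
      then show "has_socle n (adjs n K ys) (d + sum_list (map snd ys) - sum_list (map snd gs))"
        unfolding eqs by (simp add: gs ys algebra_simps)
    next
      assume "finite_colength n (adjs n K ys)"
      then have "finite_colength n (adj n ?Y z 1)"
        unfolding eqs by (intro finite_colength_exchange[OF YK z(1) _ z(3) Y(2,3)]) auto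
      then have "finite_colength n (adj n ?G z 1)"
        using IH unfolding moveG(2) moveY(2) by blast
      then show "finite_colength n (adjs n K gs)"
        unfolding eqs by (intro finite_colength_exchange[OF GK G(2-4) z(1)]) auto
    qed
  qed simp
  then show "has_socle n (adjs n K gs) d \<Longrightarrow>
      has_socle n (adjs n K ys) (d + sum_list (map snd ys) - sum_list (map snd gs))"
    and "finite_colength n (adjs n K ys) \<Longrightarrow> finite_colength n (adjs n K gs)" by blast+
qed

text \<open>The ideal generated by x_0, ..., x_(m-1), described by its monomials so that membership
  is decided term by term. These ideals are the standard of comparison for all regular
  sequences.\<close>

definition var_gideal :: "nat \<Rightarrow> nat \<Rightarrow> int \<Rightarrow> mpoly set" where
  "var_gideal n m d = {p \<in> S_part n d. \<forall>t\<in>Poly_Mapping.keys p. \<exists>i<m. i \<in> Poly_Mapping.keys t}"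

lemma keys_mult_var: "Poly_Mapping.keys (p * var i) = (\<lambda>t. t + Poly_Mapping.single i 1) ` Poly_Mapping.keys p"
proof -
  have lk: "Poly_Mapping.lookup (p * var i) (t + Poly_Mapping.single i 1) = Poly_Mapping.lookup p t" for t
  proof -
    have "p * var i = (\<Sum>s\<in>Poly_Mapping.keys p. Poly_Mapping.single (s + Poly_Mapping.single i 1) (Poly_Mapping.lookup p s))"
      by (subst mpoly_expand[of p]) (simp add: sum_distrib_right var_def mult_single)
    then show ?thesis
      by (auto simp: lookup_sum lookup_single when_def in_keys_iff sum.delta)
  qed
  have sub: "Poly_Mapping.keys (p * var i) \<subseteq> (\<lambda>t. t + Poly_Mapping.single i 1) ` Poly_Mapping.keys p"
    using keys_mult[of p "var i"] by (auto simp: var_def)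
  show ?thesis
  proof (rule equalityI[OF sub], rule subsetI)
    fix s assume "s \<in> (\<lambda>t. t + Poly_Mapping.single i 1) ` Poly_Mapping.keys p"
    then show "s \<in> Poly_Mapping.keys (p * var i)" using lk by (auto simp: in_keys_iff)
  qed
qed

lemma gideal_var_gideal: "gideal n (var_gideal n m)"
proof (rule gidealI)
  show "p + q \<in> var_gideal n m d" if "p \<in> var_gideal n m d" "q \<in> var_gideal n m d" for d p q
    using that keys_add[of p q] by (fastforce simp: var_gideal_def intro: S_part_add)
  show "r * p \<in> var_gideal n m (e + d)" if "r \<in> S_part n e" "p \<in> var_gideal n m d" for d e r p
  proof -
    have "\<exists>i<m. i \<in> Poly_Mapping.keys t" if t: "t \<in> Poly_Mapping.keys (r * p)" for t
    proof -
      obtain a b where "t = a + b" "b \<in> Poly_Mapping.keys p" using keys_mult[of r p] t by blast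
      then show ?thesis using \<open>p \<in> var_gideal n m d\<close> by (auto simp: var_gideal_def keys_add_nat)
    qed
    then show ?thesis using that by (simp add: var_gideal_def S_part_mult)
  qed
qed (auto simp: var_gideal_def)

lemma nzd_var_gideal: "nzd n (var_gideal n m) (var m) 1"
proof (rule nzdI)
  fix d u assume u: "u \<in> S_part n d" "u * var m \<in> var_gideal n m (d + 1)"
  then have "\<exists>i<m. i \<in> Poly_Mapping.keys (t + Poly_Mapping.single m 1)" if "t \<in> Poly_Mapping.keys u" for t
    using that by (auto simp: var_gideal_def keys_mult_var)
  then show "u \<in> var_gideal n m d" using u(1) by (fastforce simp: var_gideal_def keys_add_nat)
qed

lemma adj_var_gideal:
  assumes m: "m \<le> n"
  shows "adj n (var_gideal n m) (var m) 1 = var_gideal n (Suc m)"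
proof (intro ext equalityI subsetI)
  fix d p
  assume "p \<in> adj n (var_gideal n m) (var m) 1 d"
  then obtain k r where p: "p = k + r * var m" "k \<in> var_gideal n m d" "r \<in> S_part n (d - 1)"
    by (rule adjE)
  have k: "k \<in> var_gideal n (Suc m) d" using p(2) less_SucI unfolding var_gideal_def by blast
  have "r * var m \<in> S_part n d" by (rule S_part_mult'[OF p(3) var_S_part[OF m]]) simp
  then have "r * var m \<in> var_gideal n (Suc m) d"
    by (auto simp: var_gideal_def keys_mult_var keys_add_nat)
  with k show "p \<in> var_gideal n (Suc m) d" unfolding p(1) by (rule gideal_add[OF gideal_var_gideal])
next
  fix d p
  assume p: "p \<in> var_gideal n (Suc m) d"
  let ?A = "adj n (var_gideal n m) (var m) 1"
  have A: "gideal n ?A" by (rule gideal_adj[OF gideal_var_gideal var_S_part[OF m]])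
  have "Poly_Mapping.single t (Poly_Mapping.lookup p t) \<in> ?A d" if t: "t \<in> Poly_Mapping.keys p" for t
  proof -
    have t': "Poly_Mapping.keys t \<subseteq> {..n}" "int (mon_deg t) = d" "\<exists>i<Suc m. i \<in> Poly_Mapping.keys t"
      using p t by (auto simp: var_gideal_def S_part_iff)
    have "Poly_Mapping.single t 1 \<in> ?A d"
    proof (cases "\<exists>i<m. i \<in> Poly_Mapping.keys t")
      case True
      then show ?thesis using t' by (intro adj_base) (simp add: var_gideal_def S_part_iff)
    next
      case False
      then have mt: "m \<in> Poly_Mapping.keys t" using t'(3) less_Suc_eq by auto
      define s where "s = t - Poly_Mapping.single m 1"
      have st: "t = s + Poly_Mapping.single m 1"
        unfolding s_def by (rule poly_mapping_eqI)
          (use mt in \<open>auto simp: lookup_add lookup_minus lookup_single when_def in_keys_iff\<close>)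
      then have "Poly_Mapping.single t 1 = Poly_Mapping.single s 1 * var m"
        by (simp add: var_def mult_single)
      moreover have "Poly_Mapping.single s 1 \<in> S_part n (d - 1)"
        using t'(1,2) unfolding st by (auto simp: S_part_iff keys_add_nat mon_deg_add)
      ultimately show ?thesis by (simp add: adj_mult[OF gideal_var_gideal])
    qed
    then show ?thesis by (subst single_eq_const_mult) (rule gideal_const_mult[OF A])
  qed
  then show "p \<in> ?A d" by (subst mpoly_expand[of p]) (rule gideal_sum[OF A])
qed

lemma hom_regular_vars:
  assumes "m \<le> Suc n"
  shows "hom_regular n (\<lambda>_. {0}) (map (\<lambda>i. (var i, 1)) [0..<m]) \<and>
    adjs n (\<lambda>_. {0}) (map (\<lambda>i. (var i, 1)) [0..<m]) = var_gideal n m"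
  using assms
proof (induction m)
  case 0
  then show ?case by (auto simp: var_gideal_def intro!: ext)
next
  case (Suc m)
  then show ?case by (simp add: hom_regular_append adjs_append nzd_var_gideal adj_var_gideal var_S_part)
qed

text \<open>A socle would be carried over to the quotient by the first \<open>length gs\<close>
  variables, where the next variable is a nonzerodivisor; there is a next one since at most n of the
  n + 1 variables are used.\<close>

lemma hom_regular_no_socle:
  assumes "hom_regular n (\<lambda>_. {0}) gs" "length gs \<le> n"
  shows "\<not> has_socle n (adjs n (\<lambda>_. {0}) gs) d"
proof
  let ?ys = "map (\<lambda>i. (var i, 1)) [0..<length gs]"
  assume "has_socle n (adjs n (\<lambda>_. {0}) gs) d"
  then have "has_socle n (var_gideal n (length gs)) (d + sum_list (map snd ?ys) - sum_list (map snd gs))"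
    using regular_exchange(1)[OF gideal_zero assms(1), of ?ys d] hom_regular_vars[of "length gs" n] assms(2)
    by auto
  then show False
    using no_socle_if_nzd[OF gideal_var_gideal var_S_part _ nzd_var_gideal] assms(2) by force
qed

text \<open>The quotient by all n + 1 variables is the ground field, with its socle in degree 0; the
  exchange shifts this by the difference of the sums of degrees.\<close>

lemma hom_regular_socle_degree:
  assumes "hom_regular n (\<lambda>_. {0}) gs" "length gs = Suc n" "has_socle n (adjs n (\<lambda>_. {0}) gs) d"
  shows "d = sum_list (map snd gs) - int (Suc n)"
proof -
  let ?ys = "map (\<lambda>i. (var i, 1::int)) [0..<Suc n]"
  have "has_socle n (var_gideal n (Suc n)) (d + sum_list (map snd ?ys) - sum_list (map snd gs))"
    using regular_exchange(1)[OF gideal_zero assms(1), of ?ys d] hom_regular_vars[of "Suc n" n] assms(2,3)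
    by (auto simp del: upt_Suc)
  then obtain u where u: "u \<in> S_part n (d + sum_list (map snd ?ys) - sum_list (map snd gs))"
    "u \<notin> var_gideal n (Suc n) (d + sum_list (map snd ?ys) - sum_list (map snd gs))"
    unfolding has_socle_def by blast
  then obtain t where t: "t \<in> Poly_Mapping.keys u" "\<forall>i<Suc n. i \<notin> Poly_Mapping.keys t"
    by (auto simp: var_gideal_def)
  moreover have "Poly_Mapping.keys t \<subseteq> {..n}" using u(1) t(1) by (simp add: S_part_iff)
  ultimately have "Poly_Mapping.keys t = {}" by (metis atMost_iff equals0I less_Suc_eq_le subsetD)
  then have "t = 0" by simp
  then have "d + sum_list (map snd ?ys) - sum_list (map snd gs) = 0" using u(1) t(1) by (auto simp: S_part_iff)
  moreover have "sum_list (map snd ?ys) = int (Suc n)"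
    by (simp add: o_def map_replicate_const sum_list_replicate del: upt_Suc)
  ultimately show ?thesis by simp
qed

text \<open>Transported from the variables, whose quotient vanishes in all positive degrees.\<close>

lemma hom_regular_finite_colength:
  assumes "hom_regular n (\<lambda>_. {0}) gs" "length gs = Suc n"
  shows "finite_colength n (adjs n (\<lambda>_. {0}) gs)"
proof -
  let ?ys = "map (\<lambda>i. (var i, 1::int)) [0..<Suc n]"
  have "finite_colength n (var_gideal n (Suc n))"
    unfolding finite_colength_def
  proof (intro exI[of _ 1] allI impI subsetI)
    fix d :: int and p assume d: "d \<ge> 1" and p: "p \<in> S_part n d"
    have "\<exists>i<Suc n. i \<in> Poly_Mapping.keys t" if "t \<in> Poly_Mapping.keys p" for t
    proof -
      have "Poly_Mapping.keys t \<subseteq> {..n}" "int (mon_deg t) = d" using p that by (auto simp: S_part_iff)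
      moreover from this obtain i where "i \<in> Poly_Mapping.keys t" using d by (fastforce simp: mon_deg_def)
      ultimately show ?thesis by (auto simp: less_Suc_eq_le)
    qed
    then show "p \<in> var_gideal n (Suc n) d" using p by (simp add: var_gideal_def)
  qed
  then show ?thesis
    using regular_exchange(2)[OF gideal_zero assms(1), of ?ys] hom_regular_vars[of "Suc n" n] assms(2)
    by (auto simp del: upt_Suc)
qed

section \<open>Homogeneous ideals as sets of polynomials\<close>

lemma ideal_poly_S_iff:
  "ideal I (poly_S n) \<longleftrightarrow> I \<subseteq> carrier (poly_S n) \<and> 0 \<in> I \<and> (\<forall>p\<in>I. \<forall>q\<in>I. p + q \<in> I) \<and>
     (\<forall>r\<in>carrier (poly_S n). \<forall>p\<in>I. r * p \<in> I)"
proof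
  assume I: "ideal I (poly_S n)"
  note add = ideal.axioms(1)[OF I]
  show "I \<subseteq> carrier (poly_S n) \<and> 0 \<in> I \<and> (\<forall>p\<in>I. \<forall>q\<in>I. p + q \<in> I) \<and>
     (\<forall>r\<in>carrier (poly_S n). \<forall>p\<in>I. r * p \<in> I)"
    using additive_subgroup.a_subset[OF add] additive_subgroup.zero_closed[OF add]
      additive_subgroup.a_closed[OF add] ideal.I_l_closed[OF I] by auto
next
  assume I: "I \<subseteq> carrier (poly_S n) \<and> 0 \<in> I \<and> (\<forall>p\<in>I. \<forall>q\<in>I. p + q \<in> I) \<and>
     (\<forall>r\<in>carrier (poly_S n). \<forall>p\<in>I. r * p \<in> I)"
  interpret cring "poly_S n" by (rule cring_poly_S)
  have right: "p * r \<in> I" if "r \<in> carrier (poly_S n)" "p \<in> I" for p r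
    using I that by (metis mult.commute)
  have neg: "- p \<in> I" if "p \<in> I" for p
  proof -
    have "- 1 \<in> carrier (poly_S n)" by (intro poly_S_uminus poly_S_one)
    then have "- 1 * p \<in> I" using I that by blast
    then show ?thesis by simp
  qed
  have a_inv: "inv\<^bsub>add_monoid (poly_S n)\<^esub> p = - p" if "p \<in> carrier (poly_S n)" for p
    using minus_equality[of "- p" p] that unfolding a_inv_def by (auto intro: poly_S_uminus)
  show "ideal I (poly_S n)"
  proof (rule idealI[OF ring_poly_S])
    show "subgroup I (add_monoid (poly_S n))"
      using I neg a_inv by (intro subgroup.intro) (auto simp: subset_iff)
  qed (use I right in auto)
qed

lemma ideal_poly_S:
  assumes "ideal I (poly_S n)"
  shows ideal_carrier: "p \<in> I \<Longrightarrow> p \<in> carrier (poly_S n)"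
    and ideal_0: "0 \<in> I"
    and ideal_add: "p \<in> I \<Longrightarrow> q \<in> I \<Longrightarrow> p + q \<in> I"
    and ideal_mult: "r \<in> carrier (poly_S n) \<Longrightarrow> p \<in> I \<Longrightarrow> r * p \<in> I"
    and ideal_mult_right: "r \<in> carrier (poly_S n) \<Longrightarrow> p \<in> I \<Longrightarrow> p * r \<in> I"
    and ideal_diff: "p \<in> I \<Longrightarrow> q \<in> I \<Longrightarrow> p - q \<in> I"
proof -
  have 1: "- 1 \<in> carrier (poly_S n)" by (intro poly_S_uminus poly_S_one)
  have *: "I \<subseteq> carrier (poly_S n)" "0 \<in> I" "\<And>p q. p \<in> I \<Longrightarrow> q \<in> I \<Longrightarrow> p + q \<in> I"
    "\<And>r p. r \<in> carrier (poly_S n) \<Longrightarrow> p \<in> I \<Longrightarrow> r * p \<in> I"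
    using assms unfolding ideal_poly_S_iff by blast+
  show "0 \<in> I" by fact
  show "p \<in> carrier (poly_S n)" if "p \<in> I" using * that by blast
  show "p + q \<in> I" if "p \<in> I" "q \<in> I" using * that by blast
  show "r * p \<in> I" "p * r \<in> I" if "r \<in> carrier (poly_S n)" "p \<in> I"
    using *(4)[OF that] by (simp_all add: mult.commute)
  show "p - q \<in> I" if "p \<in> I" "q \<in> I"
    using *(3)[OF that(1) *(4)[OF 1 that(2)]] by simp
qed

lemma ideal_sum: "ideal I (poly_S n) \<Longrightarrow> (\<And>a. a \<in> A \<Longrightarrow> g a \<in> I) \<Longrightarrow> sum g A \<in> I"
  by (induction A rule: infinite_finite_induct) (auto intro: ideal_add ideal_0)

lemma const_carrier [simp]: "const c \<in> carrier (poly_S n)"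
  using const_S_part by (rule S_part_carrier)

lemma prime_poly_S:
  assumes "primeideal P (poly_S n)"
  shows prime_ideal: "ideal P (poly_S n)"
    and prime_one: "1 \<notin> P"
    and prime_mult: "p \<in> carrier (poly_S n) \<Longrightarrow> q \<in> carrier (poly_S n) \<Longrightarrow> p * q \<in> P \<Longrightarrow> p \<in> P \<or> q \<in> P"
proof -
  interpret primeideal P "poly_S n" by fact
  show P: "ideal P (poly_S n)" by unfold_locales
  show "1 \<notin> P"
    using I_notcarr one_imp_carrier by auto
  show "p \<in> P \<or> q \<in> P" if "p \<in> carrier (poly_S n)" "q \<in> carrier (poly_S n)" "p * q \<in> P"
    using I_prime[of p q] that by simp
qed

lemma primeideal_poly_SI:
  assumes "ideal P (poly_S n)" "1 \<notin> P"
    "\<And>p q. p \<in> carrier (poly_S n) \<Longrightarrow> q \<in> carrier (poly_S n) \<Longrightarrow> p * q \<in> P \<Longrightarrow> p \<in> P \<or> q \<in> P"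
  shows "primeideal P (poly_S n)"
  using assms cring_poly_S poly_S_one by (intro primeidealI) auto

lemma prime_power:
  assumes "primeideal P (poly_S n)" "p \<in> carrier (poly_S n)" "p ^ k \<in> P"
  shows "p \<in> P"
  using assms(3)
proof (induction k)
  case 0
  then show ?case using prime_one[OF assms(1)] by simp
next
  case (Suc k)
  have "p ^ k \<in> carrier (poly_S n)" by (induction k) (auto intro: poly_S_closed assms)
  then show ?case using Suc prime_mult[OF assms(1,2)] by auto
qed

lemma poly_S_prod: "(\<And>a. a \<in> A \<Longrightarrow> g a \<in> carrier (poly_S n)) \<Longrightarrow> prod g A \<in> carrier (poly_S n)"
  by (induction A rule: infinite_finite_induct) (auto intro: poly_S_closed)

lemma prime_prod:
  assumes P: "primeideal P (poly_S n)" and A: "finite A" "\<And>a. a \<in> A \<Longrightarrow> g a \<in> carrier (poly_S n)" "prod g A \<in> P"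
  shows "\<exists>a\<in>A. g a \<in> P"
  using A
proof (induction A rule: finite_induct)
  case (insert a A)
  then show ?case using prime_mult[OF P, of "g a" "prod g A"] by (auto intro: poly_S_prod)
qed (use prime_one[OF P] in auto)

lemma ideal_prod_mem:
  assumes "ideal I (poly_S n)" "finite A" "b \<in> A" "g b \<in> I" "\<And>a. a \<in> A \<Longrightarrow> g a \<in> carrier (poly_S n)"
  shows "prod g A \<in> I"
proof -
  have "prod g (A - {b}) \<in> carrier (poly_S n)" using assms(5) by (intro poly_S_prod) auto
  then have "g b * prod g (A - {b}) \<in> I" using assms(1,4) by (intro ideal_mult_right)
  then show ?thesis using prod.remove[OF assms(2,3), of g] by simp
qed

lemma genideal_least: "ideal I (poly_S n) \<Longrightarrow> X \<subseteq> I \<Longrightarrow> genideal (poly_S n) X \<subseteq> I"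
  unfolding genideal_def by auto

lemma genideal_is_ideal:
  "X \<subseteq> carrier (poly_S n) \<Longrightarrow> ideal (genideal (poly_S n) X) (poly_S n) \<and> X \<subseteq> genideal (poly_S n) X"
  using ring.genideal_ideal[OF ring_poly_S] ring.genideal_self[OF ring_poly_S] by blast

section \<open>Homogeneous components and total ideals\<close>

definition hom_comp :: "int \<Rightarrow> mpoly \<Rightarrow> mpoly" where
  "hom_comp d p = (\<Sum>t\<in>Poly_Mapping.keys p.
     if int (mon_deg t) = d then Poly_Mapping.single t (Poly_Mapping.lookup p t) else 0)"

lemma lookup_hom_comp:
  "Poly_Mapping.lookup (hom_comp d p) t = (if int (mon_deg t) = d then Poly_Mapping.lookup p t else 0)"
proof -
  have "Poly_Mapping.lookup (hom_comp d p) t = (\<Sum>s\<in>Poly_Mapping.keys p.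
      if s = t then (if int (mon_deg t) = d then Poly_Mapping.lookup p t else 0) else 0)"
    unfolding hom_comp_def lookup_sum by (intro sum.cong) (auto simp: lookup_single when_def)
  then show ?thesis by (auto simp: in_keys_iff)
qed

lemma hom_comp_add: "hom_comp d (p + q) = hom_comp d p + hom_comp d q"
  by (rule poly_mapping_eqI) (auto simp: lookup_hom_comp lookup_add)

lemma hom_comp_0 [simp]: "hom_comp d 0 = 0"
  by (simp add: hom_comp_def)

lemma hom_comp_sum: "hom_comp d (sum g A) = (\<Sum>a\<in>A. hom_comp d (g a))"
  by (induction A rule: infinite_finite_induct) (auto simp: hom_comp_add)

lemma hom_comp_S_part: "p \<in> carrier (poly_S n) \<Longrightarrow> hom_comp d p \<in> S_part n d"
  by (auto simp: S_part_iff carrier_poly_S_iff in_keys_iff lookup_hom_comp split: if_splits)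

lemma hom_comp_homogeneous: "p \<in> S_part n e \<Longrightarrow> hom_comp d p = (if d = e then p else 0)"
  by (rule poly_mapping_eqI) (auto simp: lookup_hom_comp S_part_iff in_keys_iff)

definition degrees :: "mpoly \<Rightarrow> int set" where
  "degrees p = (\<lambda>t. int (mon_deg t)) ` Poly_Mapping.keys p"

lemma finite_degrees [simp]: "finite (degrees p)"
  by (simp add: degrees_def)

lemma hom_comp_expand: "p = (\<Sum>d\<in>degrees p. hom_comp d p)"
proof (rule poly_mapping_eqI)
  fix t
  show "Poly_Mapping.lookup p t = Poly_Mapping.lookup (\<Sum>d\<in>degrees p. hom_comp d p) t"
    by (cases "t \<in> Poly_Mapping.keys p") (auto simp: lookup_sum lookup_hom_comp degrees_def in_keys_iff)
qed

lemma hom_comp_notin_degrees: "d \<notin> degrees p \<Longrightarrow> hom_comp d p = 0"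
  by (rule poly_mapping_eqI) (auto simp: lookup_hom_comp degrees_def in_keys_iff)

text \<open>The ordinary ideal with graded pieces \<open>K d\<close>; it links the families to the
  ideals and primes of the ring \<open>poly_S n\<close>.\<close>

definition gtotal :: "nat \<Rightarrow> (int \<Rightarrow> mpoly set) \<Rightarrow> mpoly set" where
  "gtotal n K = {p \<in> carrier (poly_S n). \<forall>d. hom_comp d p \<in> K d}"

lemma gtotal_homogeneous:
  assumes "gideal n K" "p \<in> S_part n d"
  shows "p \<in> gtotal n K \<longleftrightarrow> p \<in> K d"
  using assms(2) gideal_0[OF assms(1)]
  by (auto simp: gtotal_def hom_comp_homogeneous[OF assms(2)] S_part_carrier)

lemma gtotal_subset: "gideal n K \<Longrightarrow> K d \<subseteq> gtotal n K"
  using gtotal_homogeneous gideal_S_part by blast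

lemma gtotal_in_ideal:
  assumes "ideal I (poly_S n)" "\<And>d. K d \<subseteq> I"
  shows "gtotal n K \<subseteq> I"
proof
  fix p assume "p \<in> gtotal n K"
  then have "(\<Sum>d\<in>degrees p. hom_comp d p) \<in> I"
    using assms(2) by (intro ideal_sum[OF assms(1)]) (auto simp: gtotal_def)
  then show "p \<in> I" using hom_comp_expand[of p] by simp
qed

lemma ideal_gtotal:
  assumes K: "gideal n K"
  shows "ideal (gtotal n K) (poly_S n)"
proof -
  have add: "p + q \<in> gtotal n K" if "p \<in> gtotal n K" "q \<in> gtotal n K" for p q
    using that by (auto simp: gtotal_def hom_comp_add intro: poly_S_add gideal_add[OF K])
  have zero: "0 \<in> gtotal n K" by (auto simp: gtotal_def poly_S_zero gideal_0[OF K])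
  have sum: "sum g A \<in> gtotal n K" if "\<And>a. a \<in> A \<Longrightarrow> g a \<in> gtotal n K" for g and A :: "int set"
    using that by (induction A rule: infinite_finite_induct) (auto intro: add zero)
  have "r * p \<in> gtotal n K" if r: "r \<in> carrier (poly_S n)" and p: "p \<in> gtotal n K" for r p
  proof -
    have "hom_comp j p \<in> K j" for j using p by (simp add: gtotal_def)
    then have "hom_comp i r * hom_comp j p \<in> gtotal n K" for i j
      using gideal_mult[OF K hom_comp_S_part[OF r]] gtotal_subset[OF K] by blast
    then have "(\<Sum>i\<in>degrees r. \<Sum>j\<in>degrees p. hom_comp i r * hom_comp j p) \<in> gtotal n K"
      by (intro sum)
    then show ?thesis
      using hom_comp_expand[of r] hom_comp_expand[of p] by (simp flip: sum_product)
  qed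
  then show ?thesis unfolding ideal_poly_S_iff using add zero by (auto simp: gtotal_def)
qed

lemma homogeneous_ideal_gtotal:
  assumes K: "gideal n K"
  shows "homogeneous_ideal n (gtotal n K)"
  unfolding homogeneous_ideal_def
proof (intro conjI equalityI)
  let ?X = "gtotal n K \<inter> (\<Union>d. S_part n d)"
  show "ideal (gtotal n K) (poly_S n)" by (rule ideal_gtotal[OF K])
  have "?X \<subseteq> carrier (poly_S n)" by (auto simp: gtotal_def)
  then have G: "ideal (genideal (poly_S n) ?X) (poly_S n)" "?X \<subseteq> genideal (poly_S n) ?X"
    using genideal_is_ideal by blast+
  have "K d \<subseteq> ?X" for d using gtotal_subset[OF K, of d] gideal_S_part[OF K] by fast
  then show "gtotal n K \<subseteq> genideal (poly_S n) ?X"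
    using G(2) by (intro gtotal_in_ideal[OF G(1)]) blast
  show "genideal (poly_S n) ?X \<subseteq> gtotal n K" by (rule genideal_least[OF ideal_gtotal[OF K]]) auto
qed

lemma homogeneous_ideal_subset:
  assumes "homogeneous_ideal n P" "ideal Q (poly_S n)" "\<And>d. P \<inter> S_part n d \<subseteq> Q"
  shows "P \<subseteq> Q"
proof -
  have "genideal (poly_S n) (P \<inter> (\<Union>d. S_part n d)) \<subseteq> Q"
    using assms(3) by (intro genideal_least[OF assms(2)]) auto
  then show ?thesis using assms(1) by (simp add: homogeneous_ideal_def)
qed

text \<open>Two inductions over the list: \<open>mem\<close> finds the generators in the family, and
  \<open>gen\<close> keeps the family inside every ideal that contains them.\<close>

lemma genideal_eq_gtotal_adjs:
  assumes "\<And>g. g \<in> set gs \<Longrightarrow> fst g \<in> S_part n (snd g)"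
  shows "genideal (poly_S n) (fst ` set gs) = gtotal n (adjs n (\<lambda>_. {0}) gs)"
proof
  have K: "gideal n (adjs n (\<lambda>_. {0}) gs)" using assms by (intro gideal_adjs gideal_zero)
  have mono: "K d \<subseteq> adjs n K hs d" for K hs d
    by (induction hs arbitrary: K) (auto dest: adj_base)
  have mem: "\<And>g. g \<in> set hs \<Longrightarrow> fst g \<in> adjs n K hs (snd g)"
    if "gideal n K" "\<And>g. g \<in> set hs \<Longrightarrow> fst g \<in> S_part n (snd g)" for K hs
    using that
  proof (induction hs arbitrary: K)
    case (Cons h hs)
    have "1 * fst h \<in> adj n K (fst h) (snd h) (snd h)" by (intro adj_mult Cons.prems) simp
    then have "fst h \<in> adjs n (adj n K (fst h) (snd h)) hs (snd h)" using mono by auto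
    moreover have "gideal n (adj n K (fst h) (snd h))" using Cons.prems by (intro gideal_adj) auto
    ultimately show ?case using Cons.IH[where K = "adj n K (fst h) (snd h)"] Cons.prems by auto
  qed simp
  show "genideal (poly_S n) (fst ` set gs) \<subseteq> gtotal n (adjs n (\<lambda>_. {0}) gs)"
  proof (intro genideal_least ideal_gtotal[OF K] subsetI)
    fix p assume "p \<in> fst ` set gs"
    then obtain g where g: "g \<in> set gs" "p = fst g" by blast
    then show "p \<in> gtotal n (adjs n (\<lambda>_. {0}) gs)"
      using mem[OF gideal_zero assms g(1)] gtotal_subset[OF K] by blast
  qed
  have gen: "\<And>d. adjs n K hs d \<subseteq> Q"
    if "ideal Q (poly_S n)" "\<And>d. K d \<subseteq> Q" "fst ` set hs \<subseteq> Q" for K hs Q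
    using that
  proof (induction hs arbitrary: K)
    case (Cons h hs)
    have "adj n K (fst h) (snd h) d \<subseteq> Q" for d
      using Cons.prems by (auto elim!: adjE intro!: ideal_add ideal_mult dest: S_part_carrier)
    then show ?case using Cons.IH[where K = "adj n K (fst h) (snd h)"] Cons.prems by auto
  qed simp
  have "fst ` set gs \<subseteq> carrier (poly_S n)" using assms S_part_carrier by blast
  then have G: "ideal (genideal (poly_S n) (fst ` set gs)) (poly_S n)"
    "fst ` set gs \<subseteq> genideal (poly_S n) (fst ` set gs)" using genideal_is_ideal by blast+
  show "gtotal n (adjs n (\<lambda>_. {0}) gs) \<subseteq> genideal (poly_S n) (fst ` set gs)"
    by (rule gtotal_in_ideal[OF G(1)], rule gen[OF G(1) _ G(2)]) (use ideal_0[OF G(1)] in auto)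
qed

text \<open>If p and q lie outside, consider their highest components outside \<open>K\<close>, in
  degrees d and e. In the component of p q of degree d + e every other product has a factor in
  \<open>K\<close>, so the product of these two lies in \<open>K\<close>.\<close>

lemma primeideal_gtotal:
  assumes K: "gideal n K" and one: "1 \<notin> K 0"
    and prime: "\<And>d e p q. p \<in> S_part n d \<Longrightarrow> q \<in> S_part n e \<Longrightarrow> p * q \<in> K (d + e) \<Longrightarrow> p \<in> K d \<or> q \<in> K e"
  shows "primeideal (gtotal n K) (poly_S n)"
proof (rule primeideal_poly_SI[OF ideal_gtotal[OF K]])
  show "1 \<notin> gtotal n K" using gtotal_homogeneous[OF K one_S_part] one by simp
  fix p q assume p: "p \<in> carrier (poly_S n)" and q: "q \<in> carrier (poly_S n)" and pq: "p * q \<in> gtotal n K"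
  have top: "\<exists>d\<in>degrees r. hom_comp d r \<notin> K d \<and> (\<forall>i>d. hom_comp i r \<in> K i)"
    if r: "r \<in> carrier (poly_S n)" "r \<notin> gtotal n K" for r
  proof -
    let ?D = "{d \<in> degrees r. hom_comp d r \<notin> K d}"
    have "?D \<noteq> {}" using r gideal_0[OF K] hom_comp_notin_degrees by (force simp: gtotal_def)
    then have "Max ?D \<in> ?D" by (intro Max_in) auto
    moreover have "hom_comp i r \<in> K i" if "i > Max ?D" for i
    proof (rule ccontr)
      assume "hom_comp i r \<notin> K i"
      then have "i \<in> ?D" using gideal_0[OF K, of i] hom_comp_notin_degrees[of i r] by fastforce
      then have "i \<le> Max ?D" by (intro Max_ge) auto
      then show False using that by simp
    qed
    ultimately show ?thesis by blast
  qed
  show "p \<in> gtotal n K \<or> q \<in> gtotal n K"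
  proof (rule ccontr)
    assume "\<not> (p \<in> gtotal n K \<or> q \<in> gtotal n K)"
    then obtain d e where d: "d \<in> degrees p" "hom_comp d p \<notin> K d" "\<And>i. i > d \<Longrightarrow> hom_comp i p \<in> K i"
      and e: "e \<in> degrees q" "hom_comp e q \<notin> K e" "\<And>i. i > e \<Longrightarrow> hom_comp i q \<in> K i"
      using top p q by metis
    let ?h = "\<lambda>i j. hom_comp i p * hom_comp j q"
    let ?A = "degrees p \<times> degrees q"
    have pS: "hom_comp i p \<in> S_part n i" and qS: "hom_comp i q \<in> S_part n i" for i
      using p q hom_comp_S_part by blast+
    have "p * q = (\<Sum>i\<in>degrees p. hom_comp i p) * (\<Sum>j\<in>degrees q. hom_comp j q)"
      using hom_comp_expand[of p] hom_comp_expand[of q] by simp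
    also have "\<dots> = (\<Sum>(i, j)\<in>?A. ?h i j)" by (simp add: sum_product sum.cartesian_product)
    finally have "hom_comp (d + e) (p * q) = (\<Sum>(i, j)\<in>?A. hom_comp (d + e) (?h i j))"
      by (simp add: hom_comp_sum case_prod_unfold)
    also have "\<dots> = (\<Sum>(i, j)\<in>?A. if d + e = i + j then ?h i j else 0)"
      by (intro sum.cong refl) (auto simp: hom_comp_homogeneous[OF S_part_mult[OF pS qS]])
    also have "\<dots> = ?h d e + (\<Sum>(i, j)\<in>?A - {(d, e)}. if d + e = i + j then ?h i j else 0)"
      using d(1) e(1) by (subst sum.remove[of _ "(d, e)"]) auto
    finally have eq: "hom_comp (d + e) (p * q) = \<dots>" .
    have "(\<Sum>(i, j)\<in>?A - {(d, e)}. if d + e = i + j then ?h i j else 0) \<in> K (d + e)"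
    proof (rule gideal_sum[OF K])
      fix x assume "x \<in> ?A - {(d, e)}"
      then obtain i j where x: "x = (i, j)" "(i, j) \<noteq> (d, e)" by auto
      have "?h i j \<in> K (d + e)" if ij: "d + e = i + j"
      proof (cases "i > d")
        case True
        then show ?thesis using gideal_mult_right[OF K qS d(3)] ij by auto
      next
        case False
        then have "j > e" using ij x(2) by auto
        then show ?thesis using gideal_mult'[OF K pS e(3)] ij by auto
      qed
      then show "(case x of (i, j) \<Rightarrow> if d + e = i + j then ?h i j else 0) \<in> K (d + e)"
        using gideal_0[OF K] by (auto simp: x(1))
    qed
    moreover have "hom_comp (d + e) (p * q) \<in> K (d + e)" using pq by (simp add: gtotal_def)
    ultimately have "?h d e \<in> K (d + e)" unfolding eq using gideal_diff[OF K] by fastforce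
    then show False using prime[OF pS qS] d(2) e(2) by blast
  qed
qed

text \<open>A nonzero form has only one degree, so the graded pieces survive in a union of sets.
  This allows ideals to be compared as plain sets under inclusion.\<close>

lemma gideal_cap:
  assumes "gideal n K"
  shows "(M \<union> (\<Union>e. K e)) \<inter> S_part n d = (M \<inter> S_part n d) \<union> K d"
proof -
  have "p \<in> K d" if "p \<in> K e" "p \<in> S_part n d" for p e
    using that gideal_S_part[OF assms] gideal_0[OF assms, of d] S_part_distinct_degrees
    by (cases "d = e") fastforce+
  then show ?thesis using gideal_S_part[OF assms] by blast
qed

text \<open>A homogeneous ideal that is maximal among those containing no power of \<open>l\<close> is prime.\<close>

lemma ex_point_avoiding:
  assumes K: "gideal n K" and l: "l \<in> S_part n 1" and powers: "\<And>k. l ^ k \<notin> K (int k)"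
  obtains P where "P \<in> Proj_points n" "gtotal n K \<subseteq> P"
proof -
  have lk: "l ^ k \<in> S_part n (int k)" for k by (rule S_part_power1[OF l])
  \<comment> \<open>Zorn's lemma is applied to plain sets; the ideal belonging to \<open>X\<close>
    is the family of its intersections with the graded pieces.\<close>
  define \<A> where "\<A> = {X. gideal n (\<lambda>d. X \<inter> S_part n d) \<and> (\<forall>d. K d \<subseteq> X) \<and> (\<forall>k. l ^ k \<notin> X)}"
  have "(\<Union>e. K e) \<in> \<A>"
  proof -
    have cap: "(\<Union>e. K e) \<inter> S_part n d = K d" for d using gideal_cap[OF K, of "{}" d] by simp
    then show ?thesis using K powers lk unfolding \<A>_def by (auto simp: cap) (metis IntI UN_I UNIV_I cap)
  qed
  then have ne: "\<A> \<noteq> {}" by blast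
  have "\<Union>C \<in> \<A>" if C: "C \<noteq> {}" "subset.chain \<A> C" for C
  proof -
    have CA: "X \<in> \<A>" if "X \<in> C" for X using C that by (auto simp: subset.chain_def)
    then have g: "gideal n (\<lambda>d. X \<inter> S_part n d)" if "X \<in> C" for X using that by (auto simp: \<A>_def)
    have "gideal n (\<lambda>d. \<Union>C \<inter> S_part n d)"
    proof (rule gidealI)
      show "0 \<in> \<Union>C \<inter> S_part n d" for d using C(1) gideal_0[OF g] by auto
      show "p + q \<in> \<Union>C \<inter> S_part n d" if pq: "p \<in> \<Union>C \<inter> S_part n d" "q \<in> \<Union>C \<inter> S_part n d" for d p q
      proof -
        obtain X Y where "X \<in> C" "Y \<in> C" "p \<in> X" "q \<in> Y" using pq by blast
        moreover have "X \<subseteq> Y \<or> Y \<subseteq> X" using C(2) \<open>X \<in> C\<close> \<open>Y \<in> C\<close> by (auto simp: subset.chain_def)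
        ultimately obtain Z where "Z \<in> C" "p \<in> Z" "q \<in> Z" by blast
        then show ?thesis using gideal_add[OF g[OF \<open>Z \<in> C\<close>], of p d q] pq by auto
      qed
      show "r * p \<in> \<Union>C \<inter> S_part n (e + d)" if "r \<in> S_part n e" "p \<in> \<Union>C \<inter> S_part n d" for d e r p
        using that gideal_mult[OF g] by blast
    qed auto
    then show ?thesis using CA C(1) unfolding \<A>_def by blast
  qed
  then obtain M where M: "M \<in> \<A>" "\<And>X. X \<in> \<A> \<Longrightarrow> M \<subseteq> X \<Longrightarrow> X = M"
    using subset_Zorn_nonempty[OF ne] by blast
  define G where "G d = M \<inter> S_part n d" for d
  have G: "gideal n G" and KM: "\<And>d. K d \<subseteq> M" and lM: "\<And>k. l ^ k \<notin> M"
    using M(1) unfolding \<A>_def G_def by auto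
  \<comment> \<open>By maximality, adjoining a form outside \<open>G\<close> produces a power of
    \<open>l\<close>. For two such forms with product in \<open>G\<close>, multiplying the two
    resulting expressions puts a power of \<open>l\<close> into \<open>G\<close> itself.\<close>
  have ext: "\<exists>k. l ^ k \<in> adj n G a d (int k)" if a: "a \<in> S_part n d" "a \<notin> G d" for a d
  proof (rule ccontr)
    assume none: "\<not> ?thesis"
    let ?X = "M \<union> (\<Union>e. adj n G a d e)"
    have A: "gideal n (adj n G a d)" by (rule gideal_adj[OF G a(1)])
    have cap: "?X \<inter> S_part n e = adj n G a d e" for e
      unfolding gideal_cap[OF A] using adj_base[of _ G e] by (auto simp: G_def)
    have "l ^ k \<notin> ?X" for k using none lk[of k] cap[of "int k"] by blast
    then have "?X \<in> \<A>" using A KM unfolding \<A>_def by (auto simp: cap)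
    then have "?X = M" by (intro M(2)) auto
    moreover have "1 * a \<in> adj n G a d d" by (rule adj_mult[OF G]) simp
    ultimately show False using a by (auto simp: G_def)
  qed
  have "primeideal (gtotal n G) (poly_S n)"
  proof (rule primeideal_gtotal[OF G])
    show "1 \<notin> G 0" using lM[of 0] by (simp add: G_def)
    fix d e p q assume p: "p \<in> S_part n d" and q: "q \<in> S_part n e" and pq: "p * q \<in> G (d + e)"
    show "p \<in> G d \<or> q \<in> G e"
    proof (rule ccontr)
      assume "\<not> ?thesis"
      then obtain j k where "l ^ j \<in> adj n G p d (int j)" "l ^ k \<in> adj n G q e (int k)"
        using ext p q by blast
      then obtain a r b s where a: "l ^ j = a + r * p" "a \<in> G (int j)" "r \<in> S_part n (int j - d)"
        and b: "l ^ k = b + s * q" "b \<in> G (int k)" "s \<in> S_part n (int k - e)"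
        by (auto elim!: adjE)
      have "l ^ (j + k) = a * l ^ k + (r * p) * b + (r * s) * (p * q)"
        by (simp add: power_add a(1)) (simp add: b(1) algebra_simps)
      also have "\<dots> \<in> G (int (j + k))"
        by (intro gideal_add[OF G] gideal_mult_right[OF G lk a(2)] gideal_mult'[OF G _ b(2)]
            gideal_mult'[OF G _ pq] S_part_mult'[OF a(3) p] S_part_mult'[OF a(3) b(3)]) auto
      finally show False using lM[of "j + k"] by (simp add: G_def)
    qed
  qed
  moreover have "l \<notin> gtotal n G" using lM[of 1] gtotal_homogeneous[OF G l] by (simp add: G_def)
  moreover have "l \<in> irrelevant_ideal n"
  proof -
    have "(\<Union>d\<in>{0<..}. S_part n d) \<subseteq> irrelevant_ideal n"
      unfolding irrelevant_ideal_def by (rule conjunct2[OF genideal_is_ideal]) (auto dest: S_part_carrier)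
    then show ?thesis using l zero_less_one by blast
  qed
  ultimately have "gtotal n G \<in> Proj_points n"
    using homogeneous_ideal_gtotal[OF G] by (auto simp: Proj_points_def)
  moreover have "K d \<subseteq> G d" for d using KM gideal_S_part[OF K] by (auto simp: G_def)
  then have "gtotal n K \<subseteq> gtotal n G" by (auto simp: gtotal_def)
  ultimately show ?thesis using that by blast
qed

section \<open>Points on a one-dimensional graded quotient\<close>

text \<open>The points of Proj(S/I), with the ideal given as a family. The points of Y are among
  them once I \<subseteq> J.\<close>

definition graded_point :: "nat \<Rightarrow> (int \<Rightarrow> mpoly set) \<Rightarrow> mpoly set \<Rightarrow> bool" where
  "graded_point n I P \<longleftrightarrow> primeideal P (poly_S n) \<and> homogeneous_ideal n P \<and> (\<forall>d. I d \<subseteq> P) \<and>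
     \<not> irrelevant_ideal n \<subseteq> P"

text \<open>The cone over a zero-dimensional scheme, with \<open>l\<close> missing all its points.
  Multiplication by \<open>l\<close> on S/I is injective, and onto in each degree from
  \<open>M\<close> on, which bounds the dimensions of the graded pieces. Nonnegativity of
  \<open>M\<close> makes \<open>nat M\<close> faithful.\<close>

locale graded_curve =
  fixes n :: nat and I :: "int \<Rightarrow> mpoly set" and l :: mpoly and M :: int
  assumes I: "gideal n I" and l: "l \<in> S_part n 1" and l_nzd: "nzd n I l 1"
    and M: "M \<ge> 0" "\<And>d. d \<ge> M \<Longrightarrow> S_part n d \<subseteq> adj n I l 1 d"
begin

lemma l_power: "l ^ k \<in> S_part n (int k)"
  by (rule S_part_power1[OF l])

lemma l_carrier: "l \<in> carrier (poly_S n)"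
  by (rule S_part_carrier[OF l])

text \<open>From degree \<open>M\<close> on, every form is modulo \<open>I\<close> a power of
  \<open>l\<close> times a form of degree \<open>M\<close>, so the monomials of that degree bound
  the dimension. Finiteness of the points and algebraicity of their coordinates rest on
  this.\<close>

lemma S_part_dependent_mod:
  assumes A: "finite A" "card (monomials n M) < card A" and v: "\<And>a. a \<in> A \<Longrightarrow> v a \<in> S_part n d" and d: "d \<ge> M"
  shows "\<exists>c. (\<exists>a\<in>A. c a \<noteq> 0) \<and> (\<Sum>a\<in>A. const (c a) * v a) \<in> I d"
proof -
  let ?m = "nat (d - M)"
  have dM: "d = M + int ?m * 1" using d by simp
  have "\<forall>a\<in>A. \<exists>s\<in>S_part n M. v a - s * l ^ ?m \<in> I d"
  proof
    fix a assume "a \<in> A"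
    then have "v a \<in> S_part n (M + int ?m * 1)" using v dM by simp
    then have "\<exists>s\<in>S_part n M. v a - s * l ^ ?m \<in> I (M + int ?m * 1)"
      using M by (intro S_part_eq_power_mod[OF I l, where M = "M - 1"]) auto
    then show "\<exists>s\<in>S_part n M. v a - s * l ^ ?m \<in> I d" using dM by simp
  qed
  then obtain s where s: "\<And>a. a \<in> A \<Longrightarrow> s a \<in> S_part n M"
    "\<And>a. a \<in> A \<Longrightarrow> v a - s a * l ^ ?m \<in> I d" by metis
  then obtain c where c: "\<exists>a\<in>A. c a \<noteq> 0" "(\<Sum>a\<in>A. const (c a) * s a) = 0"
    using S_part_dependent[OF A, of s] s(1) by meson
  have "(\<Sum>a\<in>A. const (c a) * v a) =
      (\<Sum>a\<in>A. const (c a) * (v a - s a * l ^ ?m)) + (\<Sum>a\<in>A. const (c a) * s a) * l ^ ?m"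
    unfolding sum_distrib_right sum.distrib[symmetric] by (intro sum.cong) (auto simp: algebra_simps)
  also have "\<dots> \<in> I d" using c(2) s(2) by (auto intro: gideal_sum[OF I] gideal_const_mult[OF I])
  finally show ?thesis using c(1) by blast
qed

context
  fixes P assumes P: "graded_point n I P"
begin

lemma point_prime: "primeideal P (poly_S n)" and point_homogeneous: "homogeneous_ideal n P"
  and point_I: "I d \<subseteq> P"
  using P by (auto simp: graded_point_def)

lemmas point_ideal = prime_ideal[OF point_prime]

text \<open>With \<open>l\<close> the prime would contain all forms of degree at least
  \<open>M\<close>, hence the power p^M of every form p of degree d > 0, its degree being M d \<ge>
  M.\<close>

lemma l_notin_point: "l \<notin> P"
proof
  assume lP: "l \<in> P"
  have big: "S_part n d \<subseteq> P" if "d \<ge> M" for d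
  proof
    fix p assume "p \<in> S_part n d"
    then have "p \<in> adj n I l 1 d" using M(2) that by blast
    then show "p \<in> P" using point_I lP
      by (auto elim!: adjE intro!: ideal_add[OF point_ideal] ideal_mult[OF point_ideal] dest: S_part_carrier)
  qed
  have "S_part n d \<subseteq> P" if d: "d > 0" for d
  proof
    fix p assume p: "p \<in> S_part n d"
    have "M * 1 \<le> M * d" using d M(1) by (intro mult_left_mono) auto
    then have "p ^ nat M \<in> P" using S_part_power[OF p, of "nat M"] big[of "M * d"] M(1) by auto
    then show "p \<in> P" using prime_power[OF point_prime S_part_carrier[OF p]] by blast
  qed
  then have "irrelevant_ideal n \<subseteq> P"
    unfolding irrelevant_ideal_def by (intro genideal_least[OF point_ideal]) auto
  then show False using P by (simp add: graded_point_def)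
qed

lemma l_power_notin_point: "l ^ k \<notin> P"
  using prime_power[OF point_prime l_carrier] l_notin_point by blast

text \<open>A binary form in \<open>x\<close> and \<open>l\<close> splits into linear factors, one of which lies in the prime \<open>P\<close>.\<close>

lemma homogenization_root:
  assumes x: "x \<in> S_part n 1" and p: "p \<noteq> 0" "Polynomial.degree p \<le> k"
    and vanish: "(\<Sum>j\<le>k. const (Polynomial.coeff p j) * x ^ j * l ^ (k - j)) \<in> P"
  shows "\<exists>c. x - const c * l \<in> P"
  using p vanish
proof (induction "Polynomial.degree p" arbitrary: p k)
  case 0
  then obtain c where c: "p = [:c:]" "c \<noteq> 0" by (metis degree_eq_zeroE pCons_0_0)
  have "(\<Sum>j\<le>k. const (Polynomial.coeff p j) * x ^ j * l ^ (k - j)) = (\<Sum>j\<in>{0::nat}. const c * l ^ k)"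
    by (rule sum.mono_neutral_cong_right) (auto simp: c coeff_pCons split: nat.splits)
  then have "const c * l ^ k \<in> P" using 0 by simp
  then have "const (inverse c) * (const c * l ^ k) \<in> P"
    by (rule ideal_mult[OF point_ideal const_carrier])
  then show ?case using l_power_notin_point c(2) by (simp add: const_inverse_mult)
next
  case (Suc m)
  then obtain c where "poly p c = 0"
    using fundamental_theorem_of_algebra[of p] constant_degree[of p] by auto
  then obtain q where q: "p = [:- c, 1:] * q" by (metis dvdE poly_eq_0_iff_dvd)
  have q0: "q \<noteq> 0" using Suc.prems(1) q by auto
  then have deg: "Polynomial.degree p = Suc (Polynomial.degree q)" unfolding q by (subst degree_mult_eq) auto
  then obtain k' where k: "k = Suc k'" using Suc.prems(2) by (cases k) auto
  let ?h = "\<Sum>j\<le>k'. const (Polynomial.coeff q j) * x ^ j * l ^ (k' - j)"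
  have qk: "Polynomial.coeff q (Suc k') = 0" using deg Suc.prems(2) k by (intro coeff_eq_0) auto
  have pc: "const (Polynomial.coeff p j) = (if j = 0 then 0 else const (Polynomial.coeff q (j - 1))) -
      const c * const (Polynomial.coeff q j)" for j
    by (cases j) (auto simp: q const_add const_uminus const_mult const_diff)
  have "(\<Sum>j\<le>k. const (Polynomial.coeff p j) * x ^ j * l ^ (k - j)) =
     (\<Sum>j\<le>Suc k'. (if j = 0 then 0 else const (Polynomial.coeff q (j - 1))) * x ^ j * l ^ (Suc k' - j)) -
     (\<Sum>j\<le>Suc k'. const c * const (Polynomial.coeff q j) * x ^ j * l ^ (Suc k' - j))"
    unfolding k pc by (simp only: left_diff_distrib sum_subtractf)
  also have "(\<Sum>j\<le>Suc k'. (if j = 0 then 0 else const (Polynomial.coeff q (j - 1))) * x ^ j * l ^ (Suc k' - j)) = x * ?h"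
    by (subst sum.atMost_Suc_shift) (simp add: sum_distrib_left mult_ac)
  also have "(\<Sum>j\<le>Suc k'. const c * const (Polynomial.coeff q j) * x ^ j * l ^ (Suc k' - j)) = (const c * l) * ?h"
    by (simp add: qk sum_distrib_left Suc_diff_le mult_ac)
  finally have "(x - const c * l) * ?h \<in> P" using Suc.prems(3) by (simp add: left_diff_distrib)
  moreover have "x - const c * l \<in> carrier (poly_S n)"
    using S_part_diff[OF x S_part_const_mult[OF l]] by (rule S_part_carrier)
  moreover have "?h \<in> carrier (poly_S n)"
    by (intro poly_S_sum poly_S_mult const_carrier S_part_carrier[OF S_part_power1[OF x]] S_part_carrier[OF l_power])
  ultimately have "x - const c * l \<in> P \<or> ?h \<in> P" by (intro prime_mult[OF point_prime])
  then show ?case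
  proof
    assume "?h \<in> P"
    then show ?thesis using Suc.hyps q0 deg Suc.prems(2) k by (intro Suc.hyps(1)[of q k']) auto
  qed blast
qed

text \<open>The forms x^j l^(k-j) outnumber the dimension, so x/l is algebraic at the point, and its
  value is a complex number because the field is algebraically closed.\<close>

lemma point_coordinate:
  assumes x: "x \<in> S_part n 1"
  shows "\<exists>c. x - const c * l \<in> P"
proof -
  \<comment> \<open>Thus \<open>k\<close> is at least \<open>M\<close>, and the k + 1 forms are more
    than the monomials of degree \<open>M\<close>.\<close>
  define k where "k = nat M + card (monomials n M)"
  have "\<exists>c. (\<exists>j\<in>{..k}. c j \<noteq> 0) \<and> (\<Sum>j\<in>{..k}. const (c j) * (x ^ j * l ^ (k - j))) \<in> I (int k)"
  proof (rule S_part_dependent_mod)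
    show "x ^ j * l ^ (k - j) \<in> S_part n (int k)" if "j \<in> {..k}" for j
      using that by (intro S_part_mult'[OF S_part_power1[OF x] l_power]) auto
  qed (use M(1) in \<open>auto simp: k_def\<close>)
  then obtain c where c: "\<exists>j\<le>k. c j \<noteq> 0" "(\<Sum>j\<le>k. const (c j) * (x ^ j * l ^ (k - j))) \<in> I (int k)"
    by auto
  define p where "p = (\<Sum>j\<le>k. Polynomial.monom (c j) j)"
  have coeff: "Polynomial.coeff p j = (if j \<le> k then c j else 0)" for j
    by (simp add: p_def coeff_sum)
  have "p \<noteq> 0" using c(1) coeff by (metis coeff_0)
  moreover have "Polynomial.degree p \<le> k" by (rule degree_le) (simp add: coeff)
  moreover have "(\<Sum>j\<le>k. const (Polynomial.coeff p j) * x ^ j * l ^ (k - j)) \<in> P"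
    using c(2) point_I by (auto simp: coeff mult.assoc)
  ultimately show ?thesis by (rule homogenization_root[OF x])
qed

end

text \<open>Affine coordinates of the point in the chart l \<noteq> 0; existence is
  \<open>point_coordinate\<close>.\<close>

definition coord :: "mpoly set \<Rightarrow> nat \<Rightarrow> complex" where
  "coord P i = (SOME c. var i - const c * l \<in> P)"

definition local_param :: "mpoly set \<Rightarrow> nat \<Rightarrow> mpoly" where
  "local_param P i = var i - const (coord P i) * l"

lemma local_param_in: "graded_point n I P \<Longrightarrow> i \<le> n \<Longrightarrow> local_param P i \<in> P"
  unfolding local_param_def coord_def by (rule someI_ex) (intro point_coordinate var_S_part)

lemma local_param_S_part: "i \<le> n \<Longrightarrow> local_param P i \<in> S_part n 1"
  unfolding local_param_def by (intro S_part_diff var_S_part S_part_const_mult l)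

text \<open>Modulo \<open>Q\<close> every variable is a scalar multiple of \<open>l\<close>, hence
  every monomial of degree d is one of l^d.\<close>

lemma eq_l_power_mod:
  assumes Q: "ideal Q (poly_S n)" "\<And>i. i \<le> n \<Longrightarrow> var i - const (c i) * l \<in> Q" and p: "p \<in> S_part n d"
  shows "\<exists>z. p - const z * l ^ nat d \<in> Q"
  using p
proof (induction rule: S_part_induct)
  case (monomial t)
  have *: "(\<Prod>a\<in>A. var (v a)) - const (\<Prod>a\<in>A. c (v a)) * l ^ card A \<in> Q"
    if "finite A" "\<forall>a\<in>A. v a \<le> n" for A :: "nat set" and v
    using that
  proof (induction A rule: finite_induct)
    case empty
    then show ?case using ideal_0[OF Q(1)] by simp
  next
    case (insert a A)
    let ?p = "\<Prod>a\<in>A. var (v a)" and ?z = "\<Prod>a\<in>A. c (v a)"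
    have "var (v a) * (?p - const ?z * l ^ card A) + (const ?z * l ^ card A) * (var (v a) - const (c (v a)) * l) \<in> Q"
      using insert by (intro ideal_add[OF Q(1)] ideal_mult[OF Q(1)] Q poly_S_mult)
        (auto intro: S_part_carrier[OF l_power] S_part_carrier[OF var_S_part])
    then show ?case using insert by (simp add: algebra_simps const_mult)
  qed
  obtain v where v: "\<forall>a\<in>{..<nat d}. v a \<le> n" "Poly_Mapping.single t 1 = (\<Prod>a<nat d. var (v a))"
    using monomial_eq_prod_var[of "{..<nat d}" t n] monomial by auto
  then show ?case using *[OF finite_lessThan v(1)] by auto
next
  case zero
  show ?case by (rule exI[of _ 0]) (simp add: ideal_0[OF Q(1)])
next
  case (add p q)
  then obtain y z where "p - const y * l ^ nat d \<in> Q" "q - const z * l ^ nat d \<in> Q" by blast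
  then have "(p - const y * l ^ nat d) + (q - const z * l ^ nat d) \<in> Q" by (rule ideal_add[OF Q(1)])
  then show ?case by (intro exI[of _ "y + z"]) (simp add: const_add algebra_simps)
next
  case (smult a p)
  then obtain z where "p - const z * l ^ nat d \<in> Q" by blast
  then have "const a * (p - const z * l ^ nat d) \<in> Q" by (intro ideal_mult[OF Q(1)]) auto
  then show ?case by (intro exI[of _ "a * z"]) (simp add: const_mult algebra_simps)
qed

text \<open>\<open>eq_l_power_mod\<close> for the ideal P \<inter> Q yields one scalar that serves
  both ideals; it vanishes because \<open>p\<close> lies in \<open>P\<close> and powers of
  \<open>l\<close> do not. So the local parameters generate all forms in \<open>P\<close>.\<close>

lemma point_subset_if_local_params:
  assumes P: "graded_point n I P" and Q: "ideal Q (poly_S n)" "\<And>i. i \<le> n \<Longrightarrow> local_param P i \<in> Q"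
    and p: "p \<in> P" "p \<in> S_part n d"
  shows "p \<in> Q"
proof -
  note PI = point_ideal[OF P]
  have "ideal (P \<inter> Q) (poly_S n)"
    using PI Q(1) unfolding ideal_poly_S_iff by blast
  then have "\<exists>z. p - const z * l ^ nat d \<in> P \<inter> Q"
    using Q(2) local_param_in[OF P] by (intro eq_l_power_mod[OF _ _ p(2), where c = "coord P"])
      (auto simp: local_param_def)
  then obtain z where z: "p - const z * l ^ nat d \<in> P" "p - const z * l ^ nat d \<in> Q" by blast
  have "z = 0"
  proof (rule ccontr)
    assume "z \<noteq> 0"
    have "const (inverse z) * (p - (p - const z * l ^ nat d)) \<in> P"
      by (intro ideal_mult[OF PI] ideal_diff[OF PI] p z) simp
    then show False using l_power_notin_point[OF P] \<open>z \<noteq> 0\<close> by (simp add: const_inverse_mult)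
  qed
  then show ?thesis using z(2) by simp
qed

text \<open>If all linear forms in \<open>Q\<close> lay in \<open>P\<close>, so would the local
  parameters of \<open>Q\<close>, and the coordinates would agree. Equal coordinates mean equal
  primes.\<close>

lemma distinct_points_separated:
  assumes P: "graded_point n I P" and Q: "graded_point n I Q" and "P \<noteq> Q"
  shows "\<exists>v\<in>S_part n 1. v \<in> Q \<and> v \<notin> P"
proof (rule ccontr)
  assume none: "\<not> ?thesis"
  have QP: "local_param Q i \<in> P" if "i \<le> n" for i
    using none local_param_S_part[OF that] local_param_in[OF Q that] by blast
  have "local_param P i \<in> Q" if i: "i \<le> n" for i
  proof -
    have "local_param P i - local_param Q i \<in> P"
      by (intro ideal_diff[OF point_ideal[OF P]] local_param_in[OF P] QP i)
    then have *: "const (coord Q i - coord P i) * l \<in> P"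
      by (simp add: local_param_def const_diff algebra_simps)
    have "coord Q i = coord P i"
    proof (rule ccontr)
      assume ne: "coord Q i \<noteq> coord P i"
      then have "const (inverse (coord Q i - coord P i)) * (const (coord Q i - coord P i) * l) \<in> P"
        by (intro ideal_mult[OF point_ideal[OF P] _ *]) simp
      then show False using l_notin_point[OF P] ne
        by (metis const_inverse_mult right_minus_eq)
    qed
    then show ?thesis using local_param_in[OF Q i] by (simp add: local_param_def)
  qed
  then have "P \<subseteq> Q"
    using point_subset_if_local_params[OF P point_ideal[OF Q]]
    by (intro homogeneous_ideal_subset[OF point_homogeneous[OF P] point_ideal[OF Q]]) auto
  moreover have "Q \<subseteq> P"
    using point_subset_if_local_params[OF Q point_ideal[OF P]] QP
    by (intro homogeneous_ideal_subset[OF point_homogeneous[OF Q] point_ideal[OF P]]) auto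
  ultimately show False using \<open>P \<noteq> Q\<close> by blast
qed

text \<open>Distinct points impose independent conditions in large degree, whereas the graded pieces of
  \<open>S/I\<close> have bounded dimension.\<close>

lemma finite_points: "finite {P. graded_point n I P}"
proof (rule ccontr)
  assume inf: "infinite {P. graded_point n I P}"
  \<comment> \<open>With one point more than \<open>?N\<close>, each product \<open>h P\<close> has
    degree \<open>?N\<close>, which is at least \<open>M\<close>, and there are more products than
    monomials of degree \<open>M\<close>.\<close>
  let ?N = "Suc (nat M + card (monomials n M))"
  obtain Y where Y: "finite Y" "card Y = Suc ?N" "Y \<subseteq> {P. graded_point n I P}"
    using infinite_arbitrarily_large[OF inf] by blast
  have "\<forall>P\<in>Y. \<forall>Q\<in>Y - {P}. \<exists>v. v \<in> S_part n 1 \<and> v \<in> Q \<and> v \<notin> P"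
    using distinct_points_separated Y(3) by blast
  then obtain v where v: "\<And>P Q. P \<in> Y \<Longrightarrow> Q \<in> Y - {P} \<Longrightarrow> v P Q \<in> S_part n 1 \<and> v P Q \<in> Q \<and> v P Q \<notin> P"
    by metis
  define h where "h P = (\<Prod>Q\<in>Y - {P}. v P Q)" for P
  have h_S: "h P \<in> S_part n (int ?N)" if "P \<in> Y" for P
  proof -
    have "card (Y - {P}) = ?N" using Y that by simp
    then show ?thesis using S_part_prod[of "Y - {P}" "v P" n] v that by (simp add: h_def)
  qed
  have carr: "v P Q \<in> carrier (poly_S n)" if "P \<in> Y" "Q \<in> Y - {P}" for P Q
    using v[OF that] S_part_carrier by blast
  have "\<exists>c. (\<exists>P\<in>Y. c P \<noteq> 0) \<and> (\<Sum>P\<in>Y. const (c P) * h P) \<in> I (int ?N)"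
    using Y M(1) by (intro S_part_dependent_mod h_S) auto
  then obtain c P where P: "P \<in> Y" "c P \<noteq> 0" and rel: "(\<Sum>P\<in>Y. const (c P) * h P) \<in> I (int ?N)"
    by blast
  have pt: "graded_point n I P" using P Y by blast
  note PI = point_ideal[OF pt] and PP = point_prime[OF pt]
  \<comment> \<open>All other products have a factor vanishing at \<open>P\<close>, so the relation
    leaves \<open>h P\<close>, none of whose factors vanishes there.\<close>
  have "(\<Sum>Q\<in>Y - {P}. const (c Q) * h Q) \<in> P"
  proof (intro ideal_sum[OF PI] ideal_mult[OF PI])
    fix Q assume Q: "Q \<in> Y - {P}"
    show "h Q \<in> P" unfolding h_def
      by (rule ideal_prod_mem[OF PI, of _ P]) (use Q P Y v carr in auto)
  qed simp
  moreover have "(\<Sum>Q\<in>Y. const (c Q) * h Q) = const (c P) * h P + (\<Sum>Q\<in>Y - {P}. const (c Q) * h Q)"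
    using Y(1) P(1) by (rule sum.remove)
  ultimately have "const (c P) * h P \<in> P"
    using rel point_I[OF pt] ideal_diff[OF PI, of "\<Sum>Q\<in>Y. const (c Q) * h Q"] by fastforce
  then have "const (inverse (c P)) * (const (c P) * h P) \<in> P" by (rule ideal_mult[OF PI const_carrier])
  then have "h P \<in> P" using P(2) by (simp add: const_inverse_mult)
  then have "\<exists>Q\<in>Y - {P}. v P Q \<in> P" unfolding h_def
    by (intro prime_prod[OF PP]) (use Y(1) carr P in auto)
  then show False using v P(1) by blast
qed

text \<open>Some power of each local parameter is killed by an element outside \<open>P\<close>: in a linear relation
  between the \<open>u\<^sup>j l\<^sup>k\<^sup>-\<^sup>j\<close> modulo \<open>I\<close> factor out the lowest power of \<open>u\<close>.\<close>

lemma local_param_nilpotent: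
  assumes P: "graded_point n I P" and i: "i \<le> n"
  shows "\<exists>s k m. s \<in> S_part n k \<and> s \<notin> P \<and> s * local_param P i ^ m \<in> I (k + int m)"
proof -
  let ?u = "local_param P i"
  note PI = point_ideal[OF P]
  have u: "?u \<in> S_part n 1" "?u \<in> P" using local_param_S_part[OF i] local_param_in[OF P i] by auto
  define k where "k = nat M + card (monomials n M)"
  have "\<exists>c. (\<exists>j\<in>{..k}. c j \<noteq> 0) \<and> (\<Sum>j\<in>{..k}. const (c j) * (?u ^ j * l ^ (k - j))) \<in> I (int k)"
  proof (rule S_part_dependent_mod)
    show "?u ^ j * l ^ (k - j) \<in> S_part n (int k)" if "j \<in> {..k}" for j
      using that by (intro S_part_mult'[OF S_part_power1[OF u(1)] l_power]) auto
  qed (use M(1) in \<open>auto simp: k_def\<close>)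
  then obtain c where c: "\<exists>j\<le>k. c j \<noteq> 0" "(\<Sum>j\<le>k. const (c j) * (?u ^ j * l ^ (k - j))) \<in> I (int k)"
    by auto
  define m where "m = (LEAST j. j \<le> k \<and> c j \<noteq> 0)"
  have m: "m \<le> k" "c m \<noteq> 0" using LeastI_ex[of "\<lambda>j. j \<le> k \<and> c j \<noteq> 0"] c(1) by (auto simp: m_def)
  have below: "c j = 0" if "j < m" for j
    using not_less_Least[of j "\<lambda>j. j \<le> k \<and> c j \<noteq> 0"] that m(1) by (auto simp: m_def)
  define w where "w = (\<Sum>j\<in>{m<..k}. const (c j) * (?u ^ (j - Suc m) * l ^ (k - j)))"
  \<comment> \<open>This is the cofactor of u^m in the relation. It avoids \<open>P\<close> since u
    \<in> P and its first term is a nonzero multiple of a power of \<open>l\<close>.\<close>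
  define s where "s = const (c m) * l ^ (k - m) + w * ?u"
  have wS: "w * ?u \<in> S_part n (int (k - m))"
  proof (cases "m < k")
    case True
    have "w \<in> S_part n (int (k - Suc m))"
      unfolding w_def by (intro S_part_sum S_part_const_mult S_part_mult'[OF S_part_power1[OF u(1)] l_power]) auto
    then show ?thesis by (rule S_part_mult'[OF _ u(1)]) (use True in auto)
  qed (simp add: w_def)
  have sS: "s \<in> S_part n (int (k - m))"
    unfolding s_def by (intro S_part_add S_part_const_mult l_power wS)
  have "(\<Sum>j\<le>k. const (c j) * (?u ^ j * l ^ (k - j))) = (\<Sum>j\<in>{m..k}. const (c j) * (?u ^ j * l ^ (k - j)))"
    by (rule sum.mono_neutral_right) (use below in auto)
  also have "\<dots> = const (c m) * (?u ^ m * l ^ (k - m)) + (\<Sum>j\<in>{m<..k}. const (c j) * (?u ^ j * l ^ (k - j)))"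
    using m(1) by (rule sum.head)
  also have "(\<Sum>j\<in>{m<..k}. const (c j) * (?u ^ j * l ^ (k - j))) = w * ?u ^ Suc m"
    unfolding w_def sum_distrib_right
  proof (rule sum.cong)
    fix j assume "j \<in> {m<..k}"
    then have "?u ^ j = ?u ^ (j - Suc m) * ?u ^ Suc m" by (simp flip: power_add del: power_Suc)
    then show "const (c j) * (?u ^ j * l ^ (k - j)) = const (c j) * (?u ^ (j - Suc m) * l ^ (k - j)) * ?u ^ Suc m"
      by (simp only: mult_ac)
  qed simp
  also have "const (c m) * (?u ^ m * l ^ (k - m)) + w * ?u ^ Suc m = s * ?u ^ m"
    by (simp add: s_def algebra_simps)
  finally have "s * ?u ^ m \<in> I (int (k - m) + int m)" using c(2) m(1) by simp
  moreover have "s \<notin> P"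
  proof
    assume "s \<in> P"
    moreover have "w * ?u \<in> P"
      using u(2) unfolding w_def
      by (intro ideal_mult[OF PI] poly_S_sum poly_S_mult const_carrier S_part_carrier[OF S_part_power1[OF u(1)]]
          S_part_carrier[OF l_power])
    ultimately have "s - w * ?u \<in> P" by (rule ideal_diff[OF PI])
    then have "const (c m) * l ^ (k - m) \<in> P" by (simp add: s_def)
    then have "const (inverse (c m)) * (const (c m) * l ^ (k - m)) \<in> P"
      by (rule ideal_mult[OF PI const_carrier])
    then show False using l_power_notin_point[OF P] m(2) by (simp add: const_inverse_mult)
  qed
  ultimately show ?thesis using sS by blast
qed

end

section \<open>The local ring at a point\<close>

text \<open>A proper ideal contains no unit and so lies in \<open>M\<close>; the resulting
  uniqueness resolves the definite description.\<close>

lemma the_maximal_ideal_eqI: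
  assumes R: "cring R" and M: "ideal M R" "\<one>\<^bsub>R\<^esub> \<notin> M"
    and units: "\<And>x. x \<in> carrier R \<Longrightarrow> x \<notin> M \<Longrightarrow> \<exists>y\<in>carrier R. y \<otimes>\<^bsub>R\<^esub> x = \<one>\<^bsub>R\<^esub>"
  shows "the_maximal_ideal R = M"
proof -
  interpret cring R by fact
  have carr: "K \<subseteq> carrier R" if "ideal K R" for K
    using additive_subgroup.a_subset[OF ideal.axioms(1)[OF that]] .
  have sub: "K \<subseteq> M" if K: "ideal K R" "K \<noteq> carrier R" for K
  proof
    fix x assume x: "x \<in> K"
    show "x \<in> M"
    proof (rule ccontr)
      assume "x \<notin> M"
      then obtain y where "y \<in> carrier R" "y \<otimes>\<^bsub>R\<^esub> x = \<one>\<^bsub>R\<^esub>" using units x carr[OF K(1)] by blast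
      then have "\<one>\<^bsub>R\<^esub> \<in> K" using ideal.I_l_closed[OF K(1) x] by metis
      then show False using ideal.one_imp_carrier[OF K(1)] K(2) by blast
    qed
  qed
  have "maximalideal M R"
  proof (rule maximalidealI[OF M(1)])
    show "carrier R \<noteq> M" using M(2) one_closed by blast
    show "K = M \<or> K = carrier R" if "ideal K R" "M \<subseteq> K" "K \<subseteq> carrier R" for K
      using sub that by blast
  qed
  moreover have "K = M" if K: "maximalideal K R" for K
  proof -
    have id: "ideal K R" and ne: "K \<noteq> carrier R"
      using maximalideal.axioms(1)[OF K] maximalideal.I_notcarr[OF K] by auto
    show ?thesis
      using maximalideal.I_maximal[OF K M(1) sub[OF id ne] carr[OF M(1)]] M(2) one_closed by blast
  qed
  ultimately show ?thesis unfolding the_maximal_ideal_def by (intro the_equality)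
qed

lemma local_ring_Proj_simps [simp]:
  "carrier (local_ring_Proj n P) = hom_localization n P (carrier (poly_S n))"
  "monoid.mult (local_ring_Proj n P) = (*)" "monoid.one (local_ring_Proj n P) = 1"
  "ring.zero (local_ring_Proj n P) = 0" "ring.add (local_ring_Proj n P) = (+)"
  by (simp_all add: local_ring_Proj_def)

lemma hom_localizationI:
  "a \<in> I \<Longrightarrow> a \<in> S_part n d \<Longrightarrow> s \<in> S_part n d \<Longrightarrow> s \<notin> P \<Longrightarrow> Fract a s \<in> hom_localization n P I"
  unfolding hom_localization_def by blast

lemma hom_localizationE:
  assumes "x \<in> hom_localization n P I"
  obtains a s d where "x = Fract a s" "a \<in> I" "a \<in> S_part n d" "s \<in> S_part n d" "s \<notin> P"
  using assms unfolding hom_localization_def by blast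

lemma hom_localization_mono: "I \<subseteq> J \<Longrightarrow> hom_localization n P I \<subseteq> hom_localization n P J"
  unfolding hom_localization_def by blast

context
  fixes n :: nat and P :: "mpoly set"
  assumes P: "primeideal P (poly_S n)"
begin

lemma notin_prime_mult: "s \<in> S_part n d \<Longrightarrow> t \<in> S_part n e \<Longrightarrow> s \<notin> P \<Longrightarrow> t \<notin> P \<Longrightarrow> s * t \<notin> P"
  using prime_mult[OF P] S_part_carrier by blast

lemma notin_prime_nonzero: "s \<notin> P \<Longrightarrow> s \<noteq> 0"
  using ideal_0[OF prime_ideal[OF P]] by blast

lemma hom_localization_add:
  assumes I: "ideal I (poly_S n)" and x: "x \<in> hom_localization n P I" and y: "y \<in> hom_localization n P I"
  shows "x + y \<in> hom_localization n P I"
proof -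
  obtain a s d where a: "x = Fract a s" "a \<in> I" "a \<in> S_part n d" "s \<in> S_part n d" "s \<notin> P"
    using x by (rule hom_localizationE)
  obtain b t e where b: "y = Fract b t" "b \<in> I" "b \<in> S_part n e" "t \<in> S_part n e" "t \<notin> P"
    using y by (rule hom_localizationE)
  have "x + y = Fract (a * t + b * s) (s * t)"
    using a b notin_prime_nonzero by simp
  moreover have "a * t + b * s \<in> I"
    using a b by (intro ideal_add[OF I] ideal_mult_right[OF I] S_part_carrier)
  moreover have "a * t + b * s \<in> S_part n (d + e)"
    using a b by (intro S_part_add S_part_mult'[of _ n d _ e] S_part_mult'[of _ n e _ d]) auto
  ultimately show ?thesis
    using a b notin_prime_mult by (auto intro!: hom_localizationI[of _ _ _ "d + e"] S_part_mult)
qed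

lemma hom_localization_mult:
  assumes x: "x \<in> hom_localization n P I" and y: "y \<in> hom_localization n P J"
    and K: "\<And>a b. a \<in> I \<Longrightarrow> b \<in> J \<Longrightarrow> a \<in> carrier (poly_S n) \<Longrightarrow> b \<in> carrier (poly_S n) \<Longrightarrow> a * b \<in> K"
  shows "x * y \<in> hom_localization n P K"
proof -
  obtain a s d where a: "x = Fract a s" "a \<in> I" "a \<in> S_part n d" "s \<in> S_part n d" "s \<notin> P"
    using x by (rule hom_localizationE)
  obtain b t e where b: "y = Fract b t" "b \<in> J" "b \<in> S_part n e" "t \<in> S_part n e" "t \<notin> P"
    using y by (rule hom_localizationE)
  have "a * b \<in> K" using a b by (intro K S_part_carrier)
  then show ?thesis
    using a b notin_prime_mult by (auto intro!: hom_localizationI[of _ _ _ "d + e"] S_part_mult)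
qed

lemma hom_localization_one: "1 \<in> hom_localization n P (carrier (poly_S n))"
  unfolding One_fract_def by (rule hom_localizationI[of _ _ _ 0]) (simp_all add: poly_S_one prime_one[OF P])

lemma hom_localization_zero: "0 \<in> I \<Longrightarrow> 0 \<in> hom_localization n P I"
  unfolding Zero_fract_def by (rule hom_localizationI[of _ _ _ 0]) (simp_all add: prime_one[OF P])

lemma hom_localization_uminus:
  assumes I: "ideal I (poly_S n)" and x: "x \<in> hom_localization n P I"
  shows "- x \<in> hom_localization n P I"
proof -
  obtain a s d where a: "x = Fract a s" "a \<in> I" "a \<in> S_part n d" "s \<in> S_part n d" "s \<notin> P"
    using x by (rule hom_localizationE)
  have "0 - a \<in> I" by (intro ideal_diff[OF I] ideal_0[OF I] a)
  then show ?thesis using a by (auto intro!: hom_localizationI[of _ _ _ d] S_part_uminus)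
qed

lemma ideal_carrier_poly_S: "ideal (carrier (poly_S n)) (poly_S n)"
  using ring.oneideal[OF ring_poly_S] .

lemma cring_local_ring_Proj: "cring (local_ring_Proj n P)"
proof (rule cringI)
  note R = ideal_carrier_poly_S
  show "abelian_group (local_ring_Proj n P)"
  proof (rule abelian_groupI)
    fix x assume "x \<in> carrier (local_ring_Proj n P)"
    then show "\<exists>y\<in>carrier (local_ring_Proj n P). y \<oplus>\<^bsub>local_ring_Proj n P\<^esub> x = \<zero>\<^bsub>local_ring_Proj n P\<^esub>"
      using hom_localization_uminus[OF R] by (intro bexI[of _ "- x"]) auto
  qed (auto intro: hom_localization_add[OF R] hom_localization_zero poly_S_zero simp: add_ac)
  show "comm_monoid (local_ring_Proj n P)"
    by (rule comm_monoidI) (auto intro: hom_localization_mult poly_S_mult hom_localization_one simp: mult_ac)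
qed (auto simp: algebra_simps)

lemma ring_local_ring_Proj: "ring (local_ring_Proj n P)"
  using cring_local_ring_Proj by (simp add: cring_def)

lemma ideal_hom_localization:
  assumes I: "ideal I (poly_S n)"
  shows "ideal (hom_localization n P I) (local_ring_Proj n P)"
proof -
  interpret cring "local_ring_Proj n P" by (rule cring_local_ring_Proj)
  have sub: "hom_localization n P I \<subseteq> hom_localization n P (carrier (poly_S n))"
    by (rule hom_localization_mono) (use ideal_carrier[OF I] in blast)
  have a_inv: "inv\<^bsub>add_monoid (local_ring_Proj n P)\<^esub> x = - x"
    if "x \<in> carrier (local_ring_Proj n P)" for x
    using minus_equality[of "- x" x] that hom_localization_uminus[OF ideal_carrier_poly_S]
    unfolding a_inv_def by auto
  have mult: "y * x \<in> hom_localization n P I"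
    if "x \<in> hom_localization n P I" "y \<in> hom_localization n P (carrier (poly_S n))" for x y
    using that(2,1) by (rule hom_localization_mult) (rule ideal_mult[OF I])
  show ?thesis
  proof (rule idealI[OF ring_local_ring_Proj])
    show "subgroup (hom_localization n P I) (add_monoid (local_ring_Proj n P))"
    proof (intro subgroup.intro)
      show "inv\<^bsub>add_monoid (local_ring_Proj n P)\<^esub> x \<in> hom_localization n P I"
        if "x \<in> hom_localization n P I" for x
        using that sub a_inv[of x] hom_localization_uminus[OF I] by auto
    qed (use sub hom_localization_add[OF I] hom_localization_zero ideal_0[OF I] in auto)
    show "x \<otimes>\<^bsub>local_ring_Proj n P\<^esub> a \<in> hom_localization n P I"
      if "a \<in> hom_localization n P I" "x \<in> carrier (local_ring_Proj n P)" for a x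
      using mult that by simp
    show "a \<otimes>\<^bsub>local_ring_Proj n P\<^esub> x \<in> hom_localization n P I"
      if "a \<in> hom_localization n P I" "x \<in> carrier (local_ring_Proj n P)" for a x
      using mult that by (simp add: mult.commute)
  qed
qed

text \<open>Cross-multiplication clears the denominators. It turns vanishing in a local ring into a
  statement about forms, with a multiplier outside \<open>P\<close>.\<close>

lemma Fract_in_hom_localization_iff:
  assumes I: "ideal I (poly_S n)" and a: "a \<in> S_part n d" and s: "s \<in> S_part n d" "s \<notin> P"
  shows "Fract a s \<in> hom_localization n P I \<longleftrightarrow> (\<exists>t k. t \<in> S_part n k \<and> t \<notin> P \<and> t * a \<in> I)"
proof
  assume "Fract a s \<in> hom_localization n P I"
  then obtain b t e where b: "Fract a s = Fract b t" "b \<in> I" "b \<in> S_part n e" "t \<in> S_part n e" "t \<notin> P"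
    by (rule hom_localizationE)
  have "a * t = b * s" using b(1) eq_fract(1)[of s t a b] notin_prime_nonzero s(2) b(5) by blast
  then have "t * a \<in> I" using ideal_mult_right[OF I S_part_carrier[OF s(1)] b(2)] by (simp add: mult.commute)
  then show "\<exists>t k. t \<in> S_part n k \<and> t \<notin> P \<and> t * a \<in> I" using b by blast
next
  assume "\<exists>t k. t \<in> S_part n k \<and> t \<notin> P \<and> t * a \<in> I"
  then obtain t k where t: "t \<in> S_part n k" "t \<notin> P" "t * a \<in> I" by blast
  have "Fract a s = Fract (t * a) (t * s)"
    by (rule mult_fract_cancel[symmetric]) (use notin_prime_nonzero t in blast)
  also have "\<dots> \<in> hom_localization n P I"
    using t a s notin_prime_mult by (intro hom_localizationI[of _ _ _ "k + d"] S_part_mult) auto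
  finally show "Fract a s \<in> hom_localization n P I" .
qed

end

section \<open>Powers of the ideal of a point and nilpotency of the local ring\<close>

definition param_power :: "nat \<Rightarrow> (nat \<Rightarrow> mpoly) \<Rightarrow> nat \<Rightarrow> mpoly set" where
  "param_power n u k = genideal (poly_S n) {\<Prod>j<k. u (v j) | v. \<forall>j. v j \<le> n}"

lemma param_power_gens:
  assumes "\<And>i. i \<le> n \<Longrightarrow> u i \<in> carrier (poly_S n)"
  shows "{\<Prod>j<k. u (v j) | v. \<forall>j. v j \<le> n} \<subseteq> carrier (poly_S n)"
  using assms by (auto intro!: poly_S_prod)

lemma ideal_param_power:
  assumes "\<And>i. i \<le> n \<Longrightarrow> u i \<in> carrier (poly_S n)"
  shows "ideal (param_power n u k) (poly_S n)"
  unfolding param_power_def using genideal_is_ideal[OF param_power_gens[of n u k]] assms by blast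

lemma param_power_gen:
  assumes "\<And>i. i \<le> n \<Longrightarrow> u i \<in> carrier (poly_S n)" "\<forall>j. v j \<le> n"
  shows "(\<Prod>j<k. u (v j)) \<in> param_power n u k"
proof -
  have "{\<Prod>j<k. u (v j) | v. \<forall>j. v j \<le> n} \<subseteq> param_power n u k"
    unfolding param_power_def using genideal_is_ideal[OF param_power_gens[of n u k]] assms(1) by blast
  then show ?thesis using assms(2) by blast
qed

lemma param_power_least:
  assumes "ideal Q (poly_S n)" "\<And>v. \<forall>j. v j \<le> n \<Longrightarrow> (\<Prod>j<k. u (v j)) \<in> Q"
  shows "param_power n u k \<subseteq> Q"
  unfolding param_power_def using assms(2) by (intro genideal_least[OF assms(1)]) auto

lemma ideal_colon:
  assumes I: "ideal I (poly_S n)" and s: "s \<in> carrier (poly_S n)"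
  shows "ideal {p \<in> carrier (poly_S n). s * p \<in> I} (poly_S n)"
  unfolding ideal_poly_S_iff
proof (intro conjI ballI)
  show "r * p \<in> {p \<in> carrier (poly_S n). s * p \<in> I}"
    if "r \<in> carrier (poly_S n)" "p \<in> {p \<in> carrier (poly_S n). s * p \<in> I}" for r p
    using that ideal_mult[OF I, of r "s * p"] by (auto intro: poly_S_mult simp: mult.left_commute)
qed (auto intro: poly_S_add poly_S_zero ideal_add[OF I] ideal_0[OF I] simp: distrib_left)

text \<open>With one factor fixed, the other factors with product in the ideal form a colon ideal,
  so it is enough to test generators; this is done for each factor in turn.\<close>

lemma param_power_mult:
  assumes u: "\<And>i. i \<le> n \<Longrightarrow> u i \<in> carrier (poly_S n)"
    and p: "p \<in> param_power n u 1" and q: "q \<in> param_power n u k"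
  shows "p * q \<in> param_power n u (Suc k)"
proof -
  let ?W = "param_power n u (Suc k)"
  have W: "ideal ?W (poly_S n)" and Wk: "ideal (param_power n u k) (poly_S n)"
    by (intro ideal_param_power u; assumption)+
  have gen: "u i * q \<in> ?W" if i: "i \<le> n" and q: "q \<in> param_power n u k" for i q
  proof -
    have "param_power n u k \<subseteq> {p \<in> carrier (poly_S n). u i * p \<in> ?W}"
    proof (rule param_power_least[OF ideal_colon[OF W u[OF i]]])
      fix v :: "nat \<Rightarrow> nat" assume v: "\<forall>j. v j \<le> n"
      have "(\<Prod>j<Suc k. u (case_nat i v j)) \<in> ?W"
        by (rule param_power_gen[OF u]) (auto simp: v i split: nat.split)
      then show "(\<Prod>j<k. u (v j)) \<in> {p \<in> carrier (poly_S n). u i * p \<in> ?W}"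
        using v u by (auto simp: prod.lessThan_Suc_shift simp del: prod.lessThan_Suc intro: poly_S_prod)
    qed
    then show ?thesis using q by blast
  qed
  have qc: "q \<in> carrier (poly_S n)" by (rule ideal_carrier[OF Wk q])
  have "param_power n u 1 \<subseteq> {p \<in> carrier (poly_S n). q * p \<in> ?W}"
    by (rule param_power_least[OF ideal_colon[OF W qc]]) (auto simp: gen[OF _ q] u mult.commute[of q])
  then show ?thesis using p by (auto simp: mult.commute)
qed

lemma ideal_power_zero_mem:
  assumes R: "cring R" and M: "\<zero>\<^bsub>R\<^esub> \<in> M"
  shows "\<zero>\<^bsub>R\<^esub> \<in> ideal_power R M k"
proof -
  interpret cring R by fact
  show ?thesis
  proof (induction k)
    case (Suc k)
    have "\<zero>\<^bsub>R\<^esub> \<otimes>\<^bsub>R\<^esub> \<zero>\<^bsub>R\<^esub> \<in> ideal_prod R M (ideal_power R M k)"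
      by (rule ideal_prod.prod[OF M Suc])
    then show ?case by simp
  qed simp
qed

lemma pigeonhole_count:
  assumes v: "\<forall>j<Suc n * m. v j \<le> n" and m: "m > 0"
  shows "\<exists>i\<le>n. m \<le> card {j. j < Suc n * m \<and> v j = i}"
proof (rule ccontr)
  assume "\<not> ?thesis"
  then have lt: "card {j. j < Suc n * m \<and> v j = i} < m" if "i \<le> n" for i
    using that not_le by blast
  have small: "card {j. j < Suc n * m \<and> v j = i} \<le> m - 1" if "i \<le> n" for i
    using lt[OF that] by linarith
  have "{..<Suc n * m} = (\<Union>i\<in>{..n}. {j. j < Suc n * m \<and> v j = i})" using v by auto
  then have "Suc n * m \<le> (\<Sum>i\<le>n. card {j. j < Suc n * m \<and> v j = i})"
    using card_UN_le[of "{..n}" "\<lambda>i. {j. j < Suc n * m \<and> v j = i}"] by (metis card_lessThan finite_atMost)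
  also have "\<dots> \<le> (\<Sum>i\<le>n. m - 1)" by (intro sum_mono small) auto
  also have "\<dots> < Suc n * m" using m by (cases m) auto
  finally show False by simp
qed

context graded_curve
begin

lemma local_param_carrier: "i \<le> n \<Longrightarrow> local_param P i \<in> carrier (poly_S n)"
  using local_param_S_part S_part_carrier by blast

text \<open>Nilpotency of the maximal ideal at the point, expressed by forms. It guarantees that the
  least exponent in \<open>ideal_order\<close> is attained.\<close>

lemma param_power_killed:
  assumes P: "graded_point n I P" and J: "ideal J (poly_S n)" "\<And>d. I d \<subseteq> J"
  shows "\<exists>s k K. s \<in> S_part n k \<and> s \<notin> P \<and> K > 0 \<and> (\<forall>p\<in>param_power n (local_param P) K. s * p \<in> J)"
proof -
  let ?u = "local_param P"
  note PP = point_prime[OF P]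
  have "\<forall>i\<in>{..n}. \<exists>s k m. s \<in> S_part n k \<and> s \<notin> P \<and> s * ?u i ^ m \<in> I (k + int m)"
    using local_param_nilpotent[OF P] by blast
  then obtain s k m where s: "\<And>i. i \<le> n \<Longrightarrow> s i \<in> S_part n (k i) \<and> s i \<notin> P \<and> s i * ?u i ^ m i \<in> I (k i + int (m i))"
    by (metis atMost_iff)
  define m' where "m' = Suc (\<Sum>i\<le>n. m i)"
  have m': "m i \<le> m'" if "i \<le> n" for i using that member_le_sum[of i "{..n}" m] by (simp add: m'_def)
  \<comment> \<open>Among this many factors chosen from n + 1 local parameters, one occurs at least
    \<open>m'\<close> times, enough to be killed by its own multiplier \<open>s i\<close>.\<close>
  define K where "K = Suc n * m'"
  define s' where "s' = (\<Prod>i\<le>n. s i)"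
  have s'S: "s' \<in> S_part n (\<Sum>i\<le>n. k i)"
  proof -
    have "prod s A \<in> S_part n (sum k A)" if "finite A" "A \<subseteq> {..n}" for A
      using that by (induction A rule: finite_induct) (auto intro!: S_part_mult dest: s)
    then show ?thesis by (simp add: s'_def)
  qed
  have s'P: "s' \<notin> P"
  proof
    assume "s' \<in> P"
    then have "\<exists>i\<in>{..n}. s i \<in> P" unfolding s'_def
      by (intro prime_prod[OF PP]) (auto dest!: s S_part_carrier)
    then show False using s by auto
  qed
  have "param_power n ?u K \<subseteq> {p \<in> carrier (poly_S n). s' * p \<in> J}"
  proof (rule param_power_least[OF ideal_colon[OF J(1) S_part_carrier[OF s'S]]])
    fix v :: "nat \<Rightarrow> nat" assume v: "\<forall>j. v j \<le> n"
    obtain i where i: "i \<le> n" "m' \<le> card {j. j < K \<and> v j = i}"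
      using pigeonhole_count[of n m' v] v by (auto simp: K_def m'_def)
    let ?A = "{j. j < K \<and> v j = i}"
    have uc: "?u (v j) \<in> carrier (poly_S n)" for j using local_param_carrier v by blast
    have "(\<Prod>j<K. ?u (v j)) = (\<Prod>j\<in>?A. ?u (v j)) * (\<Prod>j\<in>{..<K} - ?A. ?u (v j))"
      by (subst prod.subset_diff[of ?A "{..<K}"]) (auto simp: mult.commute)
    also have "(\<Prod>j\<in>?A. ?u (v j)) = ?u i ^ card ?A" by simp
    also have "?u i ^ card ?A = ?u i ^ m i * ?u i ^ (card ?A - m i)"
      using i(2) m'[OF i(1)] by (simp flip: power_add)
    finally have split: "(\<Prod>j<K. ?u (v j)) = ?u i ^ m i * ?u i ^ (card ?A - m i) * (\<Prod>j\<in>{..<K} - ?A. ?u (v j))" .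
    have "s i * ?u i ^ m i \<in> J" using s[OF i(1)] J(2) by blast
    then have "(\<Prod>i\<in>{..n} - {i}. s i) * (?u i ^ (card ?A - m i) * (\<Prod>j\<in>{..<K} - ?A. ?u (v j))) * (s i * ?u i ^ m i) \<in> J"
      using s S_part_carrier[OF S_part_power1[OF local_param_S_part[OF i(1)]]] uc
      by (intro ideal_mult[OF J(1), of _ "s i * local_param P i ^ m i"] poly_S_mult poly_S_prod)
        (auto intro: S_part_carrier)
    moreover have "s' = s i * (\<Prod>i\<in>{..n} - {i}. s i)" unfolding s'_def using i(1) by (intro prod.remove) auto
    ultimately have "s' * (\<Prod>j<K. ?u (v j)) \<in> J" unfolding split by (simp only: mult_ac)
    then show "(\<Prod>j<K. ?u (v j)) \<in> {p \<in> carrier (poly_S n). s' * p \<in> J}"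
      using uc by (auto intro: poly_S_prod)
  qed
  then show ?thesis using s'S s'P by (intro exI[of _ s'] exI[of _ "\<Sum>i\<le>n. k i"] exI[of _ K]) (auto simp: K_def m'_def)
qed

text \<open>Divided by \<open>l\<close>, each of the linear forms through the point gives an element
  of the maximal ideal. A product of as many as the order is therefore zero in the local ring of Y,
  that is, it lies in \<open>J\<close> locally.\<close>

lemma point_order_kills:
  assumes P: "graded_point n I P" and J: "J = J_ideal n f" "ideal J (poly_S n)" "\<And>d. I d \<subseteq> J" "J \<subseteq> P"
    and A: "finite A" "card A = point_order n f P" and v: "\<And>a. a \<in> A \<Longrightarrow> v a \<in> S_part n 1 \<and> v a \<in> P"
  shows "\<exists>t k. t \<in> S_part n k \<and> t \<notin> P \<and> t * (\<Prod>a\<in>A. v a) \<in> J"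
proof -
  note PP = point_prime[OF P] and PI = point_ideal[OF P]
  let ?L = "local_ring_Proj n P" and ?J = "hom_localization n P J"
  let ?R = "carrier (poly_S n)" and ?W = "param_power n (local_param P)"
  define Q where "Q = local_ring_Y n f P"
  have Q: "Q = ?L Quot ?J" by (simp add: Q_def local_ring_Y_def J(1))
  interpret L: cring ?L by (rule cring_local_ring_Proj[OF PP])
  interpret JL: ideal ?J ?L by (rule ideal_hom_localization[OF PP J(2)])
  have cQ: "cring Q" unfolding Q by (rule JL.quotient_is_cring[OF L.is_cring])
  interpret Q: cring Q by (rule cQ)
  define \<pi> where "\<pi> x = ?J +>\<^bsub>?L\<^esub> x" for x
  interpret \<pi>: ring_hom_ring ?L Q \<pi> unfolding Q \<pi>_def by (rule JL.rcos_ring_hom_ring)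
  have \<pi>_mult: "\<pi> (x * y) = \<pi> x \<otimes>\<^bsub>Q\<^esub> \<pi> y" and \<pi>_add: "\<pi> (x + y) = \<pi> x \<oplus>\<^bsub>Q\<^esub> \<pi> y"
    if "x \<in> hom_localization n P ?R" "y \<in> hom_localization n P ?R" for x y
    using \<pi>.hom_mult[of x y] \<pi>.hom_add[of x y] that by auto
  have \<pi>_one: "\<pi> 1 = \<one>\<^bsub>Q\<^esub>" using \<pi>.hom_one by simp
  have Q_zero: "\<zero>\<^bsub>Q\<^esub> = ?J" by (simp add: Q FactRing_def)
  have \<pi>_zero_iff: "\<pi> x = \<zero>\<^bsub>Q\<^esub> \<longleftrightarrow> x \<in> ?J" if "x \<in> hom_localization n P ?R" for x
    using JL.rcos_const_imp_mem[of x] L.a_rcos_zero[OF JL.is_ideal, of x] that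
    unfolding Q_zero \<pi>_def by auto
  have carrQ: "carrier Q = \<pi> ` hom_localization n P ?R"
    unfolding Q \<pi>_def FactRing_def A_RCOSETS_def' by (simp add: image_def) blast
  have loc_sub: "hom_localization n P K \<subseteq> hom_localization n P ?R" if "ideal K (poly_S n)" for K
    by (rule hom_localization_mono) (use ideal_carrier[OF that] in blast)
  \<comment> \<open>This is the maximal ideal: it is proper because J \<subseteq> P, and a fraction
    whose numerator avoids \<open>P\<close> has an inverse.\<close>
  define \<MM> where "\<MM> = \<pi> ` hom_localization n P P"
  have \<MM>: "ideal \<MM> Q"
    unfolding \<MM>_def Q \<pi>_def
    by (rule L.ring_ideal_imp_quot_ideal[OF JL.is_ideal ideal_hom_localization[OF PP PI]])
  have "the_maximal_ideal Q = \<MM>"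
  proof (rule the_maximal_ideal_eqI[OF cQ \<MM>])
    show "\<one>\<^bsub>Q\<^esub> \<notin> \<MM>"
    proof
      assume "\<one>\<^bsub>Q\<^esub> \<in> \<MM>"
      then obtain x where x: "x \<in> hom_localization n P P" "\<pi> 1 = \<pi> x" unfolding \<MM>_def \<pi>_one by blast
      have xR: "x \<in> hom_localization n P ?R" using x(1) loc_sub[OF PI] by blast
      have "\<pi> (1 + - x) = \<zero>\<^bsub>Q\<^esub>"
      proof -
        have mx: "- x \<in> hom_localization n P ?R"
          by (rule hom_localization_uminus[OF PP ideal_carrier_poly_S[OF PP] xR])
        have "\<pi> (1 + - x) = \<pi> (x + - x)"
          using \<pi>_add[OF hom_localization_one[OF PP] mx] \<pi>_add[OF xR mx] x(2) by simp
        then show ?thesis using \<pi>_zero_iff[of 0] hom_localization_zero[OF PP] ideal_0[OF J(2)] poly_S_zero by simp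
      qed
      moreover have "1 + - x \<in> hom_localization n P ?R"
        by (intro hom_localization_add[OF PP ideal_carrier_poly_S[OF PP]] hom_localization_one[OF PP]
            hom_localization_uminus[OF PP ideal_carrier_poly_S[OF PP]] xR)
      ultimately have "1 + - x \<in> hom_localization n P P"
        using \<pi>_zero_iff hom_localization_mono[OF J(4)] by blast
      then have "(1 + - x) + x \<in> hom_localization n P P" using hom_localization_add[OF PP PI] x(1) by blast
      then have "Fract 1 1 \<in> hom_localization n P P" by (simp add: One_fract_def)
      then obtain t where "t \<in> ?R" "t \<notin> P" "t * 1 \<in> P"
        using Fract_in_hom_localization_iff[OF PP PI one_S_part one_S_part prime_one[OF PP]] S_part_carrier by blast
      then show False by simp
    qed
    fix x assume "x \<in> carrier Q" "x \<notin> \<MM>"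
    then obtain y where y: "x = \<pi> y" "y \<in> hom_localization n P ?R" "y \<notin> hom_localization n P P"
      unfolding carrQ \<MM>_def by blast
    then obtain a s d where a: "y = Fract a s" "a \<in> S_part n d" "s \<in> S_part n d" "s \<notin> P"
      by (auto elim: hom_localizationE)
    then have aP: "a \<notin> P" using y(3) hom_localizationI by blast
    have z: "Fract s a \<in> hom_localization n P ?R"
      using a aP S_part_carrier by (intro hom_localizationI[of _ _ _ d]) auto
    have "Fract s a * y = 1"
      using a aP notin_prime_nonzero[OF PP] by (simp add: One_fract_def eq_fract mult.commute)
    then have "\<pi> (Fract s a) \<otimes>\<^bsub>Q\<^esub> x = \<one>\<^bsub>Q\<^esub>" using \<pi>_mult[OF z y(2)] y(1) \<pi>_one by simp
    then show "\<exists>y\<in>carrier Q. y \<otimes>\<^bsub>Q\<^esub> x = \<one>\<^bsub>Q\<^esub>" using z carrQ by blast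
  qed
  then have order: "point_order n f P = ideal_order Q \<MM>" by (simp add: point_order_def Q_def)
  have u: "local_param P i \<in> ?R" if "i \<le> n" for i using local_param_carrier that .
  have W: "ideal (?W k) (poly_S n)" for k using u by (rule ideal_param_power)
  have PW: "hom_localization n P P \<subseteq> hom_localization n P (?W 1)"
  proof
    fix x assume "x \<in> hom_localization n P P"
    then obtain a s d where a: "x = Fract a s" "a \<in> P" "a \<in> S_part n d" "s \<in> S_part n d" "s \<notin> P"
      by (rule hom_localizationE)
    have "local_param P i \<in> ?W 1" if "i \<le> n" for i
      using param_power_gen[of n "local_param P" "\<lambda>_. i" 1] u that by simp
    then have "a \<in> ?W 1" using point_subset_if_local_params[OF P W _ a(2,3)] by blast
    then show "x \<in> hom_localization n P (?W 1)" using a by (auto intro: hom_localizationI)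
  qed
  \<comment> \<open>Forms in \<open>P\<close> lie in the ideal of the local parameters, so a k-th
    power of the maximal ideal consists of classes of fractions with numerator in
    \<open>?W k\<close>.\<close>
  have pow: "ideal_power Q \<MM> k \<subseteq> \<pi> ` hom_localization n P (?W k)" for k
  proof (induction k)
    case 0
    have "1 \<in> ?W 0" using param_power_gen[of n "local_param P" "\<lambda>_. 0" 0] u by simp
    then have "r \<in> ?W 0" if "r \<in> ?R" for r using ideal_mult[OF W that, of 1 0] by simp
    then have "hom_localization n P ?R \<subseteq> hom_localization n P (?W 0)" by (intro hom_localization_mono) blast
    then show ?case unfolding ideal_power.simps carrQ by (rule image_mono)
  next
    case (Suc k)
    show ?case
    proof
      fix z assume "z \<in> ideal_power Q \<MM> (Suc k)"
      then have "z \<in> ideal_prod Q \<MM> (ideal_power Q \<MM> k)" by simp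
      then show "z \<in> \<pi> ` hom_localization n P (?W (Suc k))"
      proof (induction rule: ideal_prod.induct)
        case (prod i j)
        then obtain x y where x: "i = \<pi> x" "x \<in> hom_localization n P P"
          and y: "j = \<pi> y" "y \<in> hom_localization n P (?W k)" using Suc.IH unfolding \<MM>_def by blast
        have "x \<in> hom_localization n P (?W 1)" using x(2) PW by blast
        then have "x * y \<in> hom_localization n P (?W (Suc k))"
          by (rule hom_localization_mult[OF PP _ y(2)]) (rule param_power_mult[OF u])
        moreover have "i \<otimes>\<^bsub>Q\<^esub> j = \<pi> (x * y)"
          using \<pi>_mult[of x y] x y loc_sub[OF PI] loc_sub[OF W] by auto
        ultimately show ?case by blast
      next
        case (sum s1 s2)
        then obtain x y where x: "s1 = \<pi> x" "x \<in> hom_localization n P (?W (Suc k))"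
          and y: "s2 = \<pi> y" "y \<in> hom_localization n P (?W (Suc k))" by blast
        have "s1 \<oplus>\<^bsub>Q\<^esub> s2 = \<pi> (x + y)" using \<pi>_add[of x y] x y loc_sub[OF W] by auto
        then show ?case using hom_localization_add[OF PP W x(2) y(2)] by blast
      qed
    qed
  qed
  obtain s k K where s: "s \<in> S_part n k" "s \<notin> P" "K > 0" "\<forall>p\<in>?W K. s * p \<in> J"
    using param_power_killed[OF P J(2,3)] by blast
  have "x \<in> ?J" if "x \<in> hom_localization n P (?W K)" for x
  proof -
    obtain a t d where a: "x = Fract a t" "a \<in> ?W K" "a \<in> S_part n d" "t \<in> S_part n d" "t \<notin> P"
      using \<open>x \<in> hom_localization n P (?W K)\<close> by (rule hom_localizationE)
    have "s * a \<in> J" using s(4) a(2) by blast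
    then show ?thesis unfolding a(1) Fract_in_hom_localization_iff[OF PP J(2) a(3-5)] using s(1,2) by blast
  qed
  then have "ideal_power Q \<MM> K \<subseteq> {\<zero>\<^bsub>Q\<^esub>}"
    using pow[of K] \<pi>_zero_iff loc_sub[OF W] by blast
  moreover have "\<zero>\<^bsub>Q\<^esub> \<in> ideal_power Q \<MM> K"
    by (rule ideal_power_zero_mem[OF cQ additive_subgroup.zero_closed[OF ideal.axioms(1)[OF \<MM>]]])
  \<comment> \<open>The exponent \<open>K\<close> witnesses the least one, so the power with
    exponent \<open>point_order n f P\<close> is zero as well.\<close>
  ultimately have "0 < K \<and> ideal_power Q \<MM> K = {\<zero>\<^bsub>Q\<^esub>}" using s(3) by blast
  then have o: "ideal_power Q \<MM> (point_order n f P) = {\<zero>\<^bsub>Q\<^esub>}"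
    unfolding order ideal_order_def by (rule conjunct2[OF LeastI])
  have prods: "\<pi> (Fract (\<Prod>a\<in>B. v a) (l ^ card B)) \<in> ideal_power Q \<MM> (card B)" if "finite B" "B \<subseteq> A" for B
    using that
  proof (induction B rule: finite_induct)
    case empty
    then show ?case using hom_localization_one[OF PP] carrQ by (auto simp: One_fract_def)
  next
    case (insert b B)
    have vb: "v b \<in> S_part n 1" "v b \<in> P" using v insert.prems by auto
    have "(\<Prod>a\<in>B. v a) \<in> S_part n (int (card B))" using v insert.prems by (intro S_part_prod) auto
    then have y: "Fract (\<Prod>a\<in>B. v a) (l ^ card B) \<in> hom_localization n P ?R"
      using l_power_notin_point[OF P] l_power S_part_carrier by (intro hom_localizationI) auto
    have x: "Fract (v b) l \<in> hom_localization n P P"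
      using vb l l_notin_point[OF P] by (intro hom_localizationI)
    then have "\<pi> (Fract (v b) l) \<otimes>\<^bsub>Q\<^esub> \<pi> (Fract (\<Prod>a\<in>B. v a) (l ^ card B)) \<in>
        ideal_prod Q \<MM> (ideal_power Q \<MM> (card B))"
      using insert by (intro ideal_prod.prod) (auto simp: \<MM>_def)
    moreover have "\<pi> (Fract (v b) l) \<otimes>\<^bsub>Q\<^esub> \<pi> (Fract (\<Prod>a\<in>B. v a) (l ^ card B)) =
        \<pi> (Fract (v b) l * Fract (\<Prod>a\<in>B. v a) (l ^ card B))"
      using \<pi>_mult y x loc_sub[OF PI] by blast
    ultimately show ?case using insert.hyps by simp
  qed
  have vS: "(\<Prod>a\<in>A. v a) \<in> S_part n (int (card A))" using v by (intro S_part_prod) auto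
  have "Fract (\<Prod>a\<in>A. v a) (l ^ card A) \<in> hom_localization n P ?R"
    using vS l_power_notin_point[OF P] l_power S_part_carrier by (intro hom_localizationI) auto
  then have "Fract (\<Prod>a\<in>A. v a) (l ^ card A) \<in> ?J"
    using prods[OF A(1)] o A(2) \<pi>_zero_iff by auto
  then show ?thesis
    using Fract_in_hom_localization_iff[OF PP J(2) vS l_power l_power_notin_point[OF P]] by blast
qed

end

section \<open>Vanishing in low degrees\<close>

context graded_curve
begin

text \<open>Each variable is a local parameter plus a multiple of \<open>l\<close>, whichever point
  is assigned to the factor. For empty \<open>A\<close> the degree of \<open>r\<close> is -1, so
  \<open>r\<close> is zero.\<close>

lemma prod_var_eq_prod_local_param:
  assumes "finite A" "\<And>x. x \<in> A \<Longrightarrow> v x \<le> n"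
  shows "\<exists>r\<in>S_part n (int (card A) - 1). (\<Prod>x\<in>A. var (v x)) = (\<Prod>x\<in>A. local_param (pt x) (v x)) + r * l"
  using assms
proof (induction A rule: finite_induct)
  case (insert x A)
  then obtain r where r: "r \<in> S_part n (int (card A) - 1)"
    "(\<Prod>x\<in>A. var (v x)) = (\<Prod>x\<in>A. local_param (pt x) (v x)) + r * l" by auto
  let ?u = "local_param (pt x) (v x)" and ?c = "const (coord (pt x) (v x))"
  have var: "var (v x) = ?u + ?c * l" by (simp add: local_param_def)
  have "(\<Prod>x\<in>insert x A. var (v x)) = ?u * (\<Prod>x\<in>A. var (v x)) + (?c * (\<Prod>x\<in>A. var (v x))) * l"
    using insert.hyps by (simp add: var algebra_simps)
  also have "?u * (\<Prod>x\<in>A. var (v x)) = ?u * (\<Prod>x\<in>A. local_param (pt x) (v x)) + (?u * r) * l"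
    unfolding r(2) by (simp add: algebra_simps)
  finally have "(\<Prod>x\<in>insert x A. var (v x)) = (\<Prod>x\<in>insert x A. local_param (pt x) (v x)) +
      (?u * r + ?c * (\<Prod>x\<in>A. var (v x))) * l"
    using insert.hyps by (simp add: distrib_right add.assoc)
  moreover have "?u * r + ?c * (\<Prod>x\<in>A. var (v x)) \<in> S_part n (int (card (insert x A)) - 1)"
  proof (intro S_part_add S_part_const_mult)
    show "?u * r \<in> S_part n (int (card (insert x A)) - 1)"
      using insert by (intro S_part_mult'[OF local_param_S_part r(1)]) auto
    show "(\<Prod>x\<in>A. var (v x)) \<in> S_part n (int (card (insert x A)) - 1)"
      using S_part_prod[of A "\<lambda>x. var (v x)" n] insert by (auto intro: var_S_part)
  qed
  ultimately show ?case by blast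
qed (auto intro!: bexI[of _ 0])

text \<open>If \<open>a J \<subseteq> I\<close>, then \<open>(I : a h)\<close> contains a power of \<open>l\<close> whenever \<open>h\<close> vanishes at each point
  of the scheme to the order of that point, because no point contains \<open>(I : a h)\<close>.\<close>

lemma annihilated_by_local_params:
  assumes J: "gideal n J" "J_ideal n f = gtotal n J" "\<And>d. I d \<subseteq> J d"
    and a: "a \<in> S_part n m" "\<And>d b. b \<in> J d \<Longrightarrow> b * a \<in> I (d + m)"
    and v: "\<And>x. v x \<le> n"
    and A: "A = Sigma (Y_support n f) (\<lambda>P. {..<point_order n f P})" "finite A"
  shows "(\<Prod>x\<in>A. local_param (fst x) (v x)) * a \<in> I (int (card A) + m)"
proof (rule ccontr)
  let ?N = "int (card A)"
  define h where "h = (\<Prod>x\<in>A. local_param (fst x) (v x))"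
  have lpS: "local_param (fst x) (v x) \<in> S_part n 1" for x using local_param_S_part v by blast
  have hS: "h \<in> S_part n ?N" unfolding h_def by (rule S_part_prod) (rule lpS)
  have haS: "h * a \<in> S_part n (?N + m)" by (rule S_part_mult[OF hS a(1)])
  assume "(\<Prod>x\<in>A. local_param (fst x) (v x)) * a \<notin> I (?N + m)"
  then have ha: "h * a \<notin> I (?N + m)" by (simp add: h_def)
  \<comment> \<open>This is (I : h a). A power of \<open>l\<close> in it would put h a into
    \<open>I\<close>, since \<open>l\<close> is a nonzerodivisor.\<close>
  define K where "K d = {b \<in> S_part n d. b * (h * a) \<in> I (d + (?N + m))}" for d
  have K: "gideal n K"
  proof (rule gidealI)
    show "r * p \<in> K (e + d)" if "r \<in> S_part n e" "p \<in> K d" for d e r p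
      using that gideal_mult'[OF I that(1), of "p * (h * a)" "d + (?N + m)" "e + d + (?N + m)"]
      by (auto simp: K_def mult.assoc intro: S_part_mult)
  qed (auto simp: K_def distrib_right intro: S_part_add gideal_add[OF I] gideal_0[OF I])
  have "l ^ k \<notin> K (int k)" for k
  proof
    assume "l ^ k \<in> K (int k)"
    then have "(h * a) * l ^ k \<in> I (?N + m + int k * 1)" by (simp add: K_def mult.commute add_ac)
    then show False using nzd_power[OF I l l_nzd haS] ha by blast
  qed
  then obtain P where P: "P \<in> Proj_points n" "gtotal n K \<subseteq> P" using ex_point_avoiding[OF K l] by blast
  have JI: "ideal (gtotal n J) (poly_S n)" by (rule ideal_gtotal[OF J(1)])
  have "J d \<subseteq> K d" for d
  proof
    fix b assume b: "b \<in> J d"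
    have "(b * a) * h \<in> I (d + (?N + m))"
      by (rule gideal_mult_right[OF I hS a(2)[OF b]]) simp
    then show "b \<in> K d" using gideal_S_part[OF J(1) b] by (simp add: K_def mult_ac)
  qed
  then have "gtotal n J \<subseteq> gtotal n K" unfolding gtotal_def by blast
  then have JP: "gtotal n J \<subseteq> P" using P(2) by blast
  have IJ: "I d \<subseteq> gtotal n J" for d using J(3) gtotal_subset[OF J(1)] by blast
  have PY: "P \<in> Y_support n f" using P(1) JP J(2) by (simp add: Y_support_def)
  have pt: "graded_point n I P" using P(1) IJ JP by (auto simp: graded_point_def Proj_points_def)
  \<comment> \<open>The factors of \<open>h\<close> assigned to \<open>P\<close> are exactly as many
    as its order.\<close>
  let ?B = "{x \<in> A. fst x = P}"
  have "?B = {P} \<times> {..<point_order n f P}" using PY by (auto simp: A(1))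
  then have "card ?B = point_order n f P" by (simp add: card_cartesian_product)
  moreover have "local_param (fst x) (v x) \<in> S_part n 1 \<and> local_param (fst x) (v x) \<in> P" if "x \<in> ?B" for x
    using that lpS[of x] local_param_in[OF pt v[of x]] by simp
  ultimately obtain t k where t: "t \<in> S_part n k" "t \<notin> P"
    "t * (\<Prod>x\<in>?B. local_param (fst x) (v x)) \<in> gtotal n J"
    using point_order_kills[OF pt J(2)[symmetric] JI IJ JP, of ?B "\<lambda>x. local_param (fst x) (v x)"] A(2)
    by auto
  have "(\<Prod>x\<in>A - ?B. local_param (fst x) (v x)) \<in> carrier (poly_S n)"
    by (intro poly_S_prod S_part_carrier[OF lpS])
  then have "(\<Prod>x\<in>A - ?B. local_param (fst x) (v x)) * (t * (\<Prod>x\<in>?B. local_param (fst x) (v x))) \<in> gtotal n J"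
    by (rule ideal_mult[OF JI _ t(3)])
  moreover have "h = (\<Prod>x\<in>A - ?B. local_param (fst x) (v x)) * (\<Prod>x\<in>?B. local_param (fst x) (v x))"
    unfolding h_def using A(2) by (intro prod.subset_diff) auto
  ultimately have "t * h \<in> gtotal n J" by (simp only: mult_ac)
  then have "t * h \<in> J (k + ?N)" using gtotal_homogeneous[OF J(1) S_part_mult[OF t(1) hS]] by blast
  \<comment> \<open>From t h \<in> J and a J \<subseteq> I follows t h a \<in> I, so
    \<open>t\<close> lies in \<open>K\<close> and thereby in \<open>P\<close>.\<close>
  then have "t \<in> K k" using a(2)[of "t * h" "k + ?N"] t(1) by (simp add: K_def mult.assoc add.assoc)
  then show False using t(2) P(2) gtotal_subset[OF K] by blast
qed

lemma low_degree_annihilator: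
  assumes socle: "\<And>d. has_socle n (adj n I l 1) d \<Longrightarrow> d = \<sigma>"
    and J: "gideal n J" "J_ideal n f = gtotal n J" "\<And>d. I d \<subseteq> J d"
    and a: "a \<in> S_part n m" "\<And>d b. b \<in> J d \<Longrightarrow> b * a \<in> I (d + m)"
    and m: "m \<le> \<sigma> - (\<Sum>P\<in>Y_support n f. int (point_order n f P))"
  shows "a \<in> I m"
  using a m
proof (induction "nat (m + 1)" arbitrary: a m rule: less_induct)
  case less
  show ?case
  proof (cases "m < 0")
    case True
    then show ?thesis using S_part_neg[OF less.prems(1)] gideal_0[OF I] by simp
  next
    case False
    have IJ: "I d \<subseteq> gtotal n J" for d using J(3) gtotal_subset[OF J(1)] by blast
    have "Y_support n f \<subseteq> {P. graded_point n I P}"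
      using IJ unfolding Y_support_def J(2) Proj_points_def graded_point_def by blast
    then have finY: "finite (Y_support n f)" using finite_points finite_subset by blast
    \<comment> \<open>Each point contributes as many slots as its order; a monomial of degree
      \<open>card A\<close> puts one variable into every slot.\<close>
    define A where "A = Sigma (Y_support n f) (\<lambda>P. {..<point_order n f P})"
    have finA: "finite A" using finY by (simp add: A_def)
    have cardA: "int (card A) = (\<Sum>P\<in>Y_support n f. int (point_order n f P))"
      using finY by (simp add: A_def)
    have adj: "gideal n (adj n I l 1)" by (rule gideal_adj[OF I l])
    have kill: "p * a \<in> adj n I l 1 (int (card A) + m)" if "p \<in> S_part n (int (card A))" for p
      using that
    proof (induction rule: S_part_induct)
      case (monomial t)
      then obtain w where w: "\<forall>x\<in>A. w x \<le> n" "Poly_Mapping.single t 1 = (\<Prod>x\<in>A. var (w x))"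
        using monomial_eq_prod_var[OF finA, of t n] by auto
      define v where "v x = (if x \<in> A then w x else 0)" for x
      have v: "v x \<le> n" for x using w(1) by (simp add: v_def)
      have mono: "Poly_Mapping.single t 1 = (\<Prod>x\<in>A. var (v x))"
        unfolding w(2) by (intro prod.cong) (auto simp: v_def)
      obtain r where r: "r \<in> S_part n (int (card A) - 1)"
        "(\<Prod>x\<in>A. var (v x)) = (\<Prod>x\<in>A. local_param (fst x) (v x)) + r * l"
        using prod_var_eq_prod_local_param[OF finA, of v fst] v by blast
      have "Poly_Mapping.single t 1 * a = (\<Prod>x\<in>A. local_param (fst x) (v x)) * a + (r * a) * l"
        unfolding mono r(2) by (simp add: algebra_simps)
      also have "\<dots> \<in> adj n I l 1 (int (card A) + m)"
        by (intro adjI annihilated_by_local_params[OF J less.prems(1,2) v A_def finA]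
            S_part_mult'[OF r(1) less.prems(1)]) simp_all
      finally show ?case .
    qed (auto simp: distrib_right mult.assoc intro: gideal_0[OF adj] gideal_add[OF adj] gideal_const_mult[OF adj])
    have "a \<in> adj n I l 1 m"
    proof (rule ccontr)
      assume "a \<notin> adj n I l 1 m"
      \<comment> \<open>In degree 0 a multiple of \<open>a\<close> stays outside (I, l), in degree
        \<open>card A\<close> none does. Where this changes, from \<open>j\<close> to
        \<open>Suc j\<close>, the multiple is a socle element of degree j + m < \<sigma>.\<close>
      let ?Q = "\<lambda>j. \<exists>g\<in>S_part n (int j). g * a \<notin> adj n I l 1 (int j + m)"
      have "?Q 0" using \<open>a \<notin> adj n I l 1 m\<close> by (auto intro!: bexI[of _ 1])
      moreover have "\<not> ?Q (card A)" using kill by blast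
      ultimately obtain j where j: "j < card A" "?Q j" "\<not> ?Q (Suc j)"
        using ex_least_nat_less[of "\<lambda>j. \<not> ?Q j" "card A"] by auto
      obtain g where g: "g \<in> S_part n (int j)" "g * a \<notin> adj n I l 1 (int j + m)" using j(2) by blast
      have "var i * (g * a) \<in> adj n I l 1 (int j + m + 1)" if "i \<le> n" for i
      proof -
        have "var i * g \<in> S_part n (int (Suc j))" by (rule S_part_mult'[OF var_S_part[OF that] g(1)]) simp
        then have "(var i * g) * a \<in> adj n I l 1 (int (Suc j) + m)" using j(3) by blast
        then show ?thesis by (simp add: mult.assoc add_ac)
      qed
      then have "has_socle n (adj n I l 1) (int j + m)"
        unfolding has_socle_def using g S_part_mult[OF g(1) less.prems(1)] by blast
      then have "int j + m = \<sigma>" by (rule socle)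
      then show False using less.prems(3) j(1) cardA by linarith
    qed
    then obtain k r where r: "a = k + r * l" "k \<in> I m" "r \<in> S_part n (m - 1)" by (rule adjE)
    have "r \<in> I (m - 1)"
    proof (rule less.hyps[OF _ r(3)])
      show "nat (m - 1 + 1) < nat (m + 1)" using False by simp
      show "m - 1 \<le> \<sigma> - (\<Sum>P\<in>Y_support n f. int (point_order n f P))" using less.prems(3) by simp
      fix d b assume b: "b \<in> J d"
      have bS: "b \<in> S_part n d" by (rule gideal_S_part[OF J(1) b])
      have "(b * r) * l = b * a - b * k" by (simp add: r(1) algebra_simps)
      also have "\<dots> \<in> I (d + m)"
        by (intro gideal_diff[OF I] less.prems(2) b gideal_mult[OF I bS r(2)])
      finally show "b * r \<in> I (d + (m - 1))"
        by (rule nzdD[OF l_nzd S_part_mult[OF bS r(3)]]) simp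
    qed
    then show ?thesis unfolding r(1)
      by (intro gideal_add[OF I r(2)] gideal_mult_right[OF I l]) auto
  qed
qed

end

section \<open>Syzygies\<close>

lemma genideal_finite_combination:
  assumes A: "finite A" "\<And>i. i \<in> A \<Longrightarrow> f i \<in> carrier (poly_S n)" and p: "p \<in> genideal (poly_S n) (f ` A)"
  shows "\<exists>b. (\<forall>i. b i \<in> carrier (poly_S n)) \<and> p = (\<Sum>i\<in>A. b i * f i)"
proof -
  let ?X = "{\<Sum>i\<in>A. b i * f i | b. \<forall>i. b i \<in> carrier (poly_S n)}"
  have "ideal ?X (poly_S n)"
    unfolding ideal_poly_S_iff
  proof (intro conjI ballI)
    show "?X \<subseteq> carrier (poly_S n)" using A(2) by (auto intro!: poly_S_sum poly_S_mult)
    show "0 \<in> ?X" by (intro CollectI exI[of _ "\<lambda>_. 0"]) (simp add: poly_S_zero)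
    fix p q assume "p \<in> ?X" "q \<in> ?X"
    then obtain b c where "p = (\<Sum>i\<in>A. b i * f i)" "q = (\<Sum>i\<in>A. c i * f i)"
      "\<forall>i. b i \<in> carrier (poly_S n)" "\<forall>i. c i \<in> carrier (poly_S n)" by blast
    then show "p + q \<in> ?X"
      by (intro CollectI exI[of _ "\<lambda>i. b i + c i"]) (auto simp: sum.distrib distrib_right intro: poly_S_add)
  next
    fix r p assume "r \<in> carrier (poly_S n)" "p \<in> ?X"
    then obtain b where "p = (\<Sum>i\<in>A. b i * f i)" "\<forall>i. b i \<in> carrier (poly_S n)" by blast
    then show "r * p \<in> ?X" using \<open>r \<in> carrier (poly_S n)\<close>
      by (intro CollectI exI[of _ "\<lambda>i. r * b i"]) (auto simp: sum_distrib_left mult.assoc intro: poly_S_mult)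
  qed
  moreover have "f ` A \<subseteq> ?X"
  proof
    fix x assume "x \<in> f ` A"
    then obtain j where j: "j \<in> A" "x = f j" by blast
    have "(\<Sum>i\<in>A. (if i = j then 1 else 0) * f i) = (\<Sum>i\<in>A. if i = j then f i else 0)"
      by (intro sum.cong) auto
    then show "x \<in> ?X" using j A(1)
      by (intro CollectI exI[of _ "\<lambda>i. if i = j then 1 else 0"]) (auto intro: poly_S_closed)
  qed
  ultimately have "p \<in> ?X" using genideal_least p by blast
  then show ?thesis by blast
qed

section \<open>Koszul relations among the syzygies\<close>

lemma AR_simps [simp]:
  "ring.add (AR n f) = (\<lambda>a b i. a i + b i)" "ring.zero (AR n f) = (\<lambda>i. 0)"
  "Module.smult (AR n f) = (\<lambda>r a i. r * a i)"
  by (simp_all add: AR_def free_S_def)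

lemma AR_carrier_iff:
  "a \<in> carrier (AR n f) \<longleftrightarrow>
    (\<forall>i\<le>n. a i \<in> carrier (poly_S n)) \<and> (\<forall>i>n. a i = 0) \<and> (\<Sum>i\<le>n. a i * f i) = 0"
  by (auto simp: AR_def free_S_def)

lemma AR_submodule:
  assumes "submodule N (poly_S n) (AR n f)"
  shows AR_submodule_carrier: "a \<in> N \<Longrightarrow> a \<in> carrier (AR n f)"
    and AR_submodule_zero: "(\<lambda>i. 0) \<in> N"
    and AR_submodule_add: "a \<in> N \<Longrightarrow> b \<in> N \<Longrightarrow> (\<lambda>i. a i + b i) \<in> N"
    and AR_submodule_smult: "r \<in> carrier (poly_S n) \<Longrightarrow> a \<in> N \<Longrightarrow> (\<lambda>i. r * a i) \<in> N"
    and AR_submodule_diff: "a \<in> N \<Longrightarrow> b \<in> N \<Longrightarrow> (\<lambda>i. a i - b i) \<in> N"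
proof -
  have grp: "subgroup N (add_monoid (AR n f))" using assms by (simp add: submodule_def)
  show "a \<in> carrier (AR n f)" if "a \<in> N" using subgroup.subset[OF grp] that by auto
  show "(\<lambda>i. 0) \<in> N" using subgroup.one_closed[OF grp] by simp
  show add: "(\<lambda>i. a i + b i) \<in> N" if "a \<in> N" "b \<in> N" for a b
    using subgroup.m_closed[OF grp that] by simp
  show smult: "(\<lambda>i. r * a i) \<in> N" if "r \<in> carrier (poly_S n)" "a \<in> N" for r a
    using submodule.smult_closed[OF assms that] by simp
  show "(\<lambda>i. a i - b i) \<in> N" if "a \<in> N" "b \<in> N"
    using add[OF that(1) smult[OF const_carrier[of "-1"] that(2)]] by (simp add: const_uminus)
qed

lemma AR_submodule_sum:
  assumes N: "submodule N (poly_S n) (AR n f)" and "\<And>x. x \<in> A \<Longrightarrow> g x \<in> N"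
  shows "(\<lambda>i. \<Sum>x\<in>A. g x i) \<in> N"
  using assms(2)
  by (induction A rule: infinite_finite_induct) (auto intro: AR_submodule_zero[OF N] AR_submodule_add[OF N])

lemma sum_atMost_split_0: "(\<Sum>i\<le>n. g i) = g 0 + (\<Sum>i\<in>{1..n}. g i)" for g :: "nat \<Rightarrow> mpoly"
  by (simp add: sum.atLeast_Suc_atMost atMost_atLeast0)

lemma regular_sequence_mapD:
  assumes reg: "regular_sequence (poly_S n) (map f [1..<Suc n])" and k: "Suc k \<le> n"
    and g: "g \<in> carrier (poly_S n)" "g * f (Suc k) \<in> genideal (poly_S n) (f ` {1..k})"
  shows "g \<in> genideal (poly_S n) (f ` {1..k})"
proof -
  have "set (take k (map f [1..<Suc n])) = f ` {1..k}"
    using k by (simp add: take_map atLeastLessThanSuc_atLeastAtMost del: upt_Suc)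
  moreover have "map f [1..<Suc n] ! k = f (Suc k)" using k by (simp del: upt_Suc)
  moreover have "k < length (map f [1..<Suc n])" using k by simp
  ultimately show ?thesis
    using reg g unfolding regular_sequence_def by (simp add: mult.commute del: upt_Suc) metis
qed

text \<open>Regularity puts the last entry, in position k + 1, into (f_1, ..., f_k); Koszul
  relations with f_(k+1) then remove it and leave entry 0 alone. The submodule is arbitrary because
  \<open>KR\<close> is an intersection of such submodules.\<close>

lemma regular_syzygy_in_submodule:
  assumes N: "submodule N (poly_S n) (AR n f)" "{koszul f i j | i j. i < j \<and> j \<le> n} \<subseteq> N"
    and f: "\<And>i. i \<le> n \<Longrightarrow> f i \<in> carrier (poly_S n)"
    and reg: "regular_sequence (poly_S n) (map f [1..<Suc n])"
    and a: "a \<in> carrier (AR n f)" "a 0 = 0" "\<And>i. i > k \<Longrightarrow> a i = 0" and k: "k \<le> n"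
  shows "a \<in> N"
  using a k
proof (induction k arbitrary: a)
  case 0
  then have "a = (\<lambda>i. 0)" by (metis gr0I ext)
  then show ?case using AR_submodule_zero[OF N(1)] by simp
next
  case (Suc k)
  have aR: "a i \<in> carrier (poly_S n)" if "i \<le> n" for i using Suc.prems(1) that by (simp add: AR_carrier_iff)
  have fk: "f ` {1..k} \<subseteq> carrier (poly_S n)" using f Suc.prems(4) by auto
  let ?G = "genideal (poly_S n) (f ` {1..k})"
  have G: "ideal ?G (poly_S n)" "f ` {1..k} \<subseteq> ?G" using genideal_is_ideal[OF fk] by auto
  have "0 = (\<Sum>i\<in>{1..n}. a i * f i)"
    using Suc.prems(1,2) by (simp add: AR_carrier_iff sum_atMost_split_0)
  also have "\<dots> = (\<Sum>i\<in>{1..Suc k}. a i * f i)"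
    using Suc.prems(3,4) by (intro sum.mono_neutral_right) auto
  finally have "a (Suc k) * f (Suc k) = 0 - (\<Sum>i\<in>{1..k}. a i * f i)"
    by (simp add: eq_neg_iff_add_eq_0 add.commute)
  also have "\<dots> \<in> ?G"
    using G(2) aR Suc.prems(4)
    by (intro ideal_diff[OF G(1)] ideal_0[OF G(1)] ideal_sum[OF G(1)] ideal_mult[OF G(1)]) auto
  finally have "a (Suc k) \<in> ?G"
    using regular_sequence_mapD[OF reg Suc.prems(4) aR[OF Suc.prems(4)]] by blast
  moreover have "f i \<in> carrier (poly_S n)" if "i \<in> {1..k}" for i using fk that by blast
  ultimately have "\<exists>b. (\<forall>i. b i \<in> carrier (poly_S n)) \<and> a (Suc k) = (\<Sum>i\<in>{1..k}. b i * f i)"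
    by (rule genideal_finite_combination[OF finite_atLeastAtMost, rotated])
  then obtain b where b: "\<And>i. b i \<in> carrier (poly_S n)" "a (Suc k) = (\<Sum>i\<in>{1..k}. b i * f i)" by blast
  \<comment> \<open>Entry \<open>Suc k\<close> of \<open>koszul f j (Suc k)\<close> is -f_j, so
    adding this combination cancels the last entry.\<close>
  let ?z = "\<lambda>i. \<Sum>j\<in>{1..k}. b j * koszul f j (Suc k) i"
  have "koszul f j (Suc k) \<in> N" if "j \<in> {1..k}" for j using N(2) that Suc.prems(4) by force
  then have zN: "?z \<in> N"
    using AR_submodule_sum[OF N(1), of "{1..k}" "\<lambda>j i. b j * koszul f j (Suc k) i"]
      AR_submodule_smult[OF N(1) b(1)] by auto
  define c where "c i = a i + ?z i" for i
  have "c \<in> N"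
  proof (rule Suc.IH)
    have "c 0 = 0" using Suc.prems(2) by (simp add: c_def koszul_def)
    moreover have "c (Suc k) = 0" by (simp add: c_def koszul_def b(2) sum_negf)
    moreover have "c i = 0" if "i > Suc k" for i using that Suc.prems(3) by (auto simp: c_def koszul_def)
    ultimately show "c 0 = 0" "\<And>i. i > k \<Longrightarrow> c i = 0" by (auto, metis Suc_lessI)
    show "c \<in> carrier (AR n f)"
      using Suc.prems(1) AR_submodule_carrier[OF N(1) zN]
      by (auto simp: AR_carrier_iff c_def distrib_right sum.distrib intro: poly_S_add)
  qed (use Suc.prems(4) in simp)
  then have "(\<lambda>i. c i - ?z i) \<in> N" by (rule AR_submodule_diff[OF N(1) _ zN])
  then show ?case by (simp add: c_def)
qed

text \<open>Subtracting Koszul relations between f_0 and the other f_j clears entry 0 and leaves a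
  syzygy of the regular sequence alone.\<close>

lemma syzygy_in_KR:
  assumes f: "\<And>i. i \<le> n \<Longrightarrow> f i \<in> carrier (poly_S n)"
    and reg: "regular_sequence (poly_S n) (map f [1..<Suc n])"
    and a: "a \<in> carrier (AR n f)" "a 0 \<in> genideal (poly_S n) (f ` {1..n})"
  shows "a \<in> KR n f"
  unfolding KR_def
proof (intro InterI, clarify)
  fix N assume N: "submodule N (poly_S n) (AR n f)" "{koszul f i j | i j. i < j \<and> j \<le> n} \<subseteq> N"
  obtain b where b: "\<And>i. b i \<in> carrier (poly_S n)" "a 0 = (\<Sum>i\<in>{1..n}. b i * f i)"
    using genideal_finite_combination[OF _ _ a(2)] f by auto
  let ?z = "\<lambda>i. \<Sum>j\<in>{1..n}. b j * koszul f 0 j i"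
  have "koszul f 0 j \<in> N" if "j \<in> {1..n}" for j using N(2) that by force
  then have zN: "?z \<in> N"
    using AR_submodule_sum[OF N(1), of "{1..n}" "\<lambda>j i. b j * koszul f 0 j i"]
      AR_submodule_smult[OF N(1) b(1)] by auto
  define c where "c i = a i - ?z i" for i
  have "c \<in> N"
  proof (rule regular_syzygy_in_submodule[OF N f reg])
    show "c 0 = 0" by (simp add: c_def koszul_def b(2))
    show "c i = 0" if "i > n" for i
      using that a(1) AR_submodule_carrier[OF N(1) zN] by (auto simp: c_def AR_carrier_iff)
    show "c \<in> carrier (AR n f)"
      using a(1) AR_submodule_carrier[OF N(1) zN]
      by (auto simp: AR_carrier_iff c_def left_diff_distrib sum_subtractf intro: poly_S_diff)
  qed simp_all
  then have "(\<lambda>i. c i + ?z i) \<in> N" by (rule AR_submodule_add[OF N(1) _ zN])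
  then show "a \<in> N" by (simp add: c_def)
qed

lemma KR_coset:
  assumes a: "a \<in> KR n f"
  shows "KR n f +>\<^bsub>AR n f\<^esub> a = KR n f"
proof -
  have "(\<lambda>i. b i + a i) \<in> KR n f" "(\<lambda>i. b i - a i) \<in> KR n f" if "b \<in> KR n f" for b
    using a that unfolding KR_def by (auto intro: AR_submodule_add AR_submodule_diff)
  note * = this
  show ?thesis
    unfolding a_r_coset_def'
  proof (intro equalityI subsetI)
    fix b assume b: "b \<in> KR n f"
    show "b \<in> (\<Union>h\<in>KR n f. {h \<oplus>\<^bsub>AR n f\<^esub> a})" by (rule UN_I[OF *(2)[OF b]]) simp
  qed (use * in auto)
qed

lemma hom_regular_map:
  assumes f: "\<And>i. i \<le> n \<Longrightarrow> f i \<in> S_part n (int e)" and e: "0 < e"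
    and reg: "regular_sequence (poly_S n) (map f [1..<Suc n])" and k: "k \<le> n"
  shows "hom_regular n (\<lambda>_. {0}) (map (\<lambda>i. (f i, int e)) [1..<Suc k])"
  using k
proof (induction k)
  case (Suc k)
  let ?gs = "map (\<lambda>i. (f i, int e)) [1..<Suc k]"
  let ?I = "adjs n (\<lambda>_. {0}) ?gs"
  have H: "hom_regular n (\<lambda>_. {0}) ?gs" using Suc by simp
  have I: "gideal n ?I" by (rule gideal_adjs_regular[OF gideal_zero H])
  have "fst ` set ?gs = f ` {1..k}"
    by (simp add: image_image atLeastLessThanSuc_atLeastAtMost del: upt_Suc)
  then have G: "genideal (poly_S n) (f ` {1..k}) = gtotal n ?I"
    using genideal_eq_gtotal_adjs[of ?gs n] hom_regular_S_part[OF H] by simp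
  have "nzd n ?I (f (Suc k)) (int e)"
  proof (rule nzdI)
    fix d u assume u: "u \<in> S_part n d" "u * f (Suc k) \<in> ?I (d + int e)"
    have "u * f (Suc k) \<in> genideal (poly_S n) (f ` {1..k})"
      unfolding G using gtotal_subset[OF I] u(2) by blast
    then have "u \<in> genideal (poly_S n) (f ` {1..k})"
      using regular_sequence_mapD[OF reg Suc.prems S_part_carrier[OF u(1)]] by blast
    then show "u \<in> ?I d" unfolding G using gtotal_homogeneous[OF I u(1)] by blast
  qed
  then show ?case using H f e Suc.prems by (simp add: hom_regular_append)
qed simp

theorem theorem1p2:
  fixes n e :: nat and f :: "nat \<Rightarrow> mpoly"
  assumes "0 < e"
    and "\<And>i. i \<le> n \<Longrightarrow> f i \<in> S_part n (int e)"
    and "krull_dim (poly_S n Quot J_ideal n f) = 1"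
    and "regular_sequence (poly_S n) (map f [1..<Suc n])"
  shows "\<forall>m::int. m \<le> int n * (int e - 1) - (\<Sum>p\<in>Y_support n f. int (point_order n f p))
           \<longrightarrow> ER_part n f m = {\<one>\<^bsub>ER n f\<^esub>}"
proof (intro allI impI)
  fix m :: int
  assume m: "m \<le> int n * (int e - 1) - (\<Sum>p\<in>Y_support n f. int (point_order n f p))"
  note f = assms(2)
  define gs where "gs = map (\<lambda>i. (f i, int e)) [1..<Suc n]"
  define I where "I = adjs n (\<lambda>_. {0}) gs"
  have H: "hom_regular n (\<lambda>_. {0}) gs"
    unfolding gs_def by (rule hom_regular_map[OF f assms(1,4) order_refl])
  have len: "length gs = n" by (simp add: gs_def)
  have I: "gideal n I" unfolding I_def by (rule gideal_adjs_regular[OF gideal_zero H])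
  have no_socle: "\<not> has_socle n I d" for d
    unfolding I_def using hom_regular_no_socle[OF H] len by simp
  obtain l where l: "l \<in> S_part n 1" "nzd n I l 1" using ex_common_nzd[OF I no_socle I no_socle] .
  have Hl: "hom_regular n (\<lambda>_. {0}) (gs @ [(l, 1)])"
    using H l by (simp add: hom_regular_append I_def)
  have Il: "adjs n (\<lambda>_. {0}) (gs @ [(l, 1)]) = adj n I l 1" by (simp add: adjs_append I_def)
  obtain M where M: "\<And>d. d \<ge> M \<Longrightarrow> S_part n d \<subseteq> adj n I l 1 d"
    using hom_regular_finite_colength[OF Hl] len unfolding Il finite_colength_def by auto
  interpret graded_curve n I l "max M 0"
    by unfold_locales (use I l M in auto)
  have deg: "sum_list (map snd gs) = int n * int e"
    by (simp add: gs_def o_def map_replicate_const sum_list_replicate del: upt_Suc)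
  \<comment> \<open>The degrees of f_1, ..., f_n and l add up to n e + 1, from which n + 1 is
    subtracted.\<close>
  have socle: "d = int n * (int e - 1)" if "has_socle n (adj n I l 1) d" for d
    using hom_regular_socle_degree[OF Hl, unfolded Il, OF _ that] len deg by (simp add: algebra_simps)
  define J where "J = adj n I (f 0) (int e)"
  have J: "gideal n J" unfolding J_def by (rule gideal_adj[OF I f]) simp
  have fst_gs: "fst ` set gs = f ` {1..n}"
    by (simp add: gs_def image_image atLeastLessThanSuc_atLeastAtMost del: upt_Suc)
  have gen_I: "genideal (poly_S n) (f ` {1..n}) = gtotal n I"
    unfolding fst_gs[symmetric] I_def by (rule genideal_eq_gtotal_adjs) (rule hom_regular_S_part[OF H])
  have "fst ` set (gs @ [(f 0, int e)]) = f ` {..n}"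
  proof -
    have "{..n} = insert 0 {1..n}" by auto
    then show ?thesis using fst_gs by (simp add: image_Un)
  qed
  moreover have "genideal (poly_S n) (fst ` set (gs @ [(f 0, int e)])) = gtotal n (adjs n (\<lambda>_. {0}) (gs @ [(f 0, int e)]))"
    by (rule genideal_eq_gtotal_adjs) (use hom_regular_S_part[OF H] f in auto)
  ultimately have J_total: "J_ideal n f = gtotal n J"
    by (simp add: J_ideal_def J_def adjs_append I_def)
  have fI: "f i \<in> I (int e)" if "i \<in> {1..n}" for i
  proof -
    have "f ` {1..n} \<subseteq> carrier (poly_S n)" using f S_part_carrier by force
    then have "f i \<in> gtotal n I" using genideal_is_ideal[of "f ` {1..n}" n] that gen_I by blast
    then show ?thesis using gtotal_homogeneous[OF I f] that by auto
  qed
  have "a \<in> KR n f" if a: "a \<in> AR_part n f m" for a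
  proof -
    have aC: "a \<in> carrier (AR n f)" and aS: "\<And>i. i \<le> n \<Longrightarrow> a i \<in> S_part n m"
      using a by (auto simp: AR_part_def)
    have "a 0 \<in> I m"
    proof (rule low_degree_annihilator[OF socle J J_total _ aS _ m])
      show "I d \<subseteq> J d" for d unfolding J_def using adj_base by blast
      fix d b assume "b \<in> J d"
      then obtain k r where b: "b = k + r * f 0" "k \<in> I d" "r \<in> S_part n (d - int e)"
        unfolding J_def by (rule adjE)
      \<comment> \<open>The syzygy moves a_0 f_0 into \<open>I\<close>; as \<open>J\<close> is
        generated by \<open>I\<close> and f_0, this yields a_0 J \<subseteq> I.\<close>
      have "a 0 * f 0 = - (\<Sum>i\<in>{1..n}. a i * f i)"
        using aC by (simp add: AR_carrier_iff sum_atMost_split_0 eq_neg_iff_add_eq_0)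
      also have "\<dots> \<in> I (m + int e)"
        by (intro gideal_uminus[OF I] gideal_sum[OF I] gideal_mult[OF I aS fI]) auto
      finally have "r * (a 0 * f 0) \<in> I (d + m)" by (rule gideal_mult'[OF I b(3)]) simp
      moreover have "k * a 0 \<in> I (d + m)" by (rule gideal_mult_right[OF I aS b(2)]) auto
      ultimately have "k * a 0 + r * (a 0 * f 0) \<in> I (d + m)" by (intro gideal_add[OF I])
      then show "b * a 0 \<in> I (d + m)" by (simp add: b(1) algebra_simps)
    qed simp_all
    then have "a 0 \<in> genideal (poly_S n) (f ` {1..n})"
      unfolding gen_I using gtotal_subset[OF I] by blast
    then show ?thesis using syzygy_in_KR[OF _ assms(4) aC] f S_part_carrier by blast
  qed
  then have "KR n f +>\<^bsub>AR n f\<^esub> a = KR n f" if "a \<in> AR_part n f m" for a using KR_coset that by blast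
  moreover have "(\<lambda>i. 0) \<in> AR_part n f m" by (auto simp: AR_part_def AR_carrier_iff poly_S_zero)
  moreover have "\<one>\<^bsub>ER n f\<^esub> = KR n f" by (simp add: ER_def A_FactGroup_def FactGroup_def)
  ultimately show "ER_part n f m = {\<one>\<^bsub>ER n f\<^esub>}" unfolding ER_part_def by auto
qed

end
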